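(* Let $n\ge 1$, let $0=t_0<t_1<\dots<t_n=1$, let $W_0,W_1,\dots,W_n\in\mathbb{R}$ with $W_0=W_n=0$, let $\gamma:[0,1]\to\mathbb{R}$ be the piecewise linear interpolation of the points $(t_k,W_k)$, let $\mathcal{U}=\{x+iy : 0<x<1,\ y<\gamma(x)\}$ and $\Gamma=\{x+i\gamma(x) : 0\le x\le 1\}$. Regard $\partial\mathcal{U}$ as a polygon with vertices $w_1,\dots,w_{n+1},w_{n+2}$, where $w_k=t_{k-1}+iW_{k-1}$ for $k=1,\dots,n+1$ and $w_{n+2}=\infty$. Let $\mathbb{H}^-=\{x+iy : x\in\mathbb{R},\ y<0\}$ and consider the Schwarz–Christoffel mapping $\varphi:\mathbb{H}^-\to\mathcal{U}$ (a conformal bijection) with pre-vertices $0=z_1<z_2<\dots<z_{n+1}=1$ and $z_{n+2}=\infty$, i.e. whose continuous extension to the boundary satisfies $\varphi(z_k)=w_k$ for $k=1,\dots,n+2$. Then for each $k=1,\dots,n$, the edge $E_k$, defined as the line segment joining $t_{k-1}+iW_{k-1}$ to $t_k+iW_k$, satisfies $$\widetilde{\omega}(E_k,\Gamma,\infty)=\frac{2}{\pi}\left(\sin^{-1}\left(\sqrt{z_{k+1}}\right)-\sin^{-1}\left(\sqrt{z_k}\right)\right),$$ where $\widetilde{\omega}(\cdot,\Gamma,\infty)$ is the limiting hitting distribution on $\Gamma$, from $-i\infty$, of reflected Brownian motion in the strip (as defined in the context).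
   Context: The interpolating function is $$\gamma(t)=\sum_{k=1}^n \mathbf{1}_{(t_{k-1},t_k]}(t)\left(\frac{t_k-t}{t_k-t_{k-1}}W_{k-1}+\frac{t-t_{k-1}}{t_k-t_{k-1}}W_k\right),\qquad t\in[0,1].$$ Let $(B_t)_{t\ge 0}$ be a two-dimensional Brownian motion, viewed as running in $\mathbb{C}$. The reflected Brownian motion constrained to the strip $\{0\le\mathrm{Re}\le 1\}$ is $$\mathcal{R}(B_t)=\pi^{-1}\cos^{-1}\big(\cos(\pi\,\mathrm{Re}(B_t))\big)+i\,\mathrm{Im}(B_t),$$ where $\cos^{-1}:[-1,1]\to[0,\pi]$. The hitting time of $\Gamma$ is $\widetilde{\tau}(\Gamma)=\min\{t : \mathcal{R}(B_t)\in\Gamma\}$. For $z\in\mathcal{U}$ and Borel $E\subseteq\Gamma$, $$\widetilde{\omega}(E,\Gamma,z)=\mathbf{P}\big(\mathcal{R}(B_{\widetilde{\tau}(\Gamma)})\in E \,\big|\, B_0=z\big).$$ The measure $\widetilde{\omega}(\cdot,\Gamma,\infty)$ is the weak limit (which exists) of $\widetilde{\omega}(\cdot,\Gamma,z)$ as $|z|\to\infty$ with $z\in\mathcal{U}$. The Schwarz–Christoffel mapping is the conformal bijection written in the form $$\varphi(z)=A+C\int^z\prod_{k=1}^{n+1}(\zeta-z_k)^{\alpha_k-1}\,d\zeta,\qquad A\in\mathbb{C},\ C\in\mathbb{C}\setminus\{0\},$$ where $\alpha_k\pi$ is the interior angle of $\mathcal{U}$ at $w_k$, and the powers use the branch of the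 logarithm cut along the positive imaginary axis with $\arg(x)=0$ and $\arg(-x)=-\pi$ for $x>0$. The points $z_k\in\mathbb{R}\cup\{\infty\}$ with $\varphi(z_k)=w_k$ are called the pre-vertices. Here $\sin^{-1}:[-1,1]\to[-\pi/2,\pi/2]$. *)

theory Defs
  imports "HOL-Probability.Probability" "HOL-Complex_Analysis.Complex_Analysis"
begin

section \<open>The polygonal curve and the domain below it\<close>

definition interpolant :: "nat \<Rightarrow> (nat \<Rightarrow> real) \<Rightarrow> (nat \<Rightarrow> real) \<Rightarrow> real \<Rightarrow> real" where
  "interpolant n t W s =
     (\<Sum>k=1..n. indicator {t (k - 1)<..t k} s *
        ((t k - s) / (t k - t (k - 1)) * W (k - 1) + (s - t (k - 1)) / (t k - t (k - 1)) * W k))"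

definition strip_below :: "(real \<Rightarrow> real) \<Rightarrow> complex set" where
  "strip_below \<gamma> = {w. 0 < Re w \<and> Re w < 1 \<and> Im w < \<gamma> (Re w)}"

definition curve_graph :: "(real \<Rightarrow> real) \<Rightarrow> complex set" where
  "curve_graph \<gamma> = (\<lambda>x. Complex x (\<gamma> x)) ` {0..1}"

text \<open>The finite vertices \<open>w\<^sub>k\<close>, \<open>1 \<le> k \<le> n + 1\<close>; the remaining vertex is \<open>\<infinity>\<close>.\<close>

definition vertex :: "(nat \<Rightarrow> real) \<Rightarrow> (nat \<Rightarrow> real) \<Rightarrow> nat \<Rightarrow> complex" where
  "vertex t W k = Complex (t (k - 1)) (W (k - 1))"


section \<open>Reflected Brownian motion in the strip\<close>

definition planar_brownian_motion ::
    "'a measure \<Rightarrow> (real \<Rightarrow> 'a \<Rightarrow> complex) \<Rightarrow> complex \<Rightarrow> bool" where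
  "planar_brownian_motion M B z \<longleftrightarrow>
     prob_space M \<and>
     (\<forall>t\<ge>0. B t \<in> borel_measurable M) \<and>
     (\<forall>\<omega>\<in>space M. continuous_on {0..} (\<lambda>t. B t \<omega>)) \<and>
     (AE \<omega> in M. B 0 \<omega> = z) \<and>
     (\<forall>(s :: nat \<Rightarrow> real) m. 0 \<le> s 0 \<and> strict_mono s \<longrightarrow>
        prob_space.indep_vars M (\<lambda>_. borel) (\<lambda>i \<omega>. B (s (Suc i)) \<omega> - B (s i) \<omega>) {..<m}) \<and>
     (\<forall>s t. 0 \<le> s \<and> s < t \<longrightarrow>
        distributed M lborel (\<lambda>\<omega>. Re (B t \<omega> - B s \<omega>)) (normal_density 0 (sqrt (t - s))) \<and>
        distributed M lborel (\<lambda>\<omega>. Im (B t \<omega> - B s \<omega>)) (normal_density 0 (sqrt (t - s))) \<and>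
        prob_space.indep_var M borel (\<lambda>\<omega>. Re (B t \<omega> - B s \<omega>)) borel (\<lambda>\<omega>. Im (B t \<omega> - B s \<omega>)))"

definition reflect_strip :: "complex \<Rightarrow> complex" where
  "reflect_strip w = Complex (arccos (cos (pi * Re w)) / pi) (Im w)"

text \<open>For a closed set \<open>\<Gamma>\<close> and a continuous path that meets \<open>\<Gamma>\<close> the infimum is attained,
  so it is a minimum; if the path never meets \<open>\<Gamma>\<close> the value carries no meaning.\<close>

definition hitting_time :: "(real \<Rightarrow> 'a \<Rightarrow> complex) \<Rightarrow> complex set \<Rightarrow> 'a \<Rightarrow> real" where
  "hitting_time B \<Gamma> \<omega> = Inf {t. 0 \<le> t \<and> reflect_strip (B t \<omega>) \<in> \<Gamma>}"

text \<open>The law of the first hitting point, as a measure on the Borel subsets of \<open>\<Gamma>\<close>. The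
  restriction to the event that \<open>\<Gamma>\<close> is hit makes the mass of \<open>E\<close> the probability that \<open>\<Gamma>\<close> is
  hit, and first hit in \<open>E\<close>. If \<open>B\<close> is a Brownian motion from \<open>z\<close> under \<open>M\<close>, this is the
  harmonic measure seen from \<open>z\<close>.\<close>

definition hitting_measure ::
    "'a measure \<Rightarrow> (real \<Rightarrow> 'a \<Rightarrow> complex) \<Rightarrow> complex set \<Rightarrow> complex measure" where
  "hitting_measure M B \<Gamma> =
     distr (restrict_space M {\<omega> \<in> space M. \<exists>t\<ge>0. reflect_strip (B t \<omega>) \<in> \<Gamma>})
       (restrict_space borel \<Gamma>)
       (\<lambda>\<omega>. reflect_strip (B (hitting_time B \<Gamma> \<omega>) \<omega>))"

text \<open>Weak convergence of measures on a subset \<open>\<Gamma>\<close> of the plane along a filter.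
  (The library's weak convergence is for sequences of measures on the real line.)\<close>

definition weak_limit ::
    "complex set \<Rightarrow> ('b \<Rightarrow> complex measure) \<Rightarrow> 'b filter \<Rightarrow> complex measure \<Rightarrow> bool" where
  "weak_limit \<Gamma> \<nu> F \<mu> \<longleftrightarrow>
     finite_measure \<mu> \<and> sets \<mu> = sets (restrict_space borel \<Gamma>) \<and>
     (\<forall>f :: complex \<Rightarrow> real. continuous_on \<Gamma> f \<and> bounded (f ` \<Gamma>) \<longrightarrow>
        ((\<lambda>z. integral\<^sup>L (\<nu> z) f) \<longlongrightarrow> integral\<^sup>L \<mu> f) F)"

text \<open>\<open>P z\<close> is the law under which the Brownian motion \<open>B\<close> starts at \<open>z\<close>; the starting
  point tends to infinity inside \<open>U\<close>. Weak limits of measures on \<open>\<Gamma>\<close> are unique.\<close>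

definition hitting_measure_infinity ::
    "(complex \<Rightarrow> 'a measure) \<Rightarrow> (real \<Rightarrow> 'a \<Rightarrow> complex) \<Rightarrow> complex set \<Rightarrow> complex set
      \<Rightarrow> complex measure" where
  "hitting_measure_infinity P B U \<Gamma> =
     (THE \<mu>. weak_limit \<Gamma> (\<lambda>z. hitting_measure (P z) B \<Gamma>) (inf at_infinity (principal U)) \<mu>)"


section \<open>Schwarz--Christoffel mappings\<close>

definition lower_half_plane :: "complex set" where
  "lower_half_plane = {z. Im z < 0}"

text \<open>The branch of the logarithm cut along the positive imaginary axis, with imaginary
  part \<open>0\<close> on the positive and \<open>-\<pi>\<close> on the negative real axis.\<close>

definition Ln_down :: "complex \<Rightarrow> complex" where
  "Ln_down \<zeta> = Ln (\<i> * \<zeta>) - \<i> * complex_of_real (pi / 2)"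

definition powr_down :: "complex \<Rightarrow> real \<Rightarrow> complex" where
  "powr_down \<zeta> a = exp (complex_of_real a * Ln_down \<zeta>)"

text \<open>The number \<open>\<alpha>\<^sub>k\<close> such that \<open>\<alpha>\<^sub>k \<pi>\<close> is the interior angle at the finite vertex \<open>w\<^sub>k\<close> of
  a polygon with vertices \<open>w\<^sub>1, \<dots>, w\<^bsub>n+1\<^esub>, \<infinity>\<close> whose two unbounded edges go vertically downwards
  from \<open>w\<^sub>1\<close> and \<open>w\<^bsub>n+1\<^esub>\<close>. Since the region lies to the right when the vertices are visited
  in order, one sweeps the interior by turning the edge towards the preceding vertex
  counterclockwise onto the edge towards the following vertex.\<close>

definition interior_angle :: "nat \<Rightarrow> (nat \<Rightarrow> complex) \<Rightarrow> nat \<Rightarrow> real" where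
  "interior_angle n w k =
     (let prev = (if k = 1 then - \<i> else w (k - 1) - w k);
          succ = (if k = n + 1 then - \<i> else w (k + 1) - w k)
      in Arg2pi (succ / prev) / pi)"

text \<open>\<open>\<phi>\<close> is a conformal bijection of the lower half-plane onto \<open>U\<close> of Schwarz--Christoffel
  form, and its values on the real line are those of its continuous extension to the closed
  half-plane. The pre-vertices are \<open>z\<^sub>1, \<dots>, z\<^bsub>n+1\<^esub>\<close> for \<open>w\<^sub>1, \<dots>, w\<^bsub>n+1\<^esub>\<close>, and \<open>\<infinity>\<close> for \<open>\<infinity>\<close>.
  The base point \<open>b\<close> of the integral is arbitrary, as changing it only changes \<open>A\<close>.\<close>

definition schwarz_christoffel_map ::
    "nat \<Rightarrow> (nat \<Rightarrow> complex) \<Rightarrow> complex set \<Rightarrow> (nat \<Rightarrow> real) \<Rightarrow> (complex \<Rightarrow> complex) \<Rightarrow> bool" where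
  "schwarz_christoffel_map n w U z \<phi> \<longleftrightarrow>
     \<phi> holomorphic_on lower_half_plane \<and> bij_betw \<phi> lower_half_plane U \<and>
     (\<exists>A C. C \<noteq> 0 \<and> (\<exists>b\<in>lower_half_plane. \<forall>x\<in>lower_half_plane.
        \<phi> x = A + C * contour_integral (linepath b x)
          (\<lambda>\<zeta>. \<Prod>k=1..n+1. powr_down (\<zeta> - complex_of_real (z k)) (interior_angle n w k - 1)))) \<and>
     continuous_on (closure lower_half_plane) \<phi> \<and>
     (\<forall>k\<in>{1..n+1}. \<phi> (complex_of_real (z k)) = w k) \<and>
     filterlim \<phi> at_infinity (inf at_infinity (principal (closure lower_half_plane)))"

end

theory Submission
  imports Defs
begin

text \<open>Let \<open>\<psi> u = \<phi> ((1 - cos (\<pi> * u)) / 2)\<close>, a conformal map of the half strip \<open>0 < Re u < 1\<close>,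
  \<open>Im u < 0\<close> onto the domain which carries vertical sides to vertical sides and \<open>[0, 1]\<close> to the curve.
  The functions \<open>h\<^sub>m = Re (exp (- \<i> * m * \<pi> * \<psi>\<^sup>-\<^sup>1))\<close> are bounded, harmonic, and by Schwarz
  reflection extend harmonically across the vertical sides. Hence \<open>h\<^sub>m\<close> of the reflected Brownian motion
  is a martingale up to the hitting time, and the integral of \<open>h\<^sub>m\<close> against the hitting measure from \<open>z\<close>
  is \<open>h\<^sub>m z\<close>, which tends to \<open>0\<close> at infinity for \<open>m \<ge> 1\<close>. On the curve \<open>h\<^sub>m\<close> is \<open>cos (m * \<pi> * u)\<close>,
  so by the Weierstrass theorem the hitting measures converge to the image under \<open>\<psi>\<close> of the
  uniform distribution on \<open>[0, 1]\<close>; and \<open>(1 - cos (\<pi> * u)) / 2 = sin\<^sup>2 (\<pi> * u / 2)\<close>.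

  The martingale property needs no stochastic calculus: on a time grid of mesh \<open>\<delta>\<close>, as long as the
  path keeps a distance \<open>\<epsilon>\<close> from the boundary, rotation invariance of the Gaussian increments and the
  mean value property make the error of one step \<open>O (\<delta>\<^sup>2)\<close>. One lets first \<open>\<delta>\<close> and then \<open>\<epsilon>\<close> tend to 0.\<close>

text \<open>The reflection is removed by unfolding: the reflected path is on the curve exactly when
  the planar path is on the graph of the even 2-periodic extension of \<gamma>, so only planar
  Brownian motion is ever stopped. Schwarz reflection unfolds the conformal map in the same way, up
  to a conjugation that real parts do not see.

  The error of one step is O(\<delta>^2) because, by fourth moments, a Gaussian step exceeds
  \<epsilon> with probability O(\<delta>^2 / \<epsilon>^4); second moments would give only
  O(\<delta>), which does not vanish when summed over T / \<delta> steps. The set to be entered is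
  first replaced by open neighbourhoods, since a time grid can step over a closed set.

  That \<phi> maps boundary intervals to straight sides is read off from the constant argument of
  the integrand. On a finite edge the direction follows from the images of the two end points; on
  the two vertical sides, with one end at infinity, it is found by turning the adjacent edge through
  the interior angle.\<close>

section \<open>Rotation invariance of the planar Gaussian law\<close>

text \<open>By Fubini: for a fixed second coordinate \<open>y\<close> the shear is the translation
  by \<open>a * y\<close>, under which one-dimensional Lebesgue measure is invariant.\<close>

lemma lborel_shear_fst:
  "distr lborel borel (\<lambda>p. (fst p + a * snd p, snd p)) = (lborel :: (real \<times> real) measure)"
proof (rule measure_eqI)
  fix A :: "(real \<times> real) set" assume "A \<in> sets (distr lborel borel (\<lambda>p. (fst p + a * snd p, snd p)))"
  then have A: "A \<in> sets borel" by simp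
  have m: "(\<lambda>p. (fst p + a * snd p, snd p)) \<in> borel_measurable (borel :: (real \<times> real) measure)"
    by (intro borel_measurable_continuous_onI continuous_intros)
  let ?B = "(\<lambda>p. (fst p + a * snd p, snd p)) -` A :: (real \<times> real) set"
  have B: "?B \<in> sets borel" using measurable_sets[OF m A] by simp
  have A': "A \<in> sets (lborel \<Otimes>\<^sub>M lborel)" and B': "?B \<in> sets (lborel \<Otimes>\<^sub>M lborel)"
    unfolding lborel_prod using A B by simp_all
  have "emeasure (distr lborel borel (\<lambda>p. (fst p + a * snd p, snd p))) A = emeasure lborel ?B"
    using m A by (subst emeasure_distr) auto
  also have "\<dots> = emeasure (lborel \<Otimes>\<^sub>M lborel) ?B" by (simp add: lborel_prod)
  also have "\<dots> = (\<integral>\<^sup>+y. emeasure lborel ((\<lambda>x. (x, y)) -` ?B) \<partial>lborel)"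
    by (rule lborel_pair.emeasure_pair_measure_alt2[OF B'])
  also have "\<dots> = (\<integral>\<^sup>+y. emeasure lborel ((\<lambda>x. (x, y)) -` A) \<partial>lborel)"
  proof (rule nn_integral_cong)
    fix y :: real
    have S: "(\<lambda>x. (x, y)) -` A \<in> sets lborel"
      using sets_Pair2[OF A'] by simp
    have "emeasure lborel ((\<lambda>x. (x, y)) -` A) = emeasure (distr lborel borel ((+) (a * y))) ((\<lambda>x. (x, y)) -` A)"
      by (simp add: lborel_distr_plus)
    also have "\<dots> = emeasure lborel ((+) (a * y) -` ((\<lambda>x. (x, y)) -` A))"
      using S by (subst emeasure_distr) auto
    also have "(+) (a * y) -` ((\<lambda>x. (x, y)) -` A) = (\<lambda>x. (x, y)) -` ?B"
      by (auto simp: add.commute)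
    finally show "emeasure lborel ((\<lambda>x. (x, y)) -` ?B) = emeasure lborel ((\<lambda>x. (x, y)) -` A)" by simp
  qed
  also have "\<dots> = emeasure (lborel \<Otimes>\<^sub>M lborel) A"
    by (rule lborel_pair.emeasure_pair_measure_alt2[OF A', symmetric])
  finally show "emeasure (distr lborel borel (\<lambda>p. (fst p + a * snd p, snd p))) A = emeasure lborel A"
    by (simp add: lborel_prod)
qed simp

lemma lborel_swap:
  "distr lborel borel (\<lambda>p. (snd p, fst p)) = (lborel :: (real \<times> real) measure)"
proof -
  have "distr lborel borel f = distr lborel lborel f" for f :: "real \<times> real \<Rightarrow> real \<times> real"
    by (rule distr_cong) auto
  then show ?thesis
    using lborel_pair.distr_pair_swap[where 'a=real and 'b=real]
    by (simp add: lborel_prod case_prod_beta')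
qed

lemma lborel_shear_snd:
  "distr lborel borel (\<lambda>p. (fst p, snd p + a * fst p)) = (lborel :: (real \<times> real) measure)"
proof -
  let ?s = "\<lambda>p :: real \<times> real. (snd p, fst p)" and ?h = "\<lambda>p :: real \<times> real. (fst p + a * snd p, snd p)"
  have m: "?s \<in> borel_measurable borel" "?h \<in> borel_measurable borel"
    by (intro borel_measurable_continuous_onI continuous_intros)+
  have "distr lborel borel (?s \<circ> (?h \<circ> ?s)) = distr (distr (distr lborel borel ?s) borel ?h) borel ?s"
    using m by (simp add: distr_distr comp_assoc)
  also have "\<dots> = lborel" by (simp add: lborel_swap lborel_shear_fst)
  finally show ?thesis by (simp add: o_def)
qed

text \<open>A rotation other than the half turn is a product of three shears.\<close>

lemma lborel_rotate:
  assumes "c\<^sup>2 + s\<^sup>2 = (1 :: real)"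
  shows "distr lborel borel (\<lambda>p. (c * fst p - s * snd p, s * fst p + c * snd p))
    = (lborel :: (real \<times> real) measure)"
proof -
  have *: "distr lborel borel (\<lambda>p. (c * fst p - s * snd p, s * fst p + c * snd p))
    = (lborel :: (real \<times> real) measure)"
    if cs: "c\<^sup>2 + s\<^sup>2 = 1" and c: "c \<noteq> - 1" for c s :: real
  proof -
    \<comment> \<open>\<open>T\<close> is the tangent of half the rotation angle; the rotation is
      the horizontal shear by \<open>- T\<close>, then the vertical shear by \<open>s\<close>, then
      the horizontal one again.\<close>
    define T where "T = s / (1 + c)"
    have T1: "T * (1 + c) = s" using c by (simp add: T_def add_eq_0_iff)
    have "T * s * (1 + c) = T * (1 + c) * s" by (simp only: ac_simps)
    also have "\<dots> = (1 - c) * (1 + c)" unfolding T1 using cs by (simp add: power2_eq_square algebra_simps)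
    finally have T2: "T * s = 1 - c" using c by (simp add: add_eq_0_iff)
    let ?f = "\<lambda>p :: real \<times> real. (fst p + (-T) * snd p, snd p)" and ?g = "\<lambda>p :: real \<times> real. (fst p, snd p + s * fst p)"
    have m: "?f \<in> borel_measurable borel" "?g \<in> borel_measurable borel"
      by (intro borel_measurable_continuous_onI continuous_intros)+
    have "distr lborel borel (?f \<circ> (?g \<circ> ?f)) = distr (distr (distr lborel borel ?f) borel ?g) borel ?f"
      using m by (simp add: distr_distr comp_assoc)
    also have "\<dots> = lborel" by (simp only: lborel_shear_snd lborel_shear_fst)
    also have "?f \<circ> (?g \<circ> ?f) = (\<lambda>p. (c * fst p - s * snd p, s * fst p + c * snd p))"
    proof (rule ext)
      fix p :: "real \<times> real" obtain x y where p: "p = (x, y)" by force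
      have "y + s * (x - T * y) = y + s * x - (T * s) * y" by (simp add: algebra_simps)
      then have 1: "y + s * (x - T * y) = s * x + c * y" by (simp only: T2) (simp add: algebra_simps)
      have "x - T * y - T * (s * x + c * y) = x - (T * s) * x - T * (1 + c) * y"
        by (simp add: algebra_simps)
      then have 2: "x - T * y - T * (s * x + c * y) = c * x - s * y"
        by (simp only: T1 T2) (simp add: algebra_simps)
      show "(?f \<circ> (?g \<circ> ?f)) p = (c * fst p - s * snd p, s * fst p + c * snd p)"
        using 1 2 by (simp add: p)
    qed
    finally show ?thesis .
  qed
  show ?thesis
  proof (cases "c = - 1")
    case False then show ?thesis using * assms by blast
  next
    case True
    then have s: "s = 0" using assms by simp
    \<comment> \<open>The half turn, for which \<open>1 + c\<close> vanishes, is a quarter turn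
      applied twice.\<close>
    let ?r = "\<lambda>p :: real \<times> real. (0 * fst p - 1 * snd p, 1 * fst p + 0 * snd p)"
    have m: "?r \<in> borel_measurable borel" by (intro borel_measurable_continuous_onI continuous_intros)
    have "distr lborel borel (?r \<circ> ?r) = distr (distr lborel borel ?r) borel ?r"
      using m by (subst distr_distr) auto
    also have "\<dots> = lborel" using *[of 0 1] by simp
    finally show ?thesis by (simp add: True s o_def)
  qed
qed

text \<open>The increment of a planar Brownian motion over a time interval of length \<open>\<sigma>\<^sup>2\<close>.\<close>

definition (in prob_space) gaussian2 :: "real \<Rightarrow> ('a \<Rightarrow> complex) \<Rightarrow> bool" where
  "gaussian2 \<sigma> \<xi> \<longleftrightarrow> \<xi> \<in> borel_measurable M \<and>
     distributed M lborel (\<lambda>\<omega>. Re (\<xi> \<omega>)) (normal_density 0 \<sigma>) \<and>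
     distributed M lborel (\<lambda>\<omega>. Im (\<xi> \<omega>)) (normal_density 0 \<sigma>) \<and>
     indep_var borel (\<lambda>\<omega>. Re (\<xi> \<omega>)) borel (\<lambda>\<omega>. Im (\<xi> \<omega>))"

lemma (in prob_space) gaussian2_expectation:
  fixes F :: "complex \<Rightarrow> real"
  assumes g: "gaussian2 \<sigma> \<xi>" and F: "F \<in> borel_measurable borel"
  shows "expectation (\<lambda>\<omega>. F (\<xi> \<omega>)) =
    (\<integral>p. (normal_density 0 \<sigma> (fst p) * normal_density 0 \<sigma> (snd p)) * F (Complex (fst p) (snd p)) \<partial>lborel)"
proof -
  let ?N = "\<lambda>x. ennreal (normal_density 0 \<sigma> x)"
  have X: "distributed M lborel (\<lambda>\<omega>. Re (\<xi> \<omega>)) ?N" and Y: "distributed M lborel (\<lambda>\<omega>. Im (\<xi> \<omega>)) ?N"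
    and i: "indep_var borel (\<lambda>\<omega>. Re (\<xi> \<omega>)) borel (\<lambda>\<omega>. Im (\<xi> \<omega>))"
    using g by (auto simp: gaussian2_def)
  have i': "indep_var lborel (\<lambda>\<omega>. Re (\<xi> \<omega>)) lborel (\<lambda>\<omega>. Im (\<xi> \<omega>))"
    using indep_var_compose[OF i, of "\<lambda>x. x" lborel "\<lambda>x. x" lborel] by (simp add: o_def)
  have J: "distributed M (lborel \<Otimes>\<^sub>M lborel) (\<lambda>\<omega>. (Re (\<xi> \<omega>), Im (\<xi> \<omega>))) (\<lambda>(x, y). ?N x * ?N y)"
    by (rule distributed_joint_indep[OF _ _ X Y i']) (unfold_locales)
  then have J': "distributed M lborel (\<lambda>\<omega>. (Re (\<xi> \<omega>), Im (\<xi> \<omega>)))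
      (\<lambda>p. ennreal (normal_density 0 \<sigma> (fst p) * normal_density 0 \<sigma> (snd p)))"
    by (simp add: lborel_prod case_prod_beta' ennreal_mult)
  have c: "(\<lambda>p. Complex (fst p) (snd p)) \<in> borel_measurable borel"
    by (intro borel_measurable_continuous_onI continuous_intros)
  have "(\<integral>p. (normal_density 0 \<sigma> (fst p) * normal_density 0 \<sigma> (snd p)) * F (Complex (fst p) (snd p)) \<partial>lborel)
     = expectation (\<lambda>\<omega>. F (Complex (Re (\<xi> \<omega>)) (Im (\<xi> \<omega>))))"
    using distributed_integral[OF J', of "\<lambda>p. F (Complex (fst p) (snd p))"] F c
    by simp
  then show ?thesis by simp
qed

text \<open>The joint density depends on \<open>x\<^sup>2 + y\<^sup>2\<close> only, so a rotation of
  the variables in the Lebesgue integral leaves it unchanged.\<close>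

lemma (in prob_space) gaussian2_rotate:
  fixes F :: "complex \<Rightarrow> real"
  assumes g: "gaussian2 \<sigma> \<xi>" and F[measurable]: "F \<in> borel_measurable borel"
  shows "expectation (\<lambda>\<omega>. F (cis \<theta> * \<xi> \<omega>)) = expectation (\<lambda>\<omega>. F (\<xi> \<omega>))"
proof -
  define c s where cs: "c = cos \<theta>" "s = sin \<theta>"
  have 1: "c\<^sup>2 + s\<^sup>2 = 1" by (simp add: cs)
  let ?R = "\<lambda>p. (c * fst p - s * snd p, s * fst p + c * snd p)"
  have R: "?R \<in> borel_measurable borel" by (intro borel_measurable_continuous_onI continuous_intros)
  have c[measurable]: "(\<lambda>p. Complex (fst p) (snd p)) \<in> borel_measurable borel"
    by (intro borel_measurable_continuous_onI continuous_intros)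
  let ?f = "\<lambda>p. normal_density 0 \<sigma> (fst p) * normal_density 0 \<sigma> (snd p)"
  have f: "?f (?R p) = ?f p" for p
  proof -
    obtain x y where p: "p = (x, y)" by force
    have "(c * x - s * y)\<^sup>2 + (s * x + c * y)\<^sup>2 = (c\<^sup>2 + s\<^sup>2) * (x\<^sup>2 + y\<^sup>2)"
      by (simp add: power2_eq_square algebra_simps)
    then have "(c * x - s * y)\<^sup>2 + (s * x + c * y)\<^sup>2 = x\<^sup>2 + y\<^sup>2" using 1 by simp
    moreover have "normal_density 0 \<sigma> u * normal_density 0 \<sigma> v =
        1 / (2 * pi * \<sigma>\<^sup>2) * exp (- (u\<^sup>2 + v\<^sup>2) / (2 * \<sigma>\<^sup>2))" for u v
      by (simp add: normal_density_def add_divide_distrib diff_divide_distrib flip: exp_add)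
    ultimately show ?thesis by (simp add: p)
  qed
  have [measurable]: "fst \<in> borel_measurable (borel :: (real \<times> real) measure)"
      "snd \<in> borel_measurable (borel :: (real \<times> real) measure)"
    by (intro borel_measurable_continuous_onI continuous_intros)+
  have m0: "(\<lambda>p. ?f p * F (Complex (fst p) (snd p))) \<in> borel_measurable borel" by measurable
  have m: "(\<lambda>\<xi>. F (cis \<theta> * \<xi>)) \<in> borel_measurable borel" by measurable
  have "expectation (\<lambda>\<omega>. F (\<xi> \<omega>)) = (\<integral>p. ?f p * F (Complex (fst p) (snd p)) \<partial>(distr lborel borel ?R))"
    by (simp add: lborel_rotate[OF 1] gaussian2_expectation[OF g F])
  also have "\<dots> = (\<integral>p. ?f (?R p) * F (Complex (fst (?R p)) (snd (?R p))) \<partial>lborel)"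
    using R m0 by (subst integral_distr) auto
  also have "\<dots> = (\<integral>p. ?f p * F (cis \<theta> * Complex (fst p) (snd p)) \<partial>lborel)"
  proof -
    have "Complex (fst (?R p)) (snd (?R p)) = cis \<theta> * Complex (fst p) (snd p)" for p
      by (simp add: complex_eq_iff cs)
    then show ?thesis unfolding f by simp
  qed
  also have "\<dots> = expectation (\<lambda>\<omega>. F (cis \<theta> * \<xi> \<omega>))"
    by (simp add: gaussian2_expectation[OF g m])
  finally show ?thesis by simp
qed

text \<open>The law of \<open>\<xi>\<close> equals its average over all rotations, and Fubini moves
  the mean over the circle inside the expectation. This takes the place of polar
  coordinates.\<close>

lemma (in prob_space) gaussian2_circle_mean_zero:
  fixes F :: "complex \<Rightarrow> real"
  assumes g: "gaussian2 \<sigma> \<xi>" and F[measurable]: "F \<in> borel_measurable borel"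
    and b: "\<And>y. \<bar>F y\<bar> \<le> H"
    and mean: "\<And>y. integral\<^sup>L (restrict_space lborel {0..2*pi}) (\<lambda>\<theta>. F (cis \<theta> * y)) = 0"
  shows "expectation (\<lambda>\<omega>. F (\<xi> \<omega>)) = 0"
proof -
  let ?L = "restrict_space lborel {0..2*pi :: real}"
  have [measurable]: "\<xi> \<in> borel_measurable M" using g by (simp add: gaussian2_def)
  interpret L: finite_measure ?L
    by standard (simp add: emeasure_restrict_space space_restrict_space)
  interpret P: pair_sigma_finite M ?L ..
  have sp: "space ?L = {0..2*pi}" by (simp add: space_restrict_space)
  have cis[measurable]: "cis \<in> borel_measurable ?L"
    by (intro measurable_restrict_space1) (auto intro!: borel_measurable_continuous_onI continuous_intros)
  have fin: "finite_measure (M \<Otimes>\<^sub>M ?L)"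
    by (intro finite_measure_pair_measure) unfold_locales
  have int: "integrable (M \<Otimes>\<^sub>M ?L) (\<lambda>(\<omega>, \<theta>). F (cis \<theta> * \<xi> \<omega>))"
    by (intro finite_measure.integrable_const_bound[OF fin, where B=H] AE_I2)
       (auto simp: b)
  have "2 * pi * expectation (\<lambda>\<omega>. F (\<xi> \<omega>)) = (\<integral>\<theta>. expectation (\<lambda>\<omega>. F (cis \<theta> * \<xi> \<omega>)) \<partial>?L)"
    by (simp add: gaussian2_rotate[OF g F] measure_restrict_space sp)
  also have "\<dots> = (\<integral>\<omega>. (\<integral>\<theta>. F (cis \<theta> * \<xi> \<omega>) \<partial>?L) \<partial>M)"
    by (rule P.Fubini_integral[OF int])
  also have "\<dots> = 0" by (simp add: mean)
  finally show ?thesis by simp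
qed

section \<open>Stopped Gaussian random walks\<close>

text \<open>Mean value property for the circle about \<open>x\<close> through \<open>x + y\<close>.
  The difference quotient of \<open>f w = g (x + w * y)\<close> at 0 has a removable singularity, so
  its integral over the unit circle vanishes by Cauchy's theorem; parametrised by
  \<open>cis\<close>, this is the integral of \<open>\<i> * (f (cis t) - f 0)\<close>.\<close>

lemma circle_mean_zero:
  assumes g: "g holomorphic_on ball x \<epsilon>" and y: "norm y < \<epsilon>"
  shows "integral\<^sup>L (restrict_space lborel {0..2*pi}) (\<lambda>\<theta>. Re (g (x + cis \<theta> * y)) - Re (g x)) = 0"
proof (cases "y = 0")
  case False
  define f where "f = (\<lambda>w. g (x + w * y))"
  let ?D = "ball (0 :: complex) (\<epsilon> / norm y)"
  have "norm (w * y) < \<epsilon>" if "w \<in> ?D" for w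
    using that False by (simp add: norm_mult field_simps)
  then have img: "(\<lambda>w. x + w * y) ` ?D \<subseteq> ball x \<epsilon>" by (auto simp: dist_norm)
  have fh: "f holomorphic_on ?D"
    unfolding f_def
    by (rule holomorphic_on_compose_gen[OF _ g img, unfolded o_def]) (intro holomorphic_intros)
  let ?k = "\<lambda>w. if w = 0 then deriv f 0 else (f w - f 0) / (w - 0)"
  have kh: "?k holomorphic_on ?D" by (rule pole_lemma_open[OF fh]) simp
  have sub: "path_image (part_circlepath 0 1 0 (2*pi)) \<subseteq> ?D"
    using y False by (auto simp: path_image_part_circlepath' norm_mult)
  have "(?k has_contour_integral 0) (part_circlepath 0 1 0 (2*pi))"
    by (rule Cauchy_theorem_convex_simple[OF kh _ _ sub])
       (simp_all add: exp_two_pi_i mult_ac)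
  then have "((\<lambda>t. ?k (cis t) * \<i> * cis t) has_integral 0) {0..2*pi}"
    by (subst (asm) has_contour_integral_part_circlepath_iff) simp_all
  then have "((\<lambda>t. \<i> * (f (cis t) - f 0)) has_integral 0) {0..2*pi}"
    by (simp add: cis_neq_zero mult.commute)
  then have "((\<lambda>t. Im (\<i> * (f (cis t) - f 0))) has_integral Im 0) {0..2*pi}"
    by (rule has_integral_Im)
  then have I: "((\<lambda>t. Re (g (x + cis t * y)) - Re (g x)) has_integral 0) {0..2*pi}"
    by (simp add: f_def)
  have cf: "continuous_on {0..2*pi} (\<lambda>t. f (cis t))"
    by (rule continuous_on_compose2[OF holomorphic_on_imp_continuous_on[OF fh]])
       (use y False in \<open>auto intro!: continuous_intros\<close>)
  then have "continuous_on {0..2*pi} (\<lambda>t. Re (g (x + cis t * y)) - Re (g x))"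
    unfolding f_def by (intro continuous_intros)
  then have "set_integrable lborel {0..2*pi} (\<lambda>t. Re (g (x + cis t * y)) - Re (g x))"
    by (rule borel_integrable_atLeastAtMost')
  from set_borel_integral_eq_integral(2)[OF this] I show ?thesis
    by (simp add: integral_restrict_space set_lebesgue_integral_def integral_unique)
qed simp

text \<open>Markov's inequality for the fourth power: each coordinate has fourth moment
  \<open>3 * \<sigma> ^ 4\<close>, and \<open>norm (\<xi> \<omega>) ^ 4\<close> is at most twice the
  sum of the fourth powers of the coordinates, hence the 12.\<close>

lemma (in prob_space) gaussian2_tail:
  assumes g: "gaussian2 \<sigma> \<xi>" and \<sigma>: "0 < \<sigma>" and \<epsilon>: "0 < \<epsilon>"
  shows "prob {\<omega>\<in>space M. \<epsilon> \<le> norm (\<xi> \<omega>)} \<le> 12 * \<sigma> ^ 4 / \<epsilon> ^ 4"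
proof -
  have [measurable]: "\<xi> \<in> borel_measurable M" using g by (simp add: gaussian2_def)
  have mom: "integrable M (\<lambda>\<omega>. X \<omega> ^ 4) \<and> expectation (\<lambda>\<omega>. X \<omega> ^ 4) = 3 * \<sigma> ^ 4"
    if "distributed M lborel X (normal_density 0 \<sigma>)" for X :: "'a \<Rightarrow> real"
  proof -
    have *: "has_bochner_integral lborel (\<lambda>x. normal_density 0 \<sigma> x * x ^ 4) (3 * \<sigma> ^ 4)"
      using normal_moment_even[OF \<sigma>, of 0 2] \<sigma>
      by (simp add: fact_numeral power2_eq_square power4_eq_xxxx field_simps)
    have "integrable M (\<lambda>\<omega>. X \<omega> ^ 4)"
      using distributed_integrable[OF that, of "\<lambda>x. x ^ 4"] * by (auto simp: has_bochner_integral_iff)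
    moreover have "expectation (\<lambda>\<omega>. X \<omega> ^ 4) = 3 * \<sigma> ^ 4"
      using distributed_integral[OF that, of "\<lambda>x. x ^ 4"] * by (auto simp: has_bochner_integral_iff)
    ultimately show ?thesis ..
  qed
  let ?R = "\<lambda>\<omega>. Re (\<xi> \<omega>)" and ?I = "\<lambda>\<omega>. Im (\<xi> \<omega>)"
  have R: "integrable M (\<lambda>\<omega>. ?R \<omega> ^ 4)" "expectation (\<lambda>\<omega>. ?R \<omega> ^ 4) = 3 * \<sigma> ^ 4"
   and I: "integrable M (\<lambda>\<omega>. ?I \<omega> ^ 4)" "expectation (\<lambda>\<omega>. ?I \<omega> ^ 4) = 3 * \<sigma> ^ 4"
    using g mom[of ?R] mom[of ?I] by (auto simp: gaussian2_def)
  have "prob {\<omega>\<in>space M. \<epsilon> \<le> norm (\<xi> \<omega>)} = expectation (indicator {\<omega>\<in>space M. \<epsilon> \<le> norm (\<xi> \<omega>)})"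
    by (subst Bochner_Integration.integral_indicator) (auto intro!: arg_cong[where f=prob])
  also have "\<dots> \<le> expectation (\<lambda>\<omega>. (2 * ?R \<omega> ^ 4 + 2 * ?I \<omega> ^ 4) / \<epsilon> ^ 4)"
  proof (rule integral_mono)
    fix \<omega> assume "\<omega> \<in> space M"
    show "indicator {\<omega>\<in>space M. \<epsilon> \<le> norm (\<xi> \<omega>)} \<omega> \<le> (2 * ?R \<omega> ^ 4 + 2 * ?I \<omega> ^ 4) / \<epsilon> ^ 4"
    proof (cases "\<epsilon> \<le> norm (\<xi> \<omega>)")
      case True
      have "\<epsilon> ^ 4 \<le> norm (\<xi> \<omega>) ^ 4" using True \<epsilon> by (intro power_mono) auto
      also have "\<dots> = ((?R \<omega>)\<^sup>2 + (?I \<omega>)\<^sup>2)\<^sup>2"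
        using power_mult[of "norm (\<xi> \<omega>)" 2 2] by (simp add: cmod_power2)
      also have "\<dots> \<le> 2 * ?R \<omega> ^ 4 + 2 * ?I \<omega> ^ 4"
        using zero_le_power2[of "(?R \<omega>)\<^sup>2 - (?I \<omega>)\<^sup>2"] by (simp add: power2_eq_square power4_eq_xxxx algebra_simps)
      finally show ?thesis using \<epsilon> by (simp add: indicator_def)
    qed (use \<epsilon> in auto)
  qed (use R I in \<open>auto intro!: integrable_real_indicator simp: emeasure_eq_measure\<close>)
  also have "\<dots> = 12 * \<sigma> ^ 4 / \<epsilon> ^ 4" using R I by simp
  finally show ?thesis .
qed

text \<open>For steps shorter than \<epsilon> the increment of \<open>h\<close> has mean zero on
  every circle about \<open>x\<close>. Longer steps change \<open>h\<close> by at most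
  \<open>2 * H\<close>, with the probability bounded in \<open>gaussian2_tail\<close>.\<close>

lemma (in prob_space) gaussian2_step:
  fixes h :: "complex \<Rightarrow> real"
  assumes g: "gaussian2 \<sigma> \<xi>" and \<sigma>: "0 < \<sigma>" and \<epsilon>: "0 < \<epsilon>"
    and h[measurable]: "h \<in> borel_measurable borel" and b: "\<And>y. \<bar>h y\<bar> \<le> H"
    and k: "k holomorphic_on ball x \<epsilon>" "\<And>w. w \<in> ball x \<epsilon> \<Longrightarrow> h w = Re (k w)"
  shows "\<bar>expectation (\<lambda>\<omega>. h (x + \<xi> \<omega>) - h x)\<bar> \<le> 24 * H * \<sigma> ^ 4 / \<epsilon> ^ 4"
proof -
  have [measurable]: "\<xi> \<in> borel_measurable M" using g by (simp add: gaussian2_def)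
  have H: "0 \<le> H" using b[of 0] by linarith
  define F where "F y = (if norm y < \<epsilon> then h (x + y) - h x else 0)" for y
  have [measurable]: "F \<in> borel_measurable borel" unfolding F_def by measurable
  have hb: "\<bar>h y - h x\<bar> \<le> 2 * H" for y using b[of y] b[of x] by linarith
  have Fb: "\<bar>F y\<bar> \<le> 2 * H" for y using hb H by (auto simp: F_def)
  have F0: "expectation (\<lambda>\<omega>. F (\<xi> \<omega>)) = 0"
  proof (rule gaussian2_circle_mean_zero[OF g _ Fb])
    fix y
    have "F (cis \<theta> * y) = (if norm y < \<epsilon> then Re (k (x + cis \<theta> * y)) - Re (k x) else 0)" for \<theta>
      using k(2) \<epsilon> by (auto simp: F_def norm_mult dist_norm)
    then show "integral\<^sup>L (restrict_space lborel {0..2*pi}) (\<lambda>\<theta>. F (cis \<theta> * y)) = 0"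
      using circle_mean_zero[OF k(1), of y] by (cases "norm y < \<epsilon>") simp_all
  qed measurable
  have int: "integrable M (\<lambda>\<omega>. h (x + \<xi> \<omega>) - h x)" "integrable M (\<lambda>\<omega>. F (\<xi> \<omega>))"
    by (rule integrable_const_bound[where B="2 * H"], use hb Fb in auto)+
  let ?A = "{\<omega>\<in>space M. \<epsilon> \<le> norm (\<xi> \<omega>)}"
  have "\<bar>expectation (\<lambda>\<omega>. h (x + \<xi> \<omega>) - h x)\<bar> = \<bar>expectation (\<lambda>\<omega>. (h (x + \<xi> \<omega>) - h x) - F (\<xi> \<omega>))\<bar>"
    using int F0 by simp
  also have "\<dots> \<le> expectation (\<lambda>\<omega>. \<bar>(h (x + \<xi> \<omega>) - h x) - F (\<xi> \<omega>)\<bar>)"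
    by (rule integral_abs_bound)
  also have "\<dots> \<le> expectation (\<lambda>\<omega>. 2 * H * indicator ?A \<omega>)"
  proof (rule integral_mono)
    have "?A \<in> sets M" by measurable
    then show "integrable M (\<lambda>\<omega>. 2 * H * indicator ?A \<omega>)"
      by (intro integrable_mult_right integrable_real_indicator) (auto simp: emeasure_eq_measure)
  qed (use int hb in \<open>auto simp: F_def\<close>)
  also have "\<dots> = 2 * H * prob ?A" by (simp add: Int_absorb1 subset_eq)
  also have "\<dots> \<le> 2 * H * (12 * \<sigma> ^ 4 / \<epsilon> ^ 4)"
    using gaussian2_tail[OF g \<sigma> \<epsilon>] H by (intro mult_left_mono) auto
  finally show ?thesis by simp
qed

text \<open>Freezes the past without conditional expectations: by independence the joint law of
  \<open>V\<close> and \<open>Y\<close> is a product measure, and Fubini integrates over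
  \<open>Y\<close> first, at a fixed value \<open>v\<close> of \<open>V\<close>.\<close>

lemma (in prob_space) indep_expectation_bound:
  fixes f :: "_ \<Rightarrow> real"
  assumes i: "indep_var S V T Y" and f[measurable]: "f \<in> borel_measurable (S \<Otimes>\<^sub>M T)"
    and b: "\<And>p. \<bar>f p\<bar> \<le> H"
    and c: "\<And>v. v \<in> space S \<Longrightarrow> \<bar>expectation (\<lambda>\<omega>. f (v, Y \<omega>))\<bar> \<le> c"
  shows "\<bar>expectation (\<lambda>\<omega>. f (V \<omega>, Y \<omega>))\<bar> \<le> c"
proof -
  have [measurable]: "V \<in> measurable M S" "Y \<in> measurable M T"
    and eq: "distr M S V \<Otimes>\<^sub>M distr M T Y = distr M (S \<Otimes>\<^sub>M T) (\<lambda>x. (V x, Y x))"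
    using i by (auto simp: indep_var_distribution_eq)
  interpret V: prob_space "distr M S V" by (rule prob_space_distr) measurable
  interpret Y: prob_space "distr M T Y" by (rule prob_space_distr) measurable
  interpret VY: pair_prob_space "distr M S V" "distr M T Y" ..
  have int: "integrable (distr M S V \<Otimes>\<^sub>M distr M T Y) f"
    by (rule VY.integrable_const_bound[where B=H]) (use b in auto)
  have in1: "(\<integral>y. f (v, y) \<partial>distr M T Y) = expectation (\<lambda>\<omega>. f (v, Y \<omega>))" if "v \<in> space S" for v
    using that by (subst integral_distr) auto
  have "expectation (\<lambda>\<omega>. f (V \<omega>, Y \<omega>)) = integral\<^sup>L (distr M S V \<Otimes>\<^sub>M distr M T Y) f"
    unfolding eq by (subst integral_distr) auto
  also have "\<dots> = (\<integral>v. (\<integral>y. f (v, y) \<partial>distr M T Y) \<partial>distr M S V)"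
    using VY.integral_fst'[OF int] by simp
  finally have e: "expectation (\<lambda>\<omega>. f (V \<omega>, Y \<omega>)) = (\<integral>v. (\<integral>y. f (v, y) \<partial>distr M T Y) \<partial>distr M S V)" .
  have "\<bar>(\<integral>v. (\<integral>y. f (v, y) \<partial>distr M T Y) \<partial>distr M S V)\<bar>
     \<le> (\<integral>v. \<bar>\<integral>y. f (v, y) \<partial>distr M T Y\<bar> \<partial>distr M S V)" by (rule integral_abs_bound)
  also have "\<dots> \<le> (\<integral>v. c \<partial>distr M S V)"
    by (rule integral_mono)
       (use VY.integrable_fst'[OF int] c in1 in auto)
  also have "\<dots> = c" using V.prob_space by simp
  finally show ?thesis unfolding e .
qed

text \<open>The alternative \<open>i = m\<close> caps the index at \<open>m\<close>, so that
  \<open>LEAST\<close> is always attained; the value \<open>m\<close> may mean entry at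
  \<open>m\<close> or no entry so far.\<close>

definition first_entry :: "(nat \<Rightarrow> 'b) \<Rightarrow> 'b set \<Rightarrow> nat \<Rightarrow> nat" where
  "first_entry X G m = (LEAST i. i = m \<or> X i \<in> G)"

lemma first_entry_le: "first_entry X G m \<le> m"
  unfolding first_entry_def by (rule Least_le) simp

lemma first_entry_in: "first_entry X G m = m \<or> X (first_entry X G m) \<in> G"
  unfolding first_entry_def by (rule LeastI[of _ m]) simp

lemma first_entry_le_entry: "X i \<in> G \<Longrightarrow> first_entry X G m \<le> i"
  unfolding first_entry_def by (rule Least_le) simp

lemma first_entry_never: "\<forall>i<m. X i \<notin> G \<Longrightarrow> first_entry X G m = m"
  using first_entry_le[of X G m] first_entry_in[of X G m] by (metis le_neq_implies_less)

lemma first_entry_Suc: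
  "first_entry X G (Suc m) = (if \<forall>i\<le>m. X i \<notin> G then Suc m else first_entry X G m)"
proof (cases "\<forall>i\<le>m. X i \<notin> G")
  case True then show ?thesis by (simp add: first_entry_never less_Suc_eq_le)
next
  case False
  then obtain i where i: "i \<le> m" "X i \<in> G" by blast
  show ?thesis
  proof -
    let ?a = "first_entry X G m" and ?b = "first_entry X G (Suc m)"
    have "?a = m \<Longrightarrow> i = m" using first_entry_le_entry[of X i G m, OF i(2)] i(1) by simp
    then have a: "X ?a \<in> G" using first_entry_in[of X G m] i(2) by auto
    have ba: "?b \<le> ?a" using first_entry_le_entry[of X ?a G, OF a] .
    then have "?b \<noteq> Suc m" using first_entry_le[of X G m] by simp
    then have "X ?b \<in> G" using first_entry_in[of X G "Suc m"] by auto
    then have "?a \<le> ?b" by (rule first_entry_le_entry)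
    then show ?thesis using ba False by auto
  qed
qed

text \<open>Discrete optional stopping: the step from \<open>j\<close> is kept only if
  \<open>G\<close> has not been entered up to \<open>j\<close>, a condition on the past of that
  step. With the identity for \<open>h\<close> the stopped position becomes a finite sum, which
  gives its measurability.\<close>

lemma first_entry_telescope:
  fixes h :: "_ \<Rightarrow> 'c :: ab_group_add"
  shows "h (X (first_entry X G m)) = h (X 0) + (\<Sum>j<m. if \<forall>i\<le>j. X i \<notin> G then h (X (Suc j)) - h (X j) else 0)"
proof (induction m)
  case 0 show ?case using first_entry_le[of X G 0] by simp
next
  case (Suc m)
  have "first_entry X G m = m" if "\<forall>i\<le>m. X i \<notin> G"
    using that by (simp add: first_entry_never)
  then show ?case using Suc by (auto simp: first_entry_Suc)
qed

text \<open>Every kept step of the telescoping sum starts outside \<open>G\<close>, where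
  \<open>h\<close> is harmonic on a ball of radius \<epsilon>, and the decision to keep it is
  independent of its increment. Each of the \<open>m\<close> steps thus costs at most the error of
  \<open>gaussian2_step\<close>.\<close>

lemma (in prob_space) stopped_walk:
  fixes h :: "complex \<Rightarrow> real"
  assumes ind: "indep_vars (\<lambda>_. borel) \<xi> {..<m}" and g: "\<And>i. i < m \<Longrightarrow> gaussian2 \<sigma> (\<xi> i)"
    and \<sigma>: "0 < \<sigma>" and \<epsilon>: "0 < \<epsilon>" and G[measurable]: "G \<in> sets borel"
    and h[measurable]: "h \<in> borel_measurable borel" and b: "\<And>y. \<bar>h y\<bar> \<le> H"
    and k: "\<And>x. x \<notin> G \<Longrightarrow> \<exists>k. k holomorphic_on ball x \<epsilon> \<and> (\<forall>w\<in>ball x \<epsilon>. h w = Re (k w))"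
  shows "\<bar>expectation (\<lambda>\<omega>. h (let X = \<lambda>j. z + (\<Sum>i<j. \<xi> i \<omega>) in X (first_entry X G m))) - h z\<bar>
    \<le> real m * (24 * H * \<sigma> ^ 4 / \<epsilon> ^ 4)"
proof -
  define X where "X \<omega> j = z + (\<Sum>i<j. \<xi> i \<omega>)" for \<omega> j
  have [measurable]: "\<xi> i \<in> borel_measurable M" if "i < m" for i
    using g[OF that] by (simp add: gaussian2_def)
  have Xm[measurable]: "(\<lambda>\<omega>. X \<omega> j) \<in> borel_measurable M" if "j \<le> m" for j
    unfolding X_def using that by (intro borel_measurable_add borel_measurable_const borel_measurable_sum) auto
  have H: "0 \<le> H" using b[of 0] by linarith
  have hb: "\<bar>h y - h x\<bar> \<le> 2 * H" for x y using b[of y] b[of x] by linarith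
  define c where "c = 24 * H * \<sigma> ^ 4 / \<epsilon> ^ 4"
  have c: "0 \<le> c" using H \<sigma> \<epsilon> by (simp add: c_def)
  define d where "d j \<omega> = (if \<forall>i\<le>j. X \<omega> i \<notin> G then h (X \<omega> (Suc j)) - h (X \<omega> j) else 0)" for j \<omega>
  have dm[measurable]: "d j \<in> borel_measurable M" if "j < m" for j
  proof -
    have [measurable]: "(\<lambda>\<omega>. X \<omega> i) \<in> borel_measurable M" if "i \<le> Suc j" for i
      using that \<open>j < m\<close> by (intro Xm) simp
    show ?thesis unfolding d_def by measurable
  qed
  have step: "\<bar>expectation (d j)\<bar> \<le> c" if j: "j < m" for j
  proof -
    let ?S = "PiM {..<j} (\<lambda>_. borel :: complex measure)"
    let ?V = "\<lambda>\<omega>. restrict (\<lambda>i. \<xi> i \<omega>) {..<j}"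
    let ?T = "PiM {j} (\<lambda>_. borel :: complex measure)" and ?Y = "\<lambda>\<omega>. restrict (\<lambda>i. \<xi> i \<omega>) {j}"
    have iv: "indep_var ?S ?V ?T ?Y"
      by (rule indep_var_restrict[OF ind]) (use j in auto)
    define Z where "Z v i = z + (\<Sum>l<i. v l)" for v :: "nat \<Rightarrow> complex" and i :: nat
    have [measurable]: "(\<lambda>p. Z (fst p) i) \<in> borel_measurable (?S \<Otimes>\<^sub>M ?T)" if "i \<le> j" for i
      unfolding Z_def using that
      by (intro borel_measurable_add borel_measurable_const borel_measurable_sum
          measurable_compose[OF measurable_fst] measurable_component_singleton) auto
    \<comment> \<open>\<open>f\<close> separates the past \<open>v\<close>, which determines the
      position and the decision to go on, from the fresh increment \<open>y j\<close>.\<close>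
    define f where "f = (\<lambda>(v, y). if \<forall>i\<le>j. Z v i \<notin> G then h (Z v j + y j) - h (Z v j) else 0)"
    have fm: "f \<in> borel_measurable (?S \<Otimes>\<^sub>M ?T)"
      unfolding f_def case_prod_beta by measurable
    have ZX: "Z (?V \<omega>) i = X \<omega> i" if "i \<le> j" for i \<omega>
      using that unfolding Z_def X_def by (intro arg_cong2[where f="(+)"] sum.cong) auto
    have "d j \<omega> = f (?V \<omega>, ?Y \<omega>)" for \<omega>
    proof -
      have "X \<omega> (Suc j) = X \<omega> j + \<xi> j \<omega>" by (simp add: X_def)
      then show ?thesis unfolding d_def f_def prod.case by (auto simp: ZX)
    qed
    moreover have "\<bar>expectation (\<lambda>\<omega>. f (?V \<omega>, ?Y \<omega>))\<bar> \<le> c"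
    proof (rule indep_expectation_bound[OF iv fm])
      show "\<bar>f p\<bar> \<le> 2 * H" for p using hb H by (auto simp: f_def split: prod.split)
      fix v
      show "\<bar>expectation (\<lambda>\<omega>. f (v, ?Y \<omega>))\<bar> \<le> c"
      proof (cases "\<forall>i\<le>j. Z v i \<notin> G")
        case True
        then obtain k' where "k' holomorphic_on ball (Z v j) \<epsilon>" "\<forall>w\<in>ball (Z v j) \<epsilon>. h w = Re (k' w)"
          using k[of "Z v j"] by auto
        then show ?thesis
          using gaussian2_step[OF g[OF j] \<sigma> \<epsilon> h b, of k' "Z v j"] True by (simp add: f_def c_def)
      next
        case False
        then have "f (v, ?Y \<omega>) = 0" for \<omega> by (auto simp: f_def)
        then show ?thesis using c by simp
      qed
    qed
    ultimately have "\<bar>expectation (\<lambda>\<omega>. d j \<omega>)\<bar> \<le> c" by presburger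
    then show ?thesis .
  qed
  have di: "integrable M (d j)" if "j < m" for j
    by (rule integrable_const_bound[where B="2 * H"]) (use that hb H in \<open>auto simp: d_def\<close>)
  have tele: "h (X \<omega> (first_entry (X \<omega>) G m)) = h z + (\<Sum>j<m. d j \<omega>)" for \<omega>
    using first_entry_telescope[of h "X \<omega>" G m] by (simp add: d_def X_def)
  have "expectation (\<lambda>\<omega>. h (X \<omega> (first_entry (X \<omega>) G m))) - h z = (\<Sum>j<m. expectation (d j))"
  proof -
    have "integrable M (\<lambda>\<omega>. \<Sum>j<m. d j \<omega>)" using di by (intro Bochner_Integration.integrable_sum) auto
    then have "expectation (\<lambda>\<omega>. h z + (\<Sum>j<m. d j \<omega>)) = h z + expectation (\<lambda>\<omega>. \<Sum>j<m. d j \<omega>)"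
      by (simp add: prob_space)
    also have "expectation (\<lambda>\<omega>. \<Sum>j<m. d j \<omega>) = (\<Sum>j<m. expectation (d j))"
      using di by (intro Bochner_Integration.integral_sum) auto
    finally show ?thesis unfolding tele by simp
  qed
  then have "\<bar>expectation (\<lambda>\<omega>. h (X \<omega> (first_entry (X \<omega>) G m))) - h z\<bar> \<le> (\<Sum>j<m. \<bar>expectation (d j)\<bar>)"
    by (simp add: sum_abs)
  also have "\<dots> \<le> (\<Sum>j<m. c)" using step by (intro sum_mono) auto
  finally show ?thesis by (simp add: X_def[abs_def] c_def Let_def)
qed

section \<open>Optional stopping at the entry time of a closed set\<close>

text \<open>Inserting \<open>T\<close> caps the time and keeps the set nonempty; again the value
  \<open>T\<close> may mean entry at \<open>T\<close> or no entry so far.\<close>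

definition entry_time :: "(real \<Rightarrow> 'b) \<Rightarrow> 'b set \<Rightarrow> real \<Rightarrow> real" where
  "entry_time b G T = Inf (insert T {t. 0 \<le> t \<and> t \<le> T \<and> b t \<in> G})"

lemma bdd_below_entry: "bdd_below (insert T {t. 0 \<le> t \<and> t \<le> T \<and> b t \<in> G})" for T :: real
  by (auto intro!: bdd_belowI[of _ 0])

lemma entry_time_bounds: "0 \<le> T \<Longrightarrow> 0 \<le> entry_time b G T \<and> entry_time b G T \<le> T"
  unfolding entry_time_def by (auto intro!: cInf_greatest cInf_lower bdd_below_entry)

lemma entry_time_le: "0 \<le> t \<Longrightarrow> t \<le> T \<Longrightarrow> b t \<in> G \<Longrightarrow> entry_time b G T \<le> t"
  unfolding entry_time_def by (intro cInf_lower bdd_below_entry) auto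

lemma entry_time_mono: "0 \<le> T \<Longrightarrow> F \<subseteq> G \<Longrightarrow> entry_time b G T \<le> entry_time b F T"
  unfolding entry_time_def by (intro cInf_superset_mono bdd_below_entry) auto

text \<open>The infimum is \<open>T\<close> or a limit of times spent in \<open>G\<close>;
  continuity of the path then yields a point of the closure.\<close>

lemma entry_time_closure:
  fixes b :: "real \<Rightarrow> 'b :: metric_space"
  assumes b: "continuous_on {0..} b" and T: "0 \<le> T"
  shows "entry_time b G T = T \<or> b (entry_time b G T) \<in> closure G"
proof -
  let ?S = "{t. 0 \<le> t \<and> t \<le> T \<and> b t \<in> G}"
  have "entry_time b G T \<in> closure (insert T ?S)"
    unfolding entry_time_def by (intro closure_contains_Inf bdd_below_entry) auto
  then have "entry_time b G T = T \<or> entry_time b G T \<in> closure ?S"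
    by (simp add: closure_insert)
  moreover have "b ` closure ?S \<subseteq> closure (b ` ?S)"
  proof (rule image_closure_subset)
    have "closure ?S \<subseteq> {0..}" by (rule closure_minimal) auto
    then show "continuous_on (closure ?S) b" using b continuous_on_subset by blast
  qed (auto intro: closure_subset[THEN subsetD])
  moreover have "closure (b ` ?S) \<subseteq> closure G" by (rule closure_mono) auto
  ultimately show ?thesis by blast
qed

text \<open>Openness prevents the grid from stepping over \<open>G\<close>: a path that is in
  \<open>G\<close> at time \<open>t\<close> is still there at the next grid time once the mesh is
  small. The grid time is never too early, being either \<open>T\<close> or a time spent in
  \<open>G\<close>.\<close>

lemma first_entry_tendsto_entry_time:
  fixes b :: "real \<Rightarrow> 'b :: metric_space"
  assumes b: "continuous_on {0..} b" and T: "0 < T" and G: "open G"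
  shows "(\<lambda>m. T / real (Suc m) * real (first_entry (\<lambda>i. b (T / real (Suc m) * real i)) G (Suc m)))
    \<longlonglongrightarrow> entry_time b G T"
proof -
  define s where "s m = T / real (Suc m) * real (first_entry (\<lambda>i. b (T / real (Suc m) * real i)) G (Suc m))" for m
  let ?r = "entry_time b G T"
  have sT: "0 \<le> s m" "s m \<le> T" for m
  proof -
    have "s m \<le> T / real (Suc m) * real (Suc m)"
      unfolding s_def using T by (intro mult_left_mono of_nat_mono first_entry_le) simp
    then show "s m \<le> T" by simp
  qed (use T in \<open>simp add: s_def\<close>)
  have low: "?r \<le> s m" for m
  proof (cases "b (s m) \<in> G")
    case True then show ?thesis using sT by (intro entry_time_le)
  next
    case False
    then have "s m = T" using first_entry_in[of "\<lambda>i. b (T / real (Suc m) * real i)" G "Suc m"]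
      by (auto simp: s_def)
    then show ?thesis using entry_time_bounds[of T b G] T by simp
  qed
  have up: "eventually (\<lambda>m. s m < ?r + e) sequentially" if e: "0 < e" for e
  proof -
    have "\<exists>t\<in>insert T {t. 0 \<le> t \<and> t \<le> T \<and> b t \<in> G}. t < ?r + e / 2"
      using e cInf_lessD[of "insert T {t. 0 \<le> t \<and> t \<le> T \<and> b t \<in> G}" "?r + e / 2"]
      by (simp add: entry_time_def)
    then obtain t where t: "t < ?r + e / 2" and "t = T \<or> (0 \<le> t \<and> t \<le> T \<and> b t \<in> G)" by auto
    then consider "t = T" | "0 \<le> t" "t \<le> T" "b t \<in> G" by blast
    then show ?thesis
    proof cases
      case 1
      have "s m < ?r + e" for m using sT[of m] 1 t e by simp
      then show ?thesis by simp
    next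
      case 2
      obtain V where V: "open V" "V \<inter> {0..} = b -` G \<inter> {0..}"
        using continuous_on_open_invariant[of "{0..}" b] b G by metis
      then have "t \<in> V" using 2 by auto
      then obtain \<kappa> where \<kappa>: "0 < \<kappa>" "\<And>u. dist u t < \<kappa> \<Longrightarrow> u \<in> V"
        using V(1) unfolding open_dist by blast
      have "(\<lambda>m. T / real (Suc m)) \<longlonglongrightarrow> 0" by real_asymp
      then have "eventually (\<lambda>m. T / real (Suc m) < min \<kappa> (e / 2)) sequentially"
        using \<kappa> e by (intro order_tendstoD) auto
      then show ?thesis
      proof eventually_elim
        case (elim m)
        define d where "d = T / real (Suc m)"
        have d: "0 < d" "d < \<kappa>" "d < e / 2" "d * real (Suc m) = T" using T elim by (auto simp: d_def)
        \<comment> \<open>The first grid index at or after \<open>t\<close>; its time exceeds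
          \<open>t\<close> by less than the mesh \<open>d\<close>.\<close>
        define i where "i = nat \<lceil>t / d\<rceil>"
        have i: "real i = of_int \<lceil>t / d\<rceil>" using 2 d by (simp add: i_def)
        have "t / d \<le> real i" "real i < t / d + 1" unfolding i by linarith+
        then have id: "t \<le> d * real i" "d * real i < t + d" using d by (simp_all add: field_simps)
        have "d * real i \<in> V" using \<kappa>(2) id d by (simp add: dist_real_def)
        then have "b (d * real i) \<in> G" using V(2) d by auto
        then have "first_entry (\<lambda>i. b (d * real i)) G (Suc m) \<le> i" by (rule first_entry_le_entry)
        then have "s m \<le> d * real i" using d(1) unfolding s_def d_def[symmetric]
            by (intro mult_left_mono of_nat_mono) auto
        then show ?case using id d t by simp
      qed
    qed
  qed
  have "s \<longlonglongrightarrow> ?r"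
  proof (rule order_tendstoI)
    fix a assume "a < ?r" then show "eventually (\<lambda>m. a < s m) sequentially"
      using low by (auto intro!: always_eventually intro: less_le_trans)
  next
    fix a assume "?r < a" then show "eventually (\<lambda>m. s m < a) sequentially"
      using up[of "a - ?r"] by simp
  qed
  then show ?thesis by (simp only: s_def[abs_def])
qed

text \<open>Passage from open neighbourhoods to the closed set \<open>F\<close>. The entry times
  increase to some \<open>R\<close>; if \<open>R < T\<close>, then by continuity the path at time
  \<open>R\<close> has distance 0 from \<open>F\<close>, so \<open>F\<close> is entered no later
  than \<open>R\<close>.\<close>

lemma entry_time_nbhds_tendsto:
  fixes b :: "real \<Rightarrow> 'b :: metric_space"
  assumes b: "continuous_on {0..} b" and T: "0 \<le> T" and F: "closed F" "F \<noteq> {}"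
  shows "(\<lambda>n. entry_time b {x. infdist x F < 1 / real (Suc n)} T) \<longlonglongrightarrow> entry_time b F T"
proof -
  define r where "r n = entry_time b {x. infdist x F < 1 / real (Suc n)} T" for n
  have "incseq r"
    unfolding r_def incseq_Suc_iff
  proof (intro allI entry_time_mono T Collect_mono impI)
    fix n x assume "infdist x F < 1 / real (Suc (Suc n))"
    also have "\<dots> \<le> 1 / real (Suc n)" by (simp add: field_simps)
    finally show "infdist x F < 1 / real (Suc n)" .
  qed
  moreover have up: "r n \<le> entry_time b F T" for n
    unfolding r_def by (rule entry_time_mono[OF T]) auto
  ultimately obtain R where R: "r \<longlonglongrightarrow> R" "\<And>n. r n \<le> R"
    using incseq_convergent[of r "entry_time b F T"] by auto
  have RF: "R \<le> entry_time b F T" using R(1) up by (intro LIMSEQ_le_const2[OF R(1)]) auto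
  have rb: "0 \<le> r n \<and> r n \<le> T" for n unfolding r_def by (rule entry_time_bounds[OF T])
  have R0: "0 \<le> R" using rb[of 0] R(2)[of 0] by linarith
  have RT: "R \<le> T" using RF entry_time_bounds[OF T, of b F] by linarith
  have "entry_time b F T \<le> R"
  proof (cases "R = T")
    case True then show ?thesis using entry_time_bounds[OF T, of b F] by simp
  next
    case False
    have "infdist (b (r n)) F \<le> 1 / real (Suc n)" for n
    proof -
      have "r n < T" using False R(2)[of n] RT by linarith
      then have "b (r n) \<in> closure {x. infdist x F < 1 / real (Suc n)}"
        using entry_time_closure[OF b T, of "{x. infdist x F < 1 / real (Suc n)}"] by (simp add: r_def)
      moreover have "closure {x. infdist x F < 1 / real (Suc n)} \<subseteq> {x. infdist x F \<le> 1 / real (Suc n)}"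
        by (rule closure_minimal) (auto intro!: closed_Collect_le continuous_intros)
      ultimately show ?thesis by blast
    qed
    moreover have "(\<lambda>n. infdist (b (r n)) F) \<longlonglongrightarrow> infdist (b R) F"
      by (intro tendsto_infdist continuous_on_tendsto_compose[OF b R(1)]) (use R0 rb in auto)
    moreover have "(\<lambda>n. 1 / real (Suc n)) \<longlonglongrightarrow> 0" by real_asymp
    ultimately have "infdist (b R) F \<le> 0" by (intro LIMSEQ_le) auto
    then have "b R \<in> F" using F infdist_nonneg[of "b R" F] by (simp add: in_closed_iff_infdist_zero)
    then show ?thesis using R0 RT by (intro entry_time_le)
  qed
  then have "R = entry_time b F T" using RF by simp
  then show ?thesis using R(1) unfolding r_def by simp
qed

section \<open>Transfer to planar Brownian motion\<close>

lemma brownian_path: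
  "planar_brownian_motion M B z \<Longrightarrow> \<omega> \<in> space M \<Longrightarrow> continuous_on {0..} (\<lambda>t. B t \<omega>)"
  by (simp add: planar_brownian_motion_def)

abbreviation grid_entry_point :: "(real \<Rightarrow> 'a \<Rightarrow> 'b) \<Rightarrow> real \<Rightarrow> 'b set \<Rightarrow> nat \<Rightarrow> 'a \<Rightarrow> 'b" where
  "grid_entry_point B \<delta> G m \<omega> \<equiv> B (\<delta> * real (first_entry (\<lambda>i. B (\<delta> * real i) \<omega>) G m)) \<omega>"

abbreviation entry_point :: "(real \<Rightarrow> 'a \<Rightarrow> 'b) \<Rightarrow> 'b set \<Rightarrow> real \<Rightarrow> 'a \<Rightarrow> 'b" where
  "entry_point B F T \<omega> \<equiv> B (entry_time (\<lambda>t. B t \<omega>) F T) \<omega>"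

abbreviation hit_point :: "(real \<Rightarrow> 'a \<Rightarrow> 'b) \<Rightarrow> 'b set \<Rightarrow> 'a \<Rightarrow> 'b" where
  "hit_point B F \<omega> \<equiv> B (Inf {t. 0 \<le> t \<and> B t \<omega> \<in> F}) \<omega>"

abbreviation hit_event :: "'a measure \<Rightarrow> (real \<Rightarrow> 'a \<Rightarrow> 'b) \<Rightarrow> 'b set \<Rightarrow> 'a set" where
  "hit_event M B F \<equiv> {\<omega>\<in>space M. \<exists>t\<ge>0. B t \<omega> \<in> F}"

text \<open>On a grid of mesh \<delta> the increments are Gaussian with
  \<open>\<sigma> = sqrt \<delta>\<close>, so the factor \<open>\<sigma> ^ 4\<close> of
  \<open>stopped_walk\<close> becomes \<open>\<delta>\<^sup>2\<close>.\<close>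

lemma brownian_entry_grid:
  fixes h :: "complex \<Rightarrow> real"
  assumes BM: "planar_brownian_motion M B z" and \<delta>: "0 < \<delta>" and \<epsilon>: "0 < \<epsilon>" and G[measurable]: "G \<in> sets borel"
    and h[measurable]: "h \<in> borel_measurable borel" and b: "\<And>y. \<bar>h y\<bar> \<le> H"
    and k: "\<And>x. x \<notin> G \<Longrightarrow> \<exists>k. k holomorphic_on ball x \<epsilon> \<and> (\<forall>w\<in>ball x \<epsilon>. h w = Re (k w))"
  shows "(\<lambda>\<omega>. grid_entry_point B \<delta> G m \<omega>) \<in> borel_measurable M"
    and "\<bar>(\<integral>\<omega>. h (grid_entry_point B \<delta> G m \<omega>) \<partial>M) - h z\<bar>
      \<le> real m * (24 * H * \<delta>\<^sup>2 / \<epsilon> ^ 4)"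
proof -
  interpret prob_space M using BM by (simp add: planar_brownian_motion_def)
  have [measurable]: "B t \<in> borel_measurable M" if "0 \<le> t" for t
    using BM that by (simp add: planar_brownian_motion_def)
  have [measurable]: "B (\<delta> * real i) \<in> borel_measurable M" for i
    using \<delta> by simp
  \<comment> \<open>The path is evaluated at a random index; the telescoping identity turns this
    into a finite sum of measurable terms.\<close>
  show meas[measurable]: "(\<lambda>\<omega>. grid_entry_point B \<delta> G m \<omega>) \<in> borel_measurable M"
    by (subst first_entry_telescope[of "\<lambda>x. x" "\<lambda>i. B (\<delta> * real i) \<omega>" for \<omega>]) measurable
  define \<xi> where "\<xi> i \<omega> = B (\<delta> * real (Suc i)) \<omega> - B (\<delta> * real i) \<omega>" for i \<omega>
  have [measurable]: "\<xi> i \<in> borel_measurable M" for i unfolding \<xi>_def by measurable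
  have ind: "indep_vars (\<lambda>_. borel) \<xi> {..<m}"
  proof -
    have "strict_mono (\<lambda>i. \<delta> * real i)" using \<delta> by (auto simp: strict_mono_def)
    then show ?thesis using BM unfolding planar_brownian_motion_def \<xi>_def
      by (elim conjE) (erule allE[of _ "\<lambda>i. \<delta> * real i"], simp)
  qed
  have g: "gaussian2 (sqrt \<delta>) (\<xi> i)" for i
  proof -
    have "0 \<le> \<delta> * real i \<and> \<delta> * real i < \<delta> * real (Suc i)" using \<delta> by simp
    moreover have "\<delta> * real (Suc i) - \<delta> * real i = \<delta>" by (simp add: algebra_simps)
    ultimately show ?thesis using BM unfolding planar_brownian_motion_def gaussian2_def \<xi>_def
      by (elim conjE) (erule allE[of _ "\<delta> * real i"], erule allE[of _ "\<delta> * real (Suc i)"], simp)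
  qed
  have "AE \<omega> in M. B 0 \<omega> = z" using BM by (simp add: planar_brownian_motion_def)
  then have "AE \<omega> in M. h (let X = \<lambda>j. z + (\<Sum>i<j. \<xi> i \<omega>) in X (first_entry X G m)) =
      h (grid_entry_point B \<delta> G m \<omega>)"
  proof eventually_elim
    case (elim \<omega>)
    have "z + (\<Sum>i<j. \<xi> i \<omega>) = B (\<delta> * real j) \<omega>" for j
      using sum_lessThan_telescope[of "\<lambda>i. B (\<delta> * real i) \<omega>" j] by (simp add: elim \<xi>_def)
    then show ?case by (simp add: Let_def)
  qed
  moreover have "(\<lambda>\<omega>. let X = \<lambda>j. z + (\<Sum>i<j. \<xi> i \<omega>) in X (first_entry X G m)) \<in> borel_measurable M"
    unfolding Let_def
    by (subst first_entry_telescope[of "\<lambda>x. x" "\<lambda>j. z + (\<Sum>i<j. \<xi> i \<omega>)" for \<omega>]) measurable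
  ultimately have "expectation (\<lambda>\<omega>. h (let X = \<lambda>j. z + (\<Sum>i<j. \<xi> i \<omega>) in X (first_entry X G m))) =
      expectation (\<lambda>\<omega>. h (grid_entry_point B \<delta> G m \<omega>))"
    by (intro integral_cong_AE measurable_compose[OF _ h]) (use meas in auto)
  moreover have "sqrt \<delta> ^ 4 = \<delta>\<^sup>2" using \<delta> power_mult[of "sqrt \<delta>" 2 2] by simp
  ultimately show "\<bar>(\<integral>\<omega>. h (grid_entry_point B \<delta> G m \<omega>) \<partial>M) - h z\<bar>
      \<le> real m * (24 * H * \<delta>\<^sup>2 / \<epsilon> ^ 4)"
    using stopped_walk[OF ind g _ \<epsilon> G h b k, of z] \<delta> by simp
qed

text \<open>Two limits in this order: for a fixed neighbourhood of radius
  \<open>1 / real (Suc n)\<close> the mesh tends to 0, then the neighbourhood shrinks to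
  \<open>F\<close>. As \<open>h\<close> is bounded and continuous on the whole plane, dominated
  convergence carries the expectations through both.\<close>

lemma brownian_entry:
  fixes h :: "complex \<Rightarrow> real"
  assumes BM: "planar_brownian_motion M B z" and F: "closed F" "F \<noteq> {}" and T: "0 < T"
    and h: "continuous_on UNIV h" and b: "\<And>y. \<bar>h y\<bar> \<le> H"
    and k: "k holomorphic_on - F" "\<And>w. w \<notin> F \<Longrightarrow> h w = Re (k w)"
  shows brownian_entry_measurable:
      "(\<lambda>\<omega>. entry_point B F T \<omega>) \<in> borel_measurable M"
    and brownian_entry_expectation:
      "(\<integral>\<omega>. h (entry_point B F T \<omega>) \<partial>M) = h z"
proof -
  interpret prob_space M using BM by (simp add: planar_brownian_motion_def)
  note path = brownian_path[OF BM]
  have hm[measurable]: "h \<in> borel_measurable borel" using h by (rule borel_measurable_continuous_onI)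
  define G where "G n = {x. infdist x F < 1 / real (Suc n)}" for n
  have Go: "open (G n)" for n unfolding G_def by (intro open_Collect_less continuous_intros)
  have Gm[measurable]: "G n \<in> sets borel" for n using Go by simp
  \<comment> \<open>A point outside \<open>G n\<close> has distance at least
    \<open>1 / real (Suc n)\<close> from \<open>F\<close>, so the open ball of this radius avoids
    \<open>F\<close>.\<close>
  have kG: "\<exists>k. k holomorphic_on ball x (1 / real (Suc n)) \<and> (\<forall>w\<in>ball x (1 / real (Suc n)). h w = Re (k w))"
    if "x \<notin> G n" for x n
  proof -
    have "ball x (1 / real (Suc n)) \<subseteq> - F"
    proof
      fix w assume w: "w \<in> ball x (1 / real (Suc n))"
      show "w \<in> - F"
      proof
        assume "w \<in> F"
        then have "infdist x F \<le> dist x w" by (rule infdist_le)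
        then show False using w that by (simp add: G_def)
      qed
    qed
    then show ?thesis using k holomorphic_on_subset by blast
  qed
  define S where "S n m \<omega> = T / real (Suc m) * real (first_entry (\<lambda>i. B (T / real (Suc m) * real i) \<omega>) (G n) (Suc m))" for n m \<omega>
  have S0: "0 \<le> S n m \<omega>" for n m \<omega> using T by (simp add: S_def)
  have Sm[measurable]: "(\<lambda>\<omega>. B (S n m \<omega>) \<omega>) \<in> borel_measurable M" for n m
    unfolding S_def by (rule brownian_entry_grid(1)[OF BM _ _ _ hm b kG[of _ n]]) (use T in auto)
  define R where "R n \<omega> = entry_time (\<lambda>t. B t \<omega>) (G n) T" for n \<omega>
  have R0: "0 \<le> R n \<omega>" for n \<omega> using entry_time_bounds[of T "\<lambda>t. B t \<omega>" "G n"] T by (simp add: R_def)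
  have lim1: "(\<lambda>m. B (S n m \<omega>) \<omega>) \<longlonglongrightarrow> B (R n \<omega>) \<omega>" if "\<omega> \<in> space M" for n \<omega>
    by (rule continuous_on_tendsto_compose[OF path[OF that] first_entry_tendsto_entry_time
          [OF path[OF that] T Go, of n, folded S_def R_def]]) (use S0 R0 in auto)
  have Rm[measurable]: "(\<lambda>\<omega>. B (R n \<omega>) \<omega>) \<in> borel_measurable M" for n
    by (rule borel_measurable_LIMSEQ_metric[OF Sm lim1])
  let ?E = "\<lambda>\<omega>. entry_time (\<lambda>t. B t \<omega>) F T"
  have lim2: "(\<lambda>n. B (R n \<omega>) \<omega>) \<longlonglongrightarrow> B (?E \<omega>) \<omega>" if "\<omega> \<in> space M" for \<omega>
    by (rule continuous_on_tendsto_compose[OF path[OF that] entry_time_nbhds_tendsto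
          [OF path[OF that] _ F, of T, folded G_def R_def]])
       (use T R0 entry_time_bounds[of T "\<lambda>t. B t \<omega>" F] in auto)
  show Em[measurable]: "(\<lambda>\<omega>. B (?E \<omega>) \<omega>) \<in> borel_measurable M"
    by (rule borel_measurable_LIMSEQ_metric[OF Rm lim2])
  have hl: "(\<lambda>n. h (u n)) \<longlonglongrightarrow> h l" if "u \<longlonglongrightarrow> l" for u l
    by (rule continuous_on_tendsto_compose[OF h that]) auto
  have "expectation (\<lambda>\<omega>. h (B (R n \<omega>) \<omega>)) = h z" for n
  proof (rule LIMSEQ_unique)
    show "(\<lambda>m. expectation (\<lambda>\<omega>. h (B (S n m \<omega>) \<omega>))) \<longlonglongrightarrow> expectation (\<lambda>\<omega>. h (B (R n \<omega>) \<omega>))"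
      by (rule integral_dominated_convergence[where w="\<lambda>_. H"])
         (use b lim1 hl in \<open>auto intro!: AE_I2\<close>)
    have "(\<lambda>m. expectation (\<lambda>\<omega>. h (B (S n m \<omega>) \<omega>)) - h z) \<longlonglongrightarrow> 0"
    proof (rule Lim_null_comparison)
      show "eventually (\<lambda>m. norm (expectation (\<lambda>\<omega>. h (B (S n m \<omega>) \<omega>)) - h z)
         \<le> real (Suc m) * (24 * H * (T / real (Suc m))\<^sup>2 / (1 / real (Suc n)) ^ 4)) sequentially"
        using brownian_entry_grid(2)[OF BM _ _ _ hm b kG[of _ n], where \<delta>="T / real (Suc m)" and m="Suc m" for m] T
        by (auto simp: S_def simp del: of_nat_Suc)
      \<comment> \<open>For fixed \<open>n\<close>, \<open>Suc m\<close> steps with errors of order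
        \<open>(T / real (Suc m))\<^sup>2\<close> leave a total of order
        \<open>1 / real (Suc m)\<close>.\<close>
      have "(\<lambda>m. real (Suc m) * (24 * H * (T / real (Suc m))\<^sup>2 / (1 / real (Suc n)) ^ 4))
         = (\<lambda>m. 24 * H * T\<^sup>2 / (1 / real (Suc n)) ^ 4 * (1 / real (Suc m)))"
        by (intro ext) (simp add: power2_eq_square field_simps del: of_nat_Suc)
      also have "\<dots> \<longlonglongrightarrow> 24 * H * T\<^sup>2 / (1 / real (Suc n)) ^ 4 * 0"
        by (intro tendsto_mult_left) real_asymp
      finally show "(\<lambda>m. real (Suc m) * (24 * H * (T / real (Suc m))\<^sup>2 / (1 / real (Suc n)) ^ 4)) \<longlonglongrightarrow> 0"
        by simp
    qed
    then show "(\<lambda>m. expectation (\<lambda>\<omega>. h (B (S n m \<omega>) \<omega>))) \<longlonglongrightarrow> h z"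
      by (simp add: LIM_zero_iff)
  qed
  moreover have "(\<lambda>n. expectation (\<lambda>\<omega>. h (B (R n \<omega>) \<omega>))) \<longlonglongrightarrow> expectation (\<lambda>\<omega>. h (B (?E \<omega>) \<omega>))"
    by (rule integral_dominated_convergence[where w="\<lambda>_. H"])
       (use b lim2 hl in \<open>auto intro!: AE_I2\<close>)
  ultimately show "expectation (\<lambda>\<omega>. h (B (?E \<omega>) \<omega>)) = h z"
    by (simp add: LIMSEQ_const_iff)
qed

section \<open>Almost sure hitting\<close>

text \<open>For closed \<open>F\<close> the position at the capped time tells entry from non-entry
  even if that time is \<open>T\<close>.\<close>

lemma entry_time_hit_iff:
  fixes b :: "real \<Rightarrow> 'b :: metric_space"
  assumes b: "continuous_on {0..} b" and T: "0 \<le> T" and F: "closed F"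
  shows "b (entry_time b F T) \<in> F \<longleftrightarrow> (\<exists>t. 0 \<le> t \<and> t \<le> T \<and> b t \<in> F)"
proof
  show "b (entry_time b F T) \<in> F \<Longrightarrow> \<exists>t. 0 \<le> t \<and> t \<le> T \<and> b t \<in> F"
    using entry_time_bounds[OF T, of b F] by blast
  assume "\<exists>t. 0 \<le> t \<and> t \<le> T \<and> b t \<in> F"
  then obtain t where t: "0 \<le> t" "t \<le> T" "b t \<in> F" by blast
  show "b (entry_time b F T) \<in> F"
    using entry_time_closure[OF b T, of F] entry_time_le[of t T b F] t F
    by (auto simp: closure_closed)
qed

lemma hit_Inf_attained:
  fixes b :: "real \<Rightarrow> 'b :: metric_space"
  assumes b: "continuous_on {0..} b" and F: "closed F" and hit: "0 \<le> t" "b t \<in> F"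
  shows "0 \<le> Inf {t. 0 \<le> t \<and> b t \<in> F}" "b (Inf {t. 0 \<le> t \<and> b t \<in> F}) \<in> F"
    "Inf {t. 0 \<le> t \<and> b t \<in> F} \<le> t"
proof -
  let ?S = "{t. 0 \<le> t \<and> b t \<in> F}"
  have eq: "?S = {0..} \<inter> b -` F" by auto
  have "closed ?S" unfolding eq using b F by (intro continuous_closed_preimage) auto
  moreover have bdd: "bdd_below ?S" by (auto intro!: bdd_belowI[of _ 0])
  moreover have "?S \<noteq> {}" using hit by auto
  ultimately have "Inf ?S \<in> ?S" by (intro closed_contains_Inf)
  then show "0 \<le> Inf ?S" "b (Inf ?S) \<in> F" by auto
  show "Inf ?S \<le> t" using hit bdd by (intro cInf_lower) auto
qed

text \<open>Once \<open>T\<close> is no earlier than some hit, the cap has no effect.\<close>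

lemma entry_time_eq_Inf:
  fixes b :: "real \<Rightarrow> 'b :: metric_space"
  assumes b: "continuous_on {0..} b" and F: "closed F" and hit: "0 \<le> t" "b t \<in> F" and T: "t \<le> T"
  shows "entry_time b F T = Inf {t. 0 \<le> t \<and> b t \<in> F}"
proof (rule antisym)
  note I = hit_Inf_attained[OF b F hit]
  show "entry_time b F T \<le> Inf {t. 0 \<le> t \<and> b t \<in> F}"
    using I T by (intro entry_time_le) auto
  show "Inf {t. 0 \<le> t \<and> b t \<in> F} \<le> entry_time b F T"
    unfolding entry_time_def
  proof (rule cInf_greatest)
    fix x assume "x \<in> insert T {t. 0 \<le> t \<and> t \<le> T \<and> b t \<in> F}"
    then consider "x = T" | "0 \<le> x" "b x \<in> F" by auto
    then show "Inf {t. 0 \<le> t \<and> b t \<in> F} \<le> x"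
      using I(3) T hit_Inf_attained(3)[OF b F] by cases auto
  qed simp
qed

lemma brownian_entry_measurable':
  assumes BM: "planar_brownian_motion M B z" and F: "closed F" "F \<noteq> {}" and T: "0 < T"
  shows "(\<lambda>\<omega>. entry_point B F T \<omega>) \<in> borel_measurable M"
  by (rule brownian_entry_measurable[OF BM F T, where h="\<lambda>_. 0" and H=0 and k="\<lambda>_. 0"]) auto

text \<open>The union over all times becomes a countable one: it is enough to ask, for each cap
  \<open>real (Suc n)\<close>, whether the entry point lies in \<open>F\<close>.\<close>

lemma brownian_hit_sets:
  assumes BM: "planar_brownian_motion M B z" and F: "closed F" "F \<noteq> {}"
  shows "(hit_event M B F) \<in> sets M"
proof -
  note path = brownian_path[OF BM]
  have [measurable]: "F \<in> sets borel" using F by simp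
  have [measurable]: "(\<lambda>\<omega>. entry_point B F (real (Suc n)) \<omega>) \<in> borel_measurable M" for n
    by (rule brownian_entry_measurable'[OF BM F]) simp
  have "(hit_event M B F) =
      (\<Union>n. {\<omega>\<in>space M. entry_point B F (real (Suc n)) \<omega> \<in> F})"
  proof (intro set_eqI iffI)
    fix \<omega> assume "\<omega> \<in> (hit_event M B F)"
    then obtain t where t: "\<omega> \<in> space M" "0 \<le> t" "B t \<omega> \<in> F" by blast
    obtain n where "t \<le> real n" using real_arch_simple by blast
    then have "t \<le> real (Suc n)" by simp
    then have "entry_point B F (real (Suc n)) \<omega> \<in> F"
      using entry_time_hit_iff[OF path[OF t(1)] _ F(1), of "real (Suc n)"] t by auto
    then show "\<omega> \<in> (\<Union>n. {\<omega>\<in>space M. entry_point B F (real (Suc n)) \<omega> \<in> F})"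
      using t by blast
  next
    fix \<omega> assume "\<omega> \<in> (\<Union>n. {\<omega>\<in>space M. entry_point B F (real (Suc n)) \<omega> \<in> F})"
    then show "\<omega> \<in> (hit_event M B F)"
      using entry_time_hit_iff[OF path _ F(1)] by fastforce
  qed
  also have "\<dots> \<in> sets M" by measurable
  finally show ?thesis .
qed

text \<open>The Gaussian density is at most \<open>1 / sqrt (2 * pi * T)\<close>, so at a late time
  the path is unlikely to be in a fixed horizontal slab.\<close>

lemma brownian_Im_spread:
  assumes BM: "planar_brownian_motion M B z" and T: "0 < T" and ac: "a \<le> c"
  shows "measure M {\<omega>\<in>space M. a \<le> Im (B T \<omega>) \<and> Im (B T \<omega>) \<le> c} \<le> (c - a) / sqrt (2 * pi * T)"
proof -
  interpret prob_space M using BM by (simp add: planar_brownian_motion_def)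
  have [measurable]: "B T \<in> borel_measurable M" "B 0 \<in> borel_measurable M"
    using BM T by (simp_all add: planar_brownian_motion_def)
  let ?X = "\<lambda>\<omega>. Im (B T \<omega> - B 0 \<omega>)" and ?I = "{a - Im z..c - Im z}"
  have "AE \<omega> in M. B 0 \<omega> = z" using BM by (simp add: planar_brownian_motion_def)
  then have "AE \<omega> in M. indicator {\<omega>\<in>space M. a \<le> Im (B T \<omega>) \<and> Im (B T \<omega>) \<le> c} \<omega> = (indicator ?I (?X \<omega>) :: real)"
    using AE_space by eventually_elim (auto simp: indicator_def)
  then have 1: "expectation (indicator {\<omega>\<in>space M. a \<le> Im (B T \<omega>) \<and> Im (B T \<omega>) \<le> c}) = expectation (\<lambda>\<omega>. indicator ?I (?X \<omega>) :: real)"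
    by (intro integral_cong_AE) auto
  have 2: "expectation (indicator {\<omega>\<in>space M. a \<le> Im (B T \<omega>) \<and> Im (B T \<omega>) \<le> c}) =
      prob {\<omega>\<in>space M. a \<le> Im (B T \<omega>) \<and> Im (B T \<omega>) \<le> c}"
    by (subst Bochner_Integration.integral_indicator) (auto intro!: arg_cong[where f=prob])
  have D: "distributed M lborel ?X (normal_density 0 (sqrt (T - 0)))"
    using BM T unfolding planar_brownian_motion_def by blast
  have "expectation (\<lambda>\<omega>. indicator ?I (?X \<omega>) :: real) = (\<integral>x. normal_density 0 (sqrt T) x * indicator ?I x \<partial>lborel)"
    using distributed_integral[OF D, of "indicator ?I"] by simp
  also have "\<dots> \<le> (\<integral>x. 1 / sqrt (2 * pi * T) * indicator ?I x \<partial>lborel)"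
  proof (rule integral_mono)
    show "integrable lborel (\<lambda>x. normal_density 0 (sqrt T) x * indicator ?I x)"
      using T by (intro integrable_real_mult_indicator) (auto intro: integrable_normal_density)
    show "integrable lborel (\<lambda>x. 1 / sqrt (2 * pi * T) * indicator ?I x :: real)"
      using ac by (intro integrable_mult_right integrable_real_indicator) auto
    fix x :: real
    have "normal_density 0 (sqrt T) x \<le> 1 / sqrt (2 * pi * T)"
      using T by (simp add: normal_density_def divide_right_mono)
    then show "normal_density 0 (sqrt T) x * indicator ?I x \<le> 1 / sqrt (2 * pi * T) * indicator ?I x"
      by (intro mult_right_mono) auto
  qed
  also have "\<dots> = (c - a) / sqrt (2 * pi * T)" using ac by simp
  finally show ?thesis using 1 2 by simp
qed

text \<open>Before hitting the level \<open>c\<close>, the imaginary part reaches \<open>- N\<close> with probability at most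
  \<open>(c - Im z) / (c + N)\<close>.\<close>

lemma brownian_hits_level:
  assumes BM: "planar_brownian_motion M B z"
  shows "AE \<omega> in M. \<exists>t\<ge>0. c \<le> Im (B t \<omega>)"
proof (cases "Im z < c")
  case False
  have "AE \<omega> in M. B 0 \<omega> = z" using BM by (simp add: planar_brownian_motion_def)
  then show ?thesis by eventually_elim (use False in \<open>auto intro!: exI[of _ 0]\<close>)
next
  case zc: True
  interpret prob_space M using BM by (simp add: planar_brownian_motion_def)
  note path = brownian_path[OF BM]
  define F0 where "F0 = {w. c \<le> Im w}"
  have F0: "closed F0" "F0 \<noteq> {}" unfolding F0_def
    by (auto intro!: closed_Collect_le continuous_intros exI[of _ "Complex 0 c"])
  define A where "A = {\<omega>\<in>space M. \<exists>t\<ge>0. B t \<omega> \<in> F0}"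
  have A[measurable]: "A \<in> sets M" unfolding A_def by (rule brownian_hit_sets[OF BM F0])
  define p where "p = prob (space M - A)"
  \<comment> \<open>Optional stopping of the imaginary part on leaving the slab between
    \<open>- N\<close> and \<open>c\<close>. A path that never reaches \<open>c\<close> has left
    through \<open>- N\<close> by time \<open>T\<close> or is still in the slab at that
    time.\<close>
  have bound: "(c + N) * p \<le> c - Im z" if N: "- N < Im z" for N
  proof -
    have cN: "0 < c + N" using N zc by linarith
    define F where "F = {w. Im w \<le> - N} \<union> F0"
    have F: "closed F" "F \<noteq> {}" unfolding F_def
      using F0 by (auto intro!: closed_Un closed_Collect_le continuous_intros)
    \<comment> \<open>Clipping bounds the imaginary part on the whole plane without changing it
      inside the slab.\<close>
    define h where "h w = max (- N) (min c (Im w))" for w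
    have hc: "continuous_on UNIV h" unfolding h_def by (intro continuous_intros)
    have hb: "\<bar>h w\<bar> \<le> \<bar>N\<bar> + \<bar>c\<bar>" for w using cN by (auto simp: h_def max_def min_def)
    have hk: "h w = Re (- \<i> * w)" if "w \<notin> F" for w
      using that by (auto simp: h_def F_def F0_def)
    have main: "Im z \<le> c - (c + N) * p + (c + N) * ((c + N) / sqrt (2 * pi * T))" if T: "0 < T" for T
    proof -
      let ?X = "\<lambda>\<omega>. entry_point B F T \<omega>"
      have [measurable]: "?X \<in> borel_measurable M" by (rule brownian_entry_measurable'[OF BM F T])
      have [measurable]: "h \<in> borel_measurable borel" using hc by (rule borel_measurable_continuous_onI)
      have [measurable]: "B T \<in> borel_measurable M" using BM T by (simp add: planar_brownian_motion_def)
      let ?D = "{\<omega>\<in>space M. - N \<le> Im (B T \<omega>) \<and> Im (B T \<omega>) \<le> c}"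
      have D: "?D \<in> sets M" by measurable
      have "Im z = h z" using N zc by (simp add: h_def)
      also have "\<dots> = expectation (\<lambda>\<omega>. h (?X \<omega>))"
        by (rule brownian_entry_expectation[OF BM F T hc hb _ hk, symmetric]) (intro holomorphic_intros)
      \<comment> \<open>The last term pays for the paths still in the slab at time \<open>T\<close>,
        for which only the bound \<open>c\<close> is available instead of
        \<open>- N\<close>.\<close>
      also have "\<dots> \<le> expectation (\<lambda>\<omega>. c - (c + N) * indicator (space M - A) \<omega> + (c + N) * indicator ?D \<omega>)"
      proof (rule integral_mono)
        show "integrable M (\<lambda>\<omega>. h (?X \<omega>))"
          by (rule integrable_const_bound[where B="\<bar>N\<bar> + \<bar>c\<bar>"]) (use hb in auto)
        show "integrable M (\<lambda>\<omega>. c - (c + N) * indicator (space M - A) \<omega> + (c + N) * indicator ?D \<omega>)"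
          using D by (intro Bochner_Integration.integrable_add Bochner_Integration.integrable_diff
            integrable_mult_right integrable_real_indicator) (auto simp: emeasure_eq_measure)
        fix \<omega> assume \<omega>: "\<omega> \<in> space M"
        show "h (?X \<omega>) \<le> c - (c + N) * indicator (space M - A) \<omega> + (c + N) * indicator ?D \<omega>"
        proof (cases "\<omega> \<in> A \<or> \<omega> \<in> ?D")
          case True
          have "h (?X \<omega>) \<le> c" using cN by (auto simp: h_def)
          then show ?thesis using True \<omega> cN by (auto simp: indicator_def)
        next
          case False
          then have nA: "\<And>t. 0 \<le> t \<Longrightarrow> B t \<omega> \<notin> F0" and nD: "\<omega> \<notin> ?D" using \<omega> by (auto simp: A_def)
          have e: "0 \<le> entry_time (\<lambda>t. B t \<omega>) F T" using entry_time_bounds[of T "\<lambda>t. B t \<omega>" F] T by simp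
          have BT: "B T \<omega> \<notin> F0" using nA T by simp
          have "?X \<omega> \<in> F"
          proof (rule ccontr)
            assume "?X \<omega> \<notin> F"
            then have "entry_time (\<lambda>t. B t \<omega>) F T = T"
              using entry_time_closure[OF path[OF \<omega>], of T F] T F by (auto simp: closure_closed)
            then have "B T \<omega> \<notin> F" using \<open>?X \<omega> \<notin> F\<close> by simp
            then show False using nD \<omega> by (auto simp: F_def F0_def)
          qed
          then have "h (?X \<omega>) = - N" using nA[OF e] cN by (auto simp: F_def F0_def h_def)
          then show ?thesis using False \<omega> by auto
        qed
      qed
      also have "\<dots> = c - (c + N) * p + (c + N) * prob ?D"
      proof -
        have i: "integrable M (indicator (space M - A) :: 'a \<Rightarrow> real)" "integrable M (indicator ?D :: 'a \<Rightarrow> real)"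
          using D A by (auto intro!: integrable_real_indicator simp: emeasure_eq_measure)
        have e: "expectation (indicator (space M - A)) = p" "expectation (indicator ?D) = prob ?D"
          unfolding p_def by (subst Bochner_Integration.integral_indicator, auto intro!: arg_cong[where f=prob])+
        show ?thesis using i e by (simp add: prob_space del: Bochner_Integration.integral_indicator)
      qed
      also have "prob ?D \<le> (c + N) / sqrt (2 * pi * T)"
        using brownian_Im_spread[OF BM T, of "- N" c] cN by simp
      finally show ?thesis using cN by (simp add: mult_left_mono)
    qed
    have "(\<lambda>n. c - (c + N) * p + (c + N) * ((c + N) / sqrt (2 * pi * real (Suc n)))) \<longlonglongrightarrow> c - (c + N) * p + (c + N) * 0"
      by (intro tendsto_add tendsto_mult tendsto_const) real_asymp
    then have "Im z \<le> c - (c + N) * p + (c + N) * 0"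
      by (rule LIMSEQ_le_const) (use main in auto)
    then show ?thesis by simp
  qed
  have "p \<le> 0"
  proof (rule ccontr)
    assume "\<not> p \<le> 0"
    then have p: "0 < p" by simp
    \<comment> \<open>Chosen so that \<open>c + N\<close> exceeds \<open>(c - Im z) / p\<close>, in
      contradiction to \<open>bound\<close>.\<close>
    define N where "N = \<bar>Im z\<bar> + \<bar>c\<bar> + 1 + (c - Im z) / p"
    have q: "0 \<le> (c - Im z) / p" using p zc by simp
    then have "- N < Im z" unfolding N_def by linarith
    from bound[OF this] have "c + N \<le> (c - Im z) / p" using p by (simp add: field_simps)
    then show False unfolding N_def by linarith
  qed
  then have "prob (space M - A) = 0" unfolding p_def using measure_nonneg[of M "space M - A"] by linarith
  then have "AE \<omega> in M. \<omega> \<in> A"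
    using A prob_compl[OF A] by (intro AE_in_set_eq_1[OF A, THEN iffD2]) simp
  then show ?thesis by eventually_elim (auto simp: A_def F0_def)
qed

text \<open>On the hit event the capped entry points are eventually equal to the hit point, which is
  therefore a pointwise limit of measurable functions. Off this event the infimum is over the empty
  set.\<close>

lemma brownian_hit_measurable:
  assumes BM: "planar_brownian_motion M B z" and F: "closed F" "F \<noteq> {}"
  shows "(\<lambda>\<omega>. hit_point B F \<omega>)
    \<in> borel_measurable (restrict_space M (hit_event M B F))" (is "_ \<in> borel_measurable ?R")
    and "\<omega> \<in> space M \<Longrightarrow> \<exists>t\<ge>0. B t \<omega> \<in> F \<Longrightarrow>
      (\<lambda>n. entry_point B F (real (Suc n)) \<omega>) \<longlonglongrightarrow> hit_point B F \<omega>"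
proof -
  note path = brownian_path[OF BM]
  show lim: "(\<lambda>n. entry_point B F (real (Suc n)) \<omega>) \<longlonglongrightarrow> hit_point B F \<omega>"
    if \<omega>: "\<omega> \<in> space M" "\<exists>t\<ge>0. B t \<omega> \<in> F" for \<omega>
  proof (rule tendsto_eventually)
    obtain t where t: "0 \<le> t" "B t \<omega> \<in> F" using \<omega> by blast
    show "eventually (\<lambda>n. entry_point B F (real (Suc n)) \<omega> = hit_point B F \<omega>) sequentially"
      using eventually_ge_at_top[of "nat \<lceil>t\<rceil>"]
    proof eventually_elim
      case (elim n)
      then have "t \<le> real (Suc n)" by linarith
      then show ?case using entry_time_eq_Inf[OF path[OF \<omega>(1)] F(1) t] by simp
    qed
  qed
  have m: "(\<lambda>\<omega>. entry_point B F (real (Suc n)) \<omega>) \<in> borel_measurable ?R" for n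
    by (intro measurable_restrict_space1 brownian_entry_measurable'[OF BM F]) simp
  show "(\<lambda>\<omega>. hit_point B F \<omega>) \<in> borel_measurable ?R"
    by (rule borel_measurable_LIMSEQ_metric[OF m lim]) (auto simp: space_restrict_space)
qed

text \<open>Since \<open>F\<close> contains a half plane above some level, it is hit almost surely,
  and the cap on the time can be sent to infinity by dominated convergence.\<close>

lemma brownian_hit_expectation:
  fixes h :: "complex \<Rightarrow> real"
  assumes BM: "planar_brownian_motion M B z" and F: "closed F" and up: "\<And>w. c \<le> Im w \<Longrightarrow> w \<in> F"
    and h: "continuous_on UNIV h" and b: "\<And>y. \<bar>h y\<bar> \<le> H"
    and k: "k holomorphic_on - F" "\<And>w. w \<notin> F \<Longrightarrow> h w = Re (k w)"
  shows "AE \<omega> in M. \<exists>t\<ge>0. B t \<omega> \<in> F"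
    and "(\<integral>\<omega>. h (hit_point B F \<omega>)
      \<partial>restrict_space M (hit_event M B F)) = h z"
proof -
  interpret prob_space M using BM by (simp add: planar_brownian_motion_def)
  have F': "F \<noteq> {}" using up[of "Complex 0 c"] by auto
  show AE: "AE \<omega> in M. \<exists>t\<ge>0. B t \<omega> \<in> F"
    using brownian_hits_level[OF BM, of c] by eventually_elim (use up in blast)
  define A where "A = (hit_event M B F)"
  have A[measurable]: "A \<in> sets M" unfolding A_def by (rule brownian_hit_sets[OF BM F F'])
  let ?Y = "\<lambda>n \<omega>. entry_point B F (real (Suc n)) \<omega>"
  let ?X = "\<lambda>\<omega>. hit_point B F \<omega>"
  have [measurable]: "h \<in> borel_measurable borel" using h by (rule borel_measurable_continuous_onI)
  have [measurable]: "?Y n \<in> borel_measurable M" for n by (rule brownian_entry_measurable'[OF BM F F']) simp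
  have Xm: "?X \<in> borel_measurable (restrict_space M A)"
    unfolding A_def by (rule brownian_hit_measurable[OF BM F F'])
  have lim: "(\<lambda>n. h (?Y n \<omega>)) \<longlonglongrightarrow> h (?X \<omega>)" if "\<omega> \<in> A" for \<omega>
    by (rule continuous_on_tendsto_compose[OF h brownian_hit_measurable(2)[OF BM F F']])
       (use that in \<open>auto simp: A_def\<close>)
  have "(\<lambda>n. (\<integral>\<omega>. h (?Y n \<omega>) \<partial>restrict_space M A)) \<longlonglongrightarrow> (\<integral>\<omega>. h (?X \<omega>) \<partial>restrict_space M A)"
  proof (rule integral_dominated_convergence[where w="\<lambda>_. H"])
    show "(\<lambda>\<omega>. h (?X \<omega>)) \<in> borel_measurable (restrict_space M A)" using Xm by measurable
    show "(\<lambda>\<omega>. h (?Y n \<omega>)) \<in> borel_measurable (restrict_space M A)" for n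
      by (rule measurable_restrict_space1) measurable
    show "integrable (restrict_space M A) (\<lambda>_. H)"
      using integrable_real_indicator[OF A] by (simp add: integrable_restrict_space emeasure_eq_measure)
    show "AE \<omega> in restrict_space M A. (\<lambda>n. h (?Y n \<omega>)) \<longlonglongrightarrow> h (?X \<omega>)"
      using lim by (intro AE_I2) (simp add: space_restrict_space A_def)
  qed (use b in auto)
  moreover have "(\<integral>\<omega>. h (?Y n \<omega>) \<partial>restrict_space M A) = h z" for n
  proof -
    have "(\<integral>\<omega>. h (?Y n \<omega>) \<partial>restrict_space M A) = expectation (\<lambda>\<omega>. indicator A \<omega> *\<^sub>R h (?Y n \<omega>))"
      using A by (subst integral_restrict_space) auto
    also have "\<dots> = expectation (\<lambda>\<omega>. h (?Y n \<omega>))"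
    proof (rule integral_cong_AE)
      show "AE \<omega> in M. indicator A \<omega> *\<^sub>R h (?Y n \<omega>) = h (?Y n \<omega>)"
        using AE AE_space by eventually_elim (auto simp: A_def)
    qed measurable
    also have "\<dots> = h z" by (rule brownian_entry_expectation[OF BM F F' _ h b k]) simp_all
    finally show ?thesis .
  qed
  ultimately show "(\<integral>\<omega>. h (?X \<omega>) \<partial>restrict_space M (hit_event M B F)) = h z"
    by (simp add: LIMSEQ_const_iff A_def)
qed

section \<open>The hitting measure of a curve in the strip\<close>

text \<open>The triangle wave: the distance from \<open>x\<close> to the nearest even
  integer.\<close>

definition fold_unit :: "real \<Rightarrow> real" where
  "fold_unit x = arccos (cos (pi * x)) / pi"

lemma reflect_strip_eq: "reflect_strip w = Complex (fold_unit (Re w)) (Im w)"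
  by (simp add: reflect_strip_def fold_unit_def)

lemma fold_unit_bounds: "0 \<le> fold_unit x" "fold_unit x \<le> 1"
  by (simp_all add: fold_unit_def arccos_lbound arccos_ubound)

lemma continuous_fold_unit: "continuous_on UNIV fold_unit"
  unfolding fold_unit_def by (intro continuous_intros) auto

lemma cos_shift_even: "cos (pi * (x + 2 * of_int k)) = cos (pi * x)"
proof -
  have "cos (pi * x + 2 * pi * of_int k) = cos (pi * x)"
    by (simp add: cos_add sin_int_2pin cos_int_2pin)
  then show ?thesis by (simp add: algebra_simps)
qed

lemma fold_unit_right:
  assumes "2 * of_int k \<le> x" "x \<le> 2 * of_int k + 1"
  shows "fold_unit x = x - 2 * of_int k"
proof -
  have "cos (pi * x) = cos (pi * (x - 2 * of_int k))"
    using cos_shift_even[of "x - 2 * of_int k" k] by simp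
  then show ?thesis using assms by (simp add: fold_unit_def arccos_cos)
qed

lemma fold_unit_left:
  assumes "2 * of_int k - 1 \<le> x" "x \<le> 2 * of_int k"
  shows "fold_unit x = 2 * of_int k - x"
proof -
  have "cos (pi * x) = cos (pi * (x - 2 * of_int k))"
    using cos_shift_even[of "x - 2 * of_int k" k] by simp
  also have "\<dots> = cos (- (pi * (x - 2 * of_int k)))" by (simp only: cos_minus)
  also have "\<dots> = cos (pi * (2 * of_int k - x))" by (simp add: algebra_simps)
  finally show ?thesis using assms by (simp add: fold_unit_def arccos_cos)
qed

lemma fold_unit_id: "0 \<le> x \<Longrightarrow> x \<le> 1 \<Longrightarrow> fold_unit x = x"
  using fold_unit_right[of 0 x] by simp

lemma continuous_reflect_strip: "continuous_on A reflect_strip"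
proof -
  have "continuous_on UNIV (\<lambda>w. fold_unit (Re w))"
    by (rule continuous_on_compose2[OF continuous_fold_unit]) (auto intro: continuous_intros)
  then have "continuous_on UNIV (\<lambda>w. Complex (fold_unit (Re w)) (Im w))"
    by (intro continuous_intros)
  then show ?thesis using continuous_on_subset unfolding reflect_strip_eq[abs_def] by blast
qed

text \<open>This unfolds the reflection: hitting the curve becomes the hitting of a periodic graph
  by the planar path itself.\<close>

lemma reflect_in_curve_graph:
  "reflect_strip w \<in> curve_graph \<gamma> \<longleftrightarrow> Im w = \<gamma> (fold_unit (Re w))"
  using fold_unit_bounds[of "Re w"] by (auto simp: reflect_strip_eq curve_graph_def)

lemma compact_curve_graph: "continuous_on {0..1} \<gamma> \<Longrightarrow> compact (curve_graph \<gamma>)"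
  unfolding curve_graph_def by (intro compact_continuous_image continuous_intros compact_Icc)

text \<open>The hitting time refers to the graph, while optional stopping uses the closed region on
  or above it, outside of which the test functions are harmonic. For a path that starts below, the
  intermediate value theorem identifies the two first times.\<close>

lemma crossing_Inf:
  fixes g :: "real \<Rightarrow> real"
  assumes g: "continuous_on {0..} g" and g0: "g 0 < 0"
  shows "{t. 0 \<le> t \<and> 0 \<le> g t} = {} \<longleftrightarrow> {t. 0 \<le> t \<and> g t = 0} = {}"
    and "Inf {t. 0 \<le> t \<and> g t = 0} = Inf {t. 0 \<le> t \<and> 0 \<le> g t}"
proof -
  have cross: "\<exists>s. 0 \<le> s \<and> s \<le> t \<and> g s = 0" if "0 \<le> t" "0 \<le> g t" for t
    using IVT'[of g 0 0 t] that g0 continuous_on_subset[OF g, of "{0..t}"] by force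
  then show ne: "{t. 0 \<le> t \<and> 0 \<le> g t} = {} \<longleftrightarrow> {t. 0 \<le> t \<and> g t = 0} = {}" by fastforce
  show "Inf {t. 0 \<le> t \<and> g t = 0} = Inf {t. 0 \<le> t \<and> 0 \<le> g t}"
  proof (cases "{t. 0 \<le> t \<and> 0 \<le> g t} = {}")
    case True
    moreover have "{t. 0 \<le> t \<and> g t = 0} = {}" using ne[unfolded True] by blast
    ultimately show ?thesis by (simp only:)
  next
    case False
    have bdd: "bdd_below {t. 0 \<le> t \<and> g t = 0}" "bdd_below {t. 0 \<le> t \<and> 0 \<le> g t}"
      by (auto intro!: bdd_belowI[of _ 0])
    show ?thesis
    proof (rule antisym)
      show "Inf {t. 0 \<le> t \<and> 0 \<le> g t} \<le> Inf {t. 0 \<le> t \<and> g t = 0}"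
        using False ne bdd by (intro cInf_superset_mono) auto
      show "Inf {t. 0 \<le> t \<and> g t = 0} \<le> Inf {t. 0 \<le> t \<and> 0 \<le> g t}"
      proof (rule cInf_greatest[OF False])
        fix t assume "t \<in> {t. 0 \<le> t \<and> 0 \<le> g t}"
        then obtain s where "0 \<le> s" "s \<le> t" "g s = 0" using cross by blast
        then show "Inf {t. 0 \<le> t \<and> g t = 0} \<le> t"
          using cInf_lower[OF _ bdd(1), of s] by simp
      qed
    qed
  qed
qed

locale strip_curve =
  fixes \<gamma> :: "real \<Rightarrow> real"
  assumes cont: "continuous_on {0..1} \<gamma>"
begin

text \<open>The even extension of \<gamma> with period 2.\<close>

definition lift :: "real \<Rightarrow> real" where "lift x = \<gamma> (fold_unit x)"

definition above :: "complex set" where "above = {w. lift (Re w) \<le> Im w}"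

lemma continuous_lift: "continuous_on UNIV lift"
  unfolding lift_def
  by (rule continuous_on_compose2[OF cont continuous_fold_unit]) (auto simp: fold_unit_bounds)

lemma continuous_lift_Re: "continuous_on A (\<lambda>w. lift (Re w))"
  by (rule continuous_on_compose2[OF continuous_lift]) (auto intro: continuous_intros)

lemma closed_above: "closed above"
  unfolding above_def by (intro closed_Collect_le continuous_lift_Re continuous_intros)

lemma above_large: obtains c where "\<And>w. c \<le> Im w \<Longrightarrow> w \<in> above"
proof -
  have "bdd_above (\<gamma> ` {0..1})"
    by (intro bounded_imp_bdd_above compact_imp_bounded compact_continuous_image cont compact_Icc)
  then obtain c where c: "\<forall>x\<in>{0..1}. \<gamma> x \<le> c" by (auto simp: bdd_above_def)
  have "lift x \<le> c" for x unfolding lift_def using c fold_unit_bounds by simp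
  then show ?thesis using that[of c] by (auto simp: above_def intro: order_trans)
qed

abbreviation "\<Gamma> \<equiv> curve_graph \<gamma>"

text \<open>The Dirichlet problem solved by stopping: \<open>h\<close> is harmonic below the lifted
  graph and has the folded boundary data \<open>f\<close>, so its value at the starting point is the
  mean of \<open>f\<close> at the hitting point.\<close>

lemma hitting_measure_integral:
  fixes h f :: "complex \<Rightarrow> real"
  assumes BM: "planar_brownian_motion M B z" and z: "Im z < lift (Re z)"
    and h: "continuous_on UNIV h" and b: "\<And>y. \<bar>h y\<bar> \<le> H"
    and k: "k holomorphic_on - above" "\<And>w. w \<notin> above \<Longrightarrow> h w = Re (k w)"
    and f: "continuous_on \<Gamma> f" and hf: "\<And>w. Im w = lift (Re w) \<Longrightarrow> h w = f (reflect_strip w)"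
  shows "integral\<^sup>L (hitting_measure M B \<Gamma>) f = h z"
proof -
  interpret prob_space M using BM by (simp add: planar_brownian_motion_def)
  note path = brownian_path[OF BM]
  define L where "L = {w. Im w = lift (Re w)}"
  have L: "closed L" "L \<noteq> {}"
    unfolding L_def by (auto intro!: closed_Collect_eq continuous_lift_Re continuous_intros exI[of _ "Complex 0 (lift 0)"])
  have RL: "reflect_strip w \<in> \<Gamma> \<longleftrightarrow> w \<in> L" for w
    by (simp add: reflect_in_curve_graph L_def lift_def)
  define A where "A = {\<omega>\<in>space M. \<exists>t\<ge>0. B t \<omega> \<in> L}"
  define A' where "A' = {\<omega>\<in>space M. \<exists>t\<ge>0. B t \<omega> \<in> above}"
  obtain c where c: "\<And>w. c \<le> Im w \<Longrightarrow> w \<in> above" by (rule above_large) blast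
  have A: "A \<in> sets M" unfolding A_def by (rule brownian_hit_sets[OF BM L])
  have ne: "above \<noteq> {}" using c[of "Complex 0 c"] by auto
  have A': "A' \<in> sets M" unfolding A'_def by (rule brownian_hit_sets[OF BM closed_above ne])
  let ?X = "\<lambda>\<omega>. B (Inf {t. 0 \<le> t \<and> B t \<omega> \<in> L}) \<omega>"
  let ?X' = "\<lambda>\<omega>. B (Inf {t. 0 \<le> t \<and> B t \<omega> \<in> above}) \<omega>"
  have X: "?X \<in> borel_measurable (restrict_space M A)"
    unfolding A_def by (rule brownian_hit_measurable[OF BM L])
  have X': "?X' \<in> borel_measurable (restrict_space M A')"
    unfolding A'_def by (rule brownian_hit_measurable[OF BM closed_above ne])
  have XL: "?X \<omega> \<in> L" if "\<omega> \<in> A" for \<omega>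
    using that hit_Inf_attained(2)[OF path L(1)] by (auto simp: A_def)
  have hm: "h \<in> borel_measurable borel" using h by (rule borel_measurable_continuous_onI)
  have Rm: "reflect_strip \<in> borel_measurable borel"
    by (rule borel_measurable_continuous_onI[OF continuous_reflect_strip])
  \<comment> \<open>A path that starts below the graph first meets \<open>above\<close> on the
    graph, so the two events and the two hit points agree.\<close>
  have same: "AE \<omega> in M. (\<omega> \<in> A \<longleftrightarrow> \<omega> \<in> A') \<and> ?X \<omega> = ?X' \<omega>"
  proof -
    have "AE \<omega> in M. B 0 \<omega> = z" using BM by (simp add: planar_brownian_motion_def)
    then show ?thesis using AE_space
    proof eventually_elim
      case (elim \<omega>)
      define g where "g t = Im (B t \<omega>) - lift (Re (B t \<omega>))" for t
      have g: "continuous_on {0..} g" unfolding g_def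
        using path[OF elim(2)]
        by (intro continuous_intros continuous_on_compose2[OF continuous_lift_Re[of UNIV]]) auto
      have g0: "g 0 < 0" using elim z by (simp add: g_def)
      have S: "{t. 0 \<le> t \<and> B t \<omega> \<in> L} = {t. 0 \<le> t \<and> g t = 0}"
          "{t. 0 \<le> t \<and> B t \<omega> \<in> above} = {t. 0 \<le> t \<and> 0 \<le> g t}"
        by (auto simp: L_def above_def g_def)
      have AS: "\<omega> \<in> A \<longleftrightarrow> {t. 0 \<le> t \<and> B t \<omega> \<in> L} \<noteq> {}" "\<omega> \<in> A' \<longleftrightarrow> {t. 0 \<le> t \<and> B t \<omega> \<in> above} \<noteq> {}"
        using elim by (auto simp: A_def A'_def)
      show ?case by (simp only: AS S crossing_Inf[OF g g0] simp_thms)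
    qed
  qed
  have "integral\<^sup>L (hitting_measure M B \<Gamma>) f = (\<integral>\<omega>. f (reflect_strip (?X \<omega>)) \<partial>restrict_space M A)"
    unfolding hitting_measure_def hitting_time_def RL A_def[symmetric]
  proof (rule integral_distr)
    show "(\<lambda>\<omega>. reflect_strip (?X \<omega>)) \<in> restrict_space M A \<rightarrow>\<^sub>M restrict_space borel \<Gamma>"
      by (rule measurable_restrict_space2)
         (use XL RL measurable_compose[OF X Rm] in \<open>auto simp: space_restrict_space\<close>)
    show "f \<in> borel_measurable (restrict_space borel \<Gamma>)"
      by (rule borel_measurable_continuous_on_restrict[OF f])
  qed
  also have "\<dots> = (\<integral>\<omega>. h (?X \<omega>) \<partial>restrict_space M A)"
    by (rule Bochner_Integration.integral_cong) (use XL in \<open>auto simp: space_restrict_space L_def hf\<close>)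
  also have "\<dots> = (\<integral>\<omega>. indicator A \<omega> *\<^sub>R h (?X \<omega>) \<partial>M)"
    using A by (subst integral_restrict_space) auto
  also have "\<dots> = (\<integral>\<omega>. indicator A' \<omega> *\<^sub>R h (?X' \<omega>) \<partial>M)"
  proof (rule integral_cong_AE)
    show "(\<lambda>\<omega>. indicator A \<omega> *\<^sub>R h (?X \<omega>)) \<in> borel_measurable M"
      using measurable_compose[OF X hm] A by (subst (asm) borel_measurable_restrict_space_iff) auto
    show "(\<lambda>\<omega>. indicator A' \<omega> *\<^sub>R h (?X' \<omega>)) \<in> borel_measurable M"
      using measurable_compose[OF X' hm] A' by (subst (asm) borel_measurable_restrict_space_iff) auto
    show "AE \<omega> in M. indicator A \<omega> *\<^sub>R h (?X \<omega>) = indicator A' \<omega> *\<^sub>R h (?X' \<omega>)"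
      using same by eventually_elim (auto simp: indicator_def)
  qed
  also have "\<dots> = (\<integral>\<omega>. h (?X' \<omega>) \<partial>restrict_space M A')"
    using A' by (subst integral_restrict_space) auto
  also have "\<dots> = h z"
    unfolding A'_def by (rule brownian_hit_expectation(2)[OF BM closed_above c h b k])
  finally show ?thesis .
qed

text \<open>The test function 1 gives \<open>measure\<close> 1 of the whole space, so the curve is
  hit almost surely. Infinite mass is excluded because its \<open>measure\<close> would be
  0.\<close>

lemma hitting_measure_prob:
  assumes BM: "planar_brownian_motion M B z" and z: "Im z < lift (Re z)"
  shows "prob_space (hitting_measure M B \<Gamma>)"
    "sets (hitting_measure M B \<Gamma>) = sets (restrict_space borel \<Gamma>)"
proof -
  interpret prob_space M using BM by (simp add: planar_brownian_motion_def)
  show S: "sets (hitting_measure M B \<Gamma>) = sets (restrict_space borel \<Gamma>)"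
    by (simp add: hitting_measure_def)
  have 1: "integral\<^sup>L (hitting_measure M B \<Gamma>) (\<lambda>_. 1) = (1 :: real)"
    by (rule hitting_measure_integral[OF BM z, where h="\<lambda>_. 1" and k="\<lambda>_. 1" and H=1]) auto
  then have "measure (hitting_measure M B \<Gamma>) (space (hitting_measure M B \<Gamma>)) = 1" by simp
  then show "prob_space (hitting_measure M B \<Gamma>)"
    by (cases "emeasure (hitting_measure M B \<Gamma>) (space (hitting_measure M B \<Gamma>))" rule: ennreal_cases)
       (auto intro!: prob_spaceI simp: measure_def)
qed

end

section \<open>The inverse Joukowski map\<close>

text \<open>Square roots halve the argument, so the right half plane goes into the sector of
  half-angle \<pi>/4 about the positive axis.\<close>

lemma csqrt_sector:
  assumes "0 \<le> Re z" shows "0 \<le> Re (csqrt z)" "\<bar>Im (csqrt z)\<bar> \<le> Re (csqrt z)"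
proof -
  show 0: "0 \<le> Re (csqrt z)" using csqrt_principal[of z] by linarith
  have "Re ((csqrt z)\<^sup>2) = (Re (csqrt z))\<^sup>2 - (Im (csqrt z))\<^sup>2" by (rule Re_power2)
  then have "(Im (csqrt z))\<^sup>2 \<le> (Re (csqrt z))\<^sup>2" using assms by (simp del: csqrt.simps)
  then show "\<bar>Im (csqrt z)\<bar> \<le> Re (csqrt z)" using 0 abs_le_square_iff[of "Im (csqrt z)" "Re (csqrt z)"] by (simp del: csqrt.simps)
qed

text \<open>The cut meets the closed right half plane only at 0, where continuity follows from
  \<open>norm (csqrt w) = sqrt (norm w)\<close>.\<close>

lemma continuous_csqrt_halfplane: "continuous_on {z. 0 \<le> Re z} csqrt"
proof (rule continuous_at_imp_continuous_on, rule ballI)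
  fix z assume z: "z \<in> {z. 0 \<le> Re z}"
  show "isCont csqrt z"
  proof (cases "z = 0")
    case True
    have "((\<lambda>w :: complex. sqrt (norm w)) \<longlongrightarrow> sqrt 0) (at 0)"
      by (intro tendsto_real_sqrt tendsto_norm_zero tendsto_ident_at)
    then have "((\<lambda>w. norm (csqrt w)) \<longlongrightarrow> 0) (at 0)" by simp
    then have "(csqrt \<longlongrightarrow> 0) (at 0)" by (rule tendsto_norm_zero_cancel)
    then show ?thesis unfolding isCont_def True by simp
  next
    case False
    then have "z \<notin> \<real>\<^sub>\<le>\<^sub>0" using z by (auto simp: complex_nonpos_Reals_iff complex_eq_iff)
    then show ?thesis by (rule continuous_at_csqrt)
  qed
qed

text \<open>The inverse of \<open>q \<mapsto> - (1 - q)\<^sup>2 / (4 * q)\<close>, mapping the closed lower half plane into the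
  closed unit disc; \<open>joukowski_inv s = exp (- \<i> * \<pi> * u)\<close> when \<open>cos (\<pi> * u) = 1 - 2 * s\<close>.\<close>

definition joukowski_inv :: "complex \<Rightarrow> complex" where
  "joukowski_inv s = \<i> * (csqrt (\<i> * s) - csqrt (\<i> * s - \<i>))\<^sup>2"

lemma continuous_joukowski_inv: "continuous_on {s. Im s \<le> 0} joukowski_inv"
  unfolding joukowski_inv_def
  by (intro continuous_intros continuous_on_compose2[OF continuous_csqrt_halfplane]) auto

lemma holomorphic_joukowski_inv: "joukowski_inv holomorphic_on {s. Im s < 0}"
  unfolding joukowski_inv_def
  by (intro holomorphic_intros) (auto simp: complex_nonpos_Reals_iff)

text \<open>The factors \<open>a - b\<close> and \<open>a + b\<close> have product
  \<open>\<i>\<close>, and the second is large: both roots lie in the sector of half-angle \<pi>/4,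
  so \<open>Re (a * cnj b)\<close> is nonnegative and the squared norm of \<open>a + b\<close> is at
  least \<open>norm s + norm (s - 1)\<close>. The estimate gives both boundedness and decay at
  infinity.\<close>

lemma norm_joukowski_inv_le:
  assumes s: "Im s \<le> 0" shows "norm (joukowski_inv s) * (norm s + norm (s - 1)) \<le> 1"
proof -
  define a b where "a = csqrt (\<i> * s)" and "b = csqrt (\<i> * s - \<i>)"
  have a2: "a\<^sup>2 = \<i> * s" and b2: "b\<^sup>2 = \<i> * (s - 1)" by (simp_all add: a_def b_def algebra_simps)
  have ab: "(a - b) * (a + b) = \<i>"
  proof -
    have "(a - b) * (a + b) = a\<^sup>2 - b\<^sup>2" by (simp add: power2_eq_square algebra_simps)
    then show ?thesis by (simp add: a2 b2 algebra_simps)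
  qed
  have "0 \<le> Re (a * cnj b)"
  proof -
    have "\<bar>Im a\<bar> \<le> Re a" "\<bar>Im b\<bar> \<le> Re b" unfolding a_def b_def by (rule csqrt_sector(2), use s in simp)+
    then have "\<bar>Im a * Im b\<bar> \<le> Re a * Re b" by (simp add: abs_mult mult_mono)
    then show ?thesis by simp
  qed
  then have "(norm a)\<^sup>2 + (norm b)\<^sup>2 \<le> (norm (a + b))\<^sup>2"
    unfolding cmod_power2 by (simp add: power2_eq_square algebra_simps)
  moreover have "(norm a)\<^sup>2 = norm s" "(norm b)\<^sup>2 = norm (s - 1)"
    using a2 b2 by (simp_all add: norm_mult flip: norm_power)
  ultimately have "(norm (a - b))\<^sup>2 * (norm s + norm (s - 1)) \<le> (norm (a - b))\<^sup>2 * (norm (a + b))\<^sup>2"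
    by (intro mult_left_mono) auto
  also have "\<dots> = (norm ((a - b) * (a + b)))\<^sup>2" by (simp add: norm_mult power_mult_distrib)
  also have "\<dots> = 1" by (simp add: ab)
  finally show ?thesis
    by (simp add: joukowski_inv_def norm_mult norm_power flip: a_def b_def)
qed

lemma norm_joukowski_inv_le_1:
  assumes s: "Im s \<le> 0" shows "norm (joukowski_inv s) \<le> 1"
proof -
  have "1 \<le> norm s + norm (s - 1)" using norm_triangle_ineq4[of s "s - 1"] by simp
  then have "norm (joukowski_inv s) * 1 \<le> norm (joukowski_inv s) * (norm s + norm (s - 1))"
    by (intro mult_left_mono) auto
  then show ?thesis using norm_joukowski_inv_le[OF s] by simp
qed

lemma csqrt_imaginary:
  assumes "0 \<le> r"
  shows "csqrt (\<i> * of_real r) = of_real (sqrt r) * cis (pi / 4)"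
    and "csqrt (- (\<i> * of_real r)) = of_real (sqrt r) * cis (- (pi / 4))"
proof -
  have c: "(cis (pi / 4))\<^sup>2 = \<i>" "(cis (- (pi / 4)))\<^sup>2 = - \<i>"
    by (simp_all add: power2_eq_square cis_mult)
  have r: "(of_real (sqrt r))\<^sup>2 = (of_real r :: complex)" using assms by (simp flip: of_real_power)
  have p: "0 < cos (pi / 4)" by (simp add: cos_45)
  have q: "r = 0 \<or> 0 < sqrt r * cos (pi / 4)" using assms p by (cases "r = 0") auto
  show "csqrt (\<i> * of_real r) = of_real (sqrt r) * cis (pi / 4)"
    by (rule csqrt_unique) (use q in \<open>auto simp: power_mult_distrib c r mult.commute\<close>)
  show "csqrt (- (\<i> * of_real r)) = of_real (sqrt r) * cis (- (pi / 4))"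
    by (rule csqrt_unique) (use q in \<open>auto simp: power_mult_distrib c r mult.commute\<close>)
qed

text \<open>Outside the open unit interval the two square roots lie on the same ray, at angle
  \<pi>/4 or -\<pi>/4, so the square of their difference is a real multiple of
  \<open>\<i>\<close>.\<close>

lemma joukowski_inv_real:
  assumes "x \<le> 0 \<or> 1 \<le> x" shows "Im (joukowski_inv (of_real x)) = 0"
proof -
  have c: "(cis (pi / 4))\<^sup>2 = \<i>" "(cis (- (pi / 4)))\<^sup>2 = - \<i>"
    by (simp_all add: power2_eq_square cis_mult)
  from assms show ?thesis
  proof
    assume x: "x \<le> 0"
    have "\<i> * of_real x = - (\<i> * of_real (- x))" "\<i> * of_real x - \<i> = - (\<i> * of_real (1 - x))"
      by (simp_all add: algebra_simps)
    then have "joukowski_inv (of_real x) = \<i> * (of_real (sqrt (- x) - sqrt (1 - x)) * cis (- (pi / 4)))\<^sup>2"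
      using x csqrt_imaginary(2)[of "- x"] csqrt_imaginary(2)[of "1 - x"]
      unfolding joukowski_inv_def by (simp only:) (simp add: algebra_simps)
    also have "\<dots> = of_real ((sqrt (- x) - sqrt (1 - x))\<^sup>2)"
      unfolding power_mult_distrib c by (simp add: mult_ac)
    finally show ?thesis by (simp only: Im_complex_of_real)
  next
    assume x: "1 \<le> x"
    have "\<i> * of_real x - \<i> = \<i> * of_real (x - 1)"
      by (simp add: algebra_simps)
    then have "joukowski_inv (of_real x) = \<i> * (of_real (sqrt x - sqrt (x - 1)) * cis (pi / 4))\<^sup>2"
      using x csqrt_imaginary(1)[of x] csqrt_imaginary(1)[of "x - 1"]
      unfolding joukowski_inv_def by (simp only:) (simp add: algebra_simps)
    also have "\<dots> = - of_real ((sqrt x - sqrt (x - 1))\<^sup>2)"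
      unfolding power_mult_distrib c by (simp add: mult_ac)
    finally show ?thesis by (simp only: Im_complex_of_real uminus_complex.simps neg_equal_0_iff_equal)
  qed
qed

text \<open>The two square roots have moduli \<open>S\<close> and \<open>C\<close> and lie on
  perpendicular rays; expanding the square of their difference gives the double-angle formulas for
  \<open>pi * x\<close>.\<close>

lemma joukowski_inv_unit_interval:
  assumes x: "0 \<le> x" "x \<le> 1"
  shows "joukowski_inv (of_real ((1 - cos (pi * x)) / 2)) = cis (- (pi * x))"
proof -
  define S C where "S = sin (pi * x / 2)" and "C = cos (pi * x / 2)"
  have "0 \<le> pi * x" "pi * x \<le> pi" using x by (simp_all add: mult_left_le)
  then have b: "0 \<le> pi * x / 2" "pi * x / 2 \<le> pi / 2" by simp_all
  have SC: "0 \<le> S" "0 \<le> C" unfolding S_def C_def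
    by (rule sin_ge_zero cos_ge_zero, use b pi_gt_zero in linarith, use b in linarith)+
  have d: "cos (pi * x) = C\<^sup>2 - S\<^sup>2" "sin (pi * x) = 2 * S * C" and 1: "S\<^sup>2 + C\<^sup>2 = 1"
    using cos_double[of "pi * x / 2"] sin_double[of "pi * x / 2"] by (simp_all add: S_def C_def)
  have s: "(1 - cos (pi * x)) / 2 = S\<^sup>2" using 1 d by simp
  have "\<i> * of_real (S\<^sup>2) - \<i> = - (\<i> * of_real (C\<^sup>2))"
  proof -
    have "S\<^sup>2 = 1 - C\<^sup>2" using 1 by simp
    then show ?thesis by (simp only:) (simp add: algebra_simps)
  qed
  then have "joukowski_inv (of_real (S\<^sup>2)) = \<i> * (of_real S * cis (pi / 4) - of_real C * cis (- (pi / 4)))\<^sup>2"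
    using csqrt_imaginary(1)[of "S\<^sup>2"] csqrt_imaginary(2)[of "C\<^sup>2"] SC
    unfolding joukowski_inv_def by (simp add: real_sqrt_abs)
  also have "\<dots> = \<i> * ((of_real S)\<^sup>2 * (cis (pi / 4))\<^sup>2 + (of_real C)\<^sup>2 * (cis (- (pi / 4)))\<^sup>2
      - 2 * of_real S * of_real C * (cis (pi / 4) * cis (- (pi / 4))))"
    by (simp add: power2_eq_square algebra_simps)
  also have "\<dots> = \<i> * ((of_real S)\<^sup>2 * \<i> - (of_real C)\<^sup>2 * \<i> - 2 * of_real S * of_real C)"
    by (simp add: cis_mult power2_eq_square)
  also have "\<dots> = cis (- (pi * x))"
    by (simp add: complex_eq_iff d power2_eq_square algebra_simps)
  finally show ?thesis by (simp only: s)
qed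

section \<open>The interpolating curve and the branch of the power\<close>

lemma partition_cover:
  fixes t :: "nat \<Rightarrow> real"
  assumes "1 \<le> n" "t 0 \<le> x" "x \<le> t n"
  shows "\<exists>k\<in>{1..n}. t (k - 1) \<le> x \<and> x \<le> t k"
  using assms
proof (induction n)
  case (Suc n)
  show ?case
  proof (cases "t n \<le> x")
    case True then show ?thesis using Suc.prems by (intro bexI[of _ "Suc n"]) auto
  next
    case False
    then have "1 \<le> n" using Suc.prems by (cases n) auto
    then show ?thesis using Suc.IH Suc.prems False by auto
  qed
qed simp

text \<open>The indicators belong to half-open intervals, so the left end point of an interval is
  served by the preceding summand. At \<open>t 0\<close> no summand is active, and the empty value 0
  is right because \<open>W 0 = 0\<close>.\<close>

lemma interpolant_at:
  assumes t: "strict_mono_on {0..n} t" and W: "W 0 = (0 :: real)"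
    and k: "k \<in> {1..n}" and s: "t (k - 1) \<le> s" "s \<le> t k"
  shows "interpolant n t W s =
    (t k - s) / (t k - t (k - 1)) * W (k - 1) + (s - t (k - 1)) / (t k - t (k - 1)) * W k"
proof -
  have mono: "t i < t j" if "i < j" "j \<le> n" for i j
    using t that by (auto simp: strict_mono_on_def)
  define g where "g k = (t k - s) / (t k - t (k - 1)) * W (k - 1) + (s - t (k - 1)) / (t k - t (k - 1)) * W k" for k
  have ind: "indicator {t (j - 1)<..t j} s = (if j = k then 1 else 0 :: real)"
    if "j \<in> {1..n}" "t (k - 1) < s" for j
  proof -
    consider "j = k" | "j < k" | "k < j" by linarith
    then show ?thesis
    proof cases
      case 2
      then have "j = k - 1 \<or> t j < t (k - 1)" using mono[of j "k - 1"] k by force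
      then show ?thesis using that 2 by (auto simp: indicator_def)
    next
      case 3
      then have "k = j - 1 \<or> t k < t (j - 1)" using mono[of k "j - 1"] that by force
      then show ?thesis using s 3 by (auto simp: indicator_def)
    qed (use s that in auto)
  qed
  show ?thesis
  proof (cases "t (k - 1) < s")
    case True
    have "interpolant n t W s = (\<Sum>j=1..n. (if j = k then 1 else 0) * g j)"
      unfolding interpolant_def g_def using ind True by (intro sum.cong) auto
    also have "\<dots> = (\<Sum>j=1..n. if j = k then g j else 0)" by (intro sum.cong) auto
    also have "\<dots> = g k" using k by simp
    finally show ?thesis by (simp add: g_def)
  next
    case False
    then have sk: "s = t (k - 1)" using s by simp
    have pos: "t (k - 1) < t k" using mono[of "k - 1" k] k by auto
    have ind': "indicator {t (j - 1)<..t j} s = (if j = k - 1 then 1 else 0 :: real)" if j: "j \<in> {1..n}" for j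
    proof -
      consider "j = k - 1" | "j < k - 1" | "k \<le> j" by linarith
      then show ?thesis
      proof cases
        case 1
        then have "t (j - 1) < t j" using mono[of "j - 1" j] j by auto
        then show ?thesis using 1 sk by simp
      next
        case 2
        then have "t j < t (k - 1)" using mono[of j "k - 1"] k by force
        then show ?thesis using 2 sk by (auto simp: indicator_def)
      next
        case 3
        then have "k = j \<or> k - 1 < j - 1" using k by auto
        moreover have "j - 1 \<le> n" using j by auto
        ultimately have "t (k - 1) \<le> t (j - 1)" using mono[of "k - 1" "j - 1"] by (metis order.refl less_imp_le)
        then show ?thesis using 3 sk k by (auto simp: indicator_def)
      qed
    qed
    have "interpolant n t W s = (\<Sum>j=1..n. (if j = k - 1 then 1 else 0) * g j)"
      unfolding interpolant_def g_def using ind' by (intro sum.cong) auto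
    also have "\<dots> = (\<Sum>j=1..n. if j = k - 1 then g j else 0)" by (intro sum.cong) auto
    also have "\<dots> = (if k = 1 then 0 else g (k - 1))" using k by auto
    also have "\<dots> = W (k - 1)"
    proof (cases "k = 1")
      case False
      then have "t (k - 1 - 1) < t (k - 1)" using mono[of "k - 1 - 1" "k - 1"] k by auto
      then show ?thesis using False by (simp add: g_def sk)
    qed (simp add: W)
    finally show ?thesis using pos by (simp add: sk)
  qed
qed

lemma continuous_interpolant:
  assumes n: "1 \<le> n" and t: "t 0 = 0" "t n = 1" "strict_mono_on {0..n} t" and W: "W 0 = 0"
  shows "continuous_on {0..1} (interpolant n t W)"
proof -
  have "continuous_on (\<Union>k\<in>{1..n}. {t (k - 1)..t k}) (interpolant n t W)"
  proof (rule continuous_on_closed_Union)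
    fix k assume k: "k \<in> {1..n}"
    have "t (k - 1) < t k" using t(3) k by (auto simp: strict_mono_on_def)
    then have "continuous_on {t (k - 1)..t k} (\<lambda>s. (t k - s) / (t k - t (k - 1)) * W (k - 1) + (s - t (k - 1)) / (t k - t (k - 1)) * W k)"
      by (intro continuous_intros) auto
    then show "continuous_on {t (k - 1)..t k} (interpolant n t W)"
      by (rule continuous_on_eq) (simp add: interpolant_at[where W=W, OF t(3) W k])
  qed auto
  moreover have "{0..1} \<subseteq> (\<Union>k\<in>{1..n}. {t (k - 1)..t k})"
    using partition_cover[OF n, of t] t by auto
  ultimately show ?thesis by (rule continuous_on_subset)
qed

text \<open>The set is the complement of the shifted cut, the vertical ray from \<open>c\<close>
  upwards; it contains the real axis apart from \<open>c\<close>, so the boundary may be crossed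
  there.\<close>

lemma powr_down_holomorphic:
  "(\<lambda>\<zeta>. powr_down (\<zeta> - of_real c) a) holomorphic_on {\<zeta>. Im \<zeta> < 0 \<or> Re \<zeta> \<noteq> c}"
  unfolding powr_down_def Ln_down_def
  by (intro holomorphic_intros) (auto simp: complex_nonpos_Reals_iff)

lemma powr_down_of_real:
  assumes "x \<noteq> 0"
  shows "powr_down (of_real x) a = of_real (\<bar>x\<bar> powr a) * (if 0 < x then 1 else cis (- (pi * a)))"
proof -
  have L: "Ln_down (of_real x) = of_real (ln \<bar>x\<bar>) - (if 0 < x then 0 else \<i> * of_real pi)"
    using assms by (simp add: Ln_down_def Ln_times_ii Ln_of_real' algebra_simps)
  have "powr_down (of_real x) a = exp (of_real (a * ln \<bar>x\<bar>) + \<i> * of_real (if 0 < x then 0 else - (pi * a)))"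
    unfolding powr_down_def L by (simp add: algebra_simps)
  also have "\<dots> = of_real (exp (a * ln \<bar>x\<bar>)) * cis (if 0 < x then 0 else - (pi * a))"
    by (simp add: exp_add cis_conv_exp flip: exp_of_real)
  finally show ?thesis using assms by (auto simp: powr_def)
qed

section \<open>Boundary behaviour of the Schwarz--Christoffel map\<close>

lemma closure_lower_half_plane: "closure lower_half_plane = {z. Im z \<le> 0}"
proof -
  have "lower_half_plane = {z. \<i> \<bullet> z < 0}" "{z. Im z \<le> 0} = {z. \<i> \<bullet> z \<le> 0}"
    by (auto simp: lower_half_plane_def)
  then show ?thesis using closure_halfspace_lt[of \<i> 0] by simp
qed

lemma convex_lower_half_plane: "convex lower_half_plane"
  unfolding lower_half_plane_def by (rule convex_halfspace_Im_lt)

lemma open_lower_half_plane: "open lower_half_plane"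
  unfolding lower_half_plane_def by (rule open_halfspace_Im_lt)

lemma cis_Arg2pi: "z \<noteq> 0 \<Longrightarrow> cis (Arg2pi z) = z / of_real (norm z)"
  using Arg2pi[of z] by (simp add: is_Arg_def cis_conv_exp field_simps)

text \<open>As \<open>p\<close> is holomorphic in the full vertical strip over the interval,
  \<open>C\<close> times a primitive of \<open>p\<close> continues \<open>\<phi>\<close> across it.
  The derivative along the interval is \<open>C * u\<close> times a positive number, so
  \<open>\<phi>\<close> moves straight in the direction \<open>C * u\<close>. The end points
  \<open>l\<close> and \<open>r\<close>, where \<open>p\<close> may be singular, are reached by
  continuity.\<close>

lemma boundary_straight:
  fixes \<phi> p :: "complex \<Rightarrow> complex"
  assumes cont: "continuous_on {z. Im z \<le> 0} \<phi>"
    and der: "\<And>x. x \<in> lower_half_plane \<Longrightarrow> (\<phi> has_field_derivative C * p x) (at x)"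
    and hol: "p holomorphic_on {\<zeta>. l < Re \<zeta> \<and> Re \<zeta> < r}"
    and phase: "\<And>x. l < x \<Longrightarrow> x < r \<Longrightarrow> 0 < R x \<and> p (of_real x) = of_real (R x) * u"
    and u: "C * u \<noteq> 0" and xy: "l \<le> x" "x < y" "y \<le> r"
  shows "\<exists>s>0. \<phi> (of_real y) = \<phi> (of_real x) + C * u * of_real s"
proof -
  let ?Q = "{\<zeta>. l < Re \<zeta> \<and> Re \<zeta> < r}"
  have "?Q = {\<zeta>. l < Re \<zeta>} \<inter> {\<zeta>. Re \<zeta> < r}" by auto
  then have Q: "convex ?Q" "open ?Q"
    by (simp_all add: convex_Int convex_halfspace_Re_gt convex_halfspace_Re_lt open_Int
        open_halfspace_Re_gt open_halfspace_Re_lt)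
  obtain G where G: "\<And>x. x \<in> ?Q \<Longrightarrow> (G has_field_derivative p x) (at x within ?Q)"
    using holomorphic_convex_primitive'[OF Q hol] by blast
  then have G: "(G has_field_derivative p x) (at x)" if "x \<in> ?Q" for x
    using Q(2) that at_within_open by metis
  let ?S = "?Q \<inter> lower_half_plane"
  have S: "convex ?S" "open ?S"
    using Q convex_lower_half_plane open_lower_half_plane by (auto intro: convex_Int open_Int)
  have "\<exists>c. \<forall>x\<in>?S. \<phi> x - C * G x = c"
  proof (rule has_field_derivative_zero_constant[OF S(1)])
    fix x assume x: "x \<in> ?S"
    have "((\<lambda>x. \<phi> x - C * G x) has_field_derivative (C * p x - C * p x)) (at x)"
      using x by (intro DERIV_diff der DERIV_cmult G) auto
    then show "((\<lambda>x. \<phi> x - C * G x) has_field_derivative 0) (at x within ?S)"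
      by (simp add: has_field_derivative_at_within)
  qed
  then obtain c where c: "\<And>x. x \<in> ?S \<Longrightarrow> \<phi> x = C * G x + c" by (metis diff_eq_eq add.commute)
  have bd: "\<phi> (of_real a) = C * G (of_real a) + c" if a: "l < a" "a < r" for a
  proof -
    define s where "s n = of_real a - \<i> * of_real (1 / real (Suc n))" for n
    have "(\<lambda>n. of_real a - \<i> * of_real (1 / real (Suc n)) :: complex) \<longlonglongrightarrow> of_real a - \<i> * of_real 0"
      by (intro tendsto_intros) real_asymp
    then have s: "s \<longlonglongrightarrow> of_real a" by (simp add: s_def[abs_def])
    have sS: "s n \<in> ?S" for n using a by (simp add: s_def lower_half_plane_def)
    have "(\<lambda>n. \<phi> (s n)) \<longlonglongrightarrow> \<phi> (of_real a)"
      by (rule continuous_on_tendsto_compose[OF cont s]) (use sS in \<open>auto simp: lower_half_plane_def less_imp_le\<close>)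
    moreover have "isCont G (of_real a)" using a by (intro DERIV_isCont[OF G]) auto
    then have "(\<lambda>n. C * G (s n) + c) \<longlonglongrightarrow> C * G (of_real a) + c"
      by (intro tendsto_intros isCont_tendsto_compose[OF _ s])
    moreover have "(\<lambda>n. \<phi> (s n)) = (\<lambda>n. C * G (s n) + c)" using c[OF sS] by simp
    ultimately show ?thesis using LIMSEQ_unique by metis
  qed
  \<comment> \<open>After division by \<open>C * u\<close> the velocity is real and positive: the
    real part increases and the imaginary part is constant.\<close>
  define \<psi> where "\<psi> a = \<phi> (of_real a) / (C * u)" for a
  have u0: "C \<noteq> 0" "u \<noteq> 0" using u by auto
  have d: "(\<psi> has_vector_derivative of_real (R a)) (at a)" if a: "l < a" "a < r" for a
  proof -
    have "((\<lambda>x. (C * G x + c) / (C * u)) has_field_derivative C * p (of_real a) / (C * u)) (at (of_real a))"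
      by (intro DERIV_cdivide) (use G[of "of_real a"] a in \<open>auto intro!: derivative_eq_intros\<close>)
    then have "((\<lambda>x. (C * G (of_real x) + c) / (C * u)) has_vector_derivative C * p (of_real a) / (C * u)) (at a)"
      by (rule has_vector_derivative_real_field)
    moreover have "C * p (of_real a) / (C * u) = of_real (R a)" using phase[OF a] u0 by simp
    ultimately have "((\<lambda>x. (C * G (of_real x) + c) / (C * u)) has_vector_derivative of_real (R a)) (at a)"
      by simp
    then show ?thesis
      by (rule has_vector_derivative_transform_within_open[of _ _ _ "{l<..<r}"])
         (use a bd in \<open>auto simp: \<psi>_def\<close>)
  qed
  have \<psi>c: "continuous_on UNIV \<psi>"
    unfolding \<psi>_def using u by (intro continuous_intros continuous_on_compose2[OF cont]) auto
  have dR: "((\<lambda>a. Re (\<psi> a)) has_real_derivative R a) (at a)"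
    and dI: "((\<lambda>a. Im (\<psi> a)) has_real_derivative 0) (at a)" if "l < a" "a < r" for a
  proof -
    show "((\<lambda>a. Re (\<psi> a)) has_real_derivative R a) (at a)"
      using bounded_linear.has_vector_derivative[OF bounded_linear_Re d[OF that]]
      by (simp add: has_real_derivative_iff_has_vector_derivative)
    show "((\<lambda>a. Im (\<psi> a)) has_real_derivative 0) (at a)"
      using bounded_linear.has_vector_derivative[OF bounded_linear_Im d[OF that]]
      by (simp add: has_real_derivative_iff_has_vector_derivative)
  qed
  have cI: "continuous_on {x..y} (\<lambda>a. Re (\<psi> a))" "continuous_on {x..y} (\<lambda>a. Im (\<psi> a))"
    using \<psi>c by (auto intro!: continuous_intros intro: continuous_on_subset)
  have "Re (\<psi> x) < Re (\<psi> y)"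
  proof (rule DERIV_pos_imp_increasing_open[OF xy(2) _ cI(1)])
    fix a assume "x < a" "a < y"
    then have "l < a" "a < r" using xy by auto
    then show "\<exists>D. ((\<lambda>a. Re (\<psi> a)) has_real_derivative D) (at a) \<and> 0 < D" using dR phase by blast
  qed
  moreover have "Im (\<psi> y) = Im (\<psi> x)"
    by (rule DERIV_isconst_end[OF xy(2) cI(2)]) (use dI xy in auto)
  ultimately have "\<psi> y = \<psi> x + of_real (Re (\<psi> y) - Re (\<psi> x))" by (simp add: complex_eq_iff)
  then have "\<phi> (of_real y) = \<phi> (of_real x) + C * u * of_real (Re (\<psi> y) - Re (\<psi> x))"
    using u by (simp add: \<psi>_def field_simps)
  then show ?thesis using \<open>Re (\<psi> x) < Re (\<psi> y)\<close> by (intro exI[of _ "Re (\<psi> y) - Re (\<psi> x)"]) simp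
qed

section \<open>Directions of the boundary sides\<close>

locale schwarz_christoffel =
  fixes n :: nat and t W z :: "nat \<Rightarrow> real" and \<gamma> :: "real \<Rightarrow> real" and \<phi> :: "complex \<Rightarrow> complex"
  assumes n: "1 \<le> n"
    and t: "t 0 = 0" "t n = 1" "strict_mono_on {0..n} t"
    and W: "W 0 = 0" "W n = 0"
    and \<gamma>: "\<gamma> = interpolant n t W"
    and z: "z 1 = 0" "z (n + 1) = 1" "strict_mono_on {1..n + 1} z"
    and \<phi>: "schwarz_christoffel_map n (vertex t W) (strip_below \<gamma>) z \<phi>"
begin

sublocale strip_curve \<gamma>
  by unfold_locales (unfold \<gamma>, rule continuous_interpolant[where W=W, OF n t W(1)])

definition alpha :: "nat \<Rightarrow> real" where "alpha k = interior_angle n (vertex t W) k - 1"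

definition integrand :: "complex \<Rightarrow> complex" where
  "integrand \<zeta> = (\<Prod>k=1..n+1. powr_down (\<zeta> - of_real (z k)) (alpha k))"

text \<open>The constant direction of \<open>integrand\<close> on the real interval from
  \<open>z j\<close> to \<open>z (j + 1)\<close>: a factor whose \<open>z k\<close> is to the right
  has a negative base and contributes the argument \<open>- (pi * alpha k)\<close>. The indices 0
  and \<open>n + 1\<close> stand for the two unbounded intervals.\<close>

definition phase :: "nat \<Rightarrow> complex" where
  "phase j = (\<Prod>k=1..n+1. if k \<le> j then 1 else cis (- (pi * alpha k)))"

lemma t_mono: "i < j \<Longrightarrow> j \<le> n \<Longrightarrow> t i < t j"
  using t(3) by (auto simp: strict_mono_on_def)

lemma z_mono: "1 \<le> i \<Longrightarrow> i < j \<Longrightarrow> j \<le> n + 1 \<Longrightarrow> z i < z j"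
  using z(3) by (auto simp: strict_mono_on_def)

lemma z_mono': "1 \<le> i \<Longrightarrow> i \<le> j \<Longrightarrow> j \<le> n + 1 \<Longrightarrow> z i \<le> z j"
  using z_mono[of i j] by (cases "i = j") auto

lemma phi_cont: "continuous_on {z. Im z \<le> 0} \<phi>"
  and phi_holo: "\<phi> holomorphic_on lower_half_plane"
  and phi_bij: "bij_betw \<phi> lower_half_plane (strip_below \<gamma>)"
  and phi_vertex: "k \<in> {1..n+1} \<Longrightarrow> \<phi> (of_real (z k)) = Complex (t (k - 1)) (W (k - 1))"
  and phi_infinity: "filterlim \<phi> at_infinity (inf at_infinity (principal {z. Im z \<le> 0}))"
  using \<phi> by (auto simp: schwarz_christoffel_map_def closure_lower_half_plane vertex_def)

lemma phi_deriv:
  obtains C where "C \<noteq> 0"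
    "\<And>x. x \<in> lower_half_plane \<Longrightarrow> (\<phi> has_field_derivative C * integrand x) (at x)"
proof -
  let ?H = lower_half_plane
  have "\<exists>A C. C \<noteq> 0 \<and> (\<exists>b\<in>?H. \<forall>x\<in>?H. \<phi> x = A + C * contour_integral (linepath b x) integrand)"
    using \<phi> unfolding schwarz_christoffel_map_def integrand_def[abs_def] alpha_def by (elim conjE)
  then obtain A C where C: "C \<noteq> 0"
    and "\<exists>b\<in>?H. \<forall>x\<in>?H. \<phi> x = A + C * contour_integral (linepath b x) integrand"
    by (elim exE conjE) (rule that)
  then obtain b where b: "b \<in> ?H"
    and eq: "\<forall>x\<in>?H. \<phi> x = A + C * contour_integral (linepath b x) integrand"
    by (elim bexE) (rule that)
  have hol: "integrand holomorphic_on ?H"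
    unfolding integrand_def[abs_def]
    by (rule holomorphic_on_prod, rule holomorphic_on_subset[OF powr_down_holomorphic])
       (auto simp: lower_half_plane_def)
  obtain G where G: "\<And>x. x \<in> ?H \<Longrightarrow> (G has_field_derivative integrand x) (at x within ?H)"
    using holomorphic_convex_primitive'[OF convex_lower_half_plane open_lower_half_plane hol] by blast
  have I: "contour_integral (linepath b x) integrand = G x - G b" if "x \<in> ?H" for x
  proof -
    have "path_image (linepath b x) \<subseteq> ?H"
      using b that convex_lower_half_plane by (simp add: closed_segment_subset)
    from contour_integral_primitive[where f=G and f'=integrand and S="?H", OF G valid_path_linepath this]
    have "(integrand has_contour_integral G x - G b) (linepath b x)" by simp
    then show ?thesis by (rule contour_integral_unique)
  qed
  have "(\<phi> has_field_derivative C * integrand x) (at x)" if x: "x \<in> ?H" for x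
  proof -
    have "(G has_field_derivative integrand x) (at x)"
      using G[OF x] unfolding at_within_open[OF x open_lower_half_plane] .
    from DERIV_add[OF DERIV_const DERIV_cmult[OF DERIV_diff[OF this DERIV_const]], of A C "G b"]
    have "((\<lambda>x. A + C * (G x - G b)) has_field_derivative C * integrand x) (at x)" by simp
    then show ?thesis
    proof (rule has_field_derivative_transform_within_open[OF _ open_lower_half_plane x])
      fix y assume "y \<in> ?H"
      then show "A + C * (G y - G b) = \<phi> y" using eq by (simp only: I)
    qed
  qed
  with C show ?thesis by (rule that)
qed

lemma integrand_phase:
  assumes j: "j \<le> n + 1"
    and lo: "\<And>k. k \<in> {1..j} \<Longrightarrow> z k < x" and hi: "\<And>k. k \<in> {j+1..n+1} \<Longrightarrow> x < z k"
  shows "integrand (of_real x) = of_real (\<Prod>k=1..n+1. \<bar>x - z k\<bar> powr alpha k) * phase j"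
    and "0 < (\<Prod>k=1..n+1. \<bar>x - z k\<bar> powr alpha k)"
proof -
  have ne: "x - z k \<noteq> 0" if "k \<in> {1..n+1}" for k
    using lo[of k] hi[of k] that by (cases "k \<le> j") auto
  have "powr_down (of_real x - of_real (z k)) (alpha k) =
      of_real (\<bar>x - z k\<bar> powr alpha k) * (if k \<le> j then 1 else cis (- (pi * alpha k)))"
    if k: "k \<in> {1..n+1}" for k
  proof -
    have "0 < x - z k \<longleftrightarrow> k \<le> j" using lo[of k] hi[of k] k by (cases "k \<le> j") auto
    then show ?thesis using powr_down_of_real[OF ne[OF k], of "alpha k"] by simp
  qed
  then show "integrand (of_real x) = of_real (\<Prod>k=1..n+1. \<bar>x - z k\<bar> powr alpha k) * phase j"
    unfolding integrand_def phase_def of_real_prod prod.distrib[symmetric]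
    by (intro prod.cong) auto
  show "0 < (\<Prod>k=1..n+1. \<bar>x - z k\<bar> powr alpha k)"
    using ne by (intro prod_pos) auto
qed

lemma phase_nonzero: "phase j \<noteq> 0"
  unfolding phase_def by (auto simp: cis_neq_zero)

text \<open>One admissible constant is fixed for all boundary intervals, so that the directions on
  neighbouring ones can be compared.\<close>

definition scale :: complex where
  "scale = (SOME C. C \<noteq> 0 \<and> (\<forall>x\<in>lower_half_plane. (\<phi> has_field_derivative C * integrand x) (at x)))"

lemma scale:
  shows scale_nonzero: "scale \<noteq> 0"
    and phi_deriv_scale: "x \<in> lower_half_plane \<Longrightarrow> (\<phi> has_field_derivative scale * integrand x) (at x)"
proof -
  have "\<exists>C. C \<noteq> 0 \<and> (\<forall>x\<in>lower_half_plane. (\<phi> has_field_derivative C * integrand x) (at x))"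
    by (rule phi_deriv) blast
  from someI_ex[OF this] show "scale \<noteq> 0"
    "x \<in> lower_half_plane \<Longrightarrow> (\<phi> has_field_derivative scale * integrand x) (at x)"
    unfolding scale_def by blast+
qed

lemma phi_straight:
  assumes j: "j \<le> n + 1" and lo: "\<And>k. k \<in> {1..j} \<Longrightarrow> z k \<le> l" and hi: "\<And>k. k \<in> {j+1..n+1} \<Longrightarrow> r \<le> z k"
    and xy: "l \<le> x" "x < y" "y \<le> r"
  shows "\<exists>s>0. \<phi> (of_real y) = \<phi> (of_real x) + scale * phase j * of_real s"
proof -
  have hol: "integrand holomorphic_on {\<zeta>. l < Re \<zeta> \<and> Re \<zeta> < r}"
    unfolding integrand_def[abs_def]
  proof (rule holomorphic_on_prod, rule holomorphic_on_subset[OF powr_down_holomorphic])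
    fix k assume "k \<in> {1..n+1}"
    then have "z k \<le> l \<or> r \<le> z k" using lo[of k] hi[of k] by (cases "k \<le> j") auto
    then show "{\<zeta>. l < Re \<zeta> \<and> Re \<zeta> < r} \<subseteq> {\<zeta>. Im \<zeta> < 0 \<or> Re \<zeta> \<noteq> z k}" by auto
  qed
  show ?thesis
  proof (rule boundary_straight[OF phi_cont phi_deriv_scale hol _ _ xy])
    show "scale * phase j \<noteq> 0" using scale_nonzero phase_nonzero by simp
    fix a assume "l < a" "a < r"
    then show "0 < (\<Prod>k=1..n+1. \<bar>a - z k\<bar> powr alpha k) \<and>
        integrand (of_real a) = of_real (\<Prod>k=1..n+1. \<bar>a - z k\<bar> powr alpha k) * phase j"
      using integrand_phase[OF j, of a] lo hi by (meson le_less_trans less_le_trans)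
  qed
qed

lemma phase_last: "phase (n + 1) = 1" "phase n = cis (- (pi * alpha (n + 1)))"
proof -
  show "phase (n + 1) = 1" unfolding phase_def by (rule prod.neutral) auto
  have "phase n = (\<Prod>k=1..n. if k \<le> n then 1 else cis (- (pi * alpha k))) * cis (- (pi * alpha (n + 1)))"
    unfolding phase_def by simp
  also have "(\<Prod>k=1..n. if k \<le> n then 1 else cis (- (pi * alpha k))) = 1" by (rule prod.neutral) auto
  finally show "phase n = cis (- (pi * alpha (n + 1)))" by simp
qed

lemma phase_first: "phase 0 = cis (- (pi * alpha 1)) * phase 1"
proof -
  have "phase 0 = cis (- (pi * alpha 1)) * (\<Prod>k=2..n+1. if k \<le> 0 then 1 else cis (- (pi * alpha k)))"
    unfolding phase_def by (subst prod.atLeast_Suc_atMost) (auto simp: numeral_2_eq_2)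
  moreover have "phase 1 = (\<Prod>k=2..n+1. if k \<le> 1 then 1 else cis (- (pi * alpha k)))"
    unfolding phase_def by (subst prod.atLeast_Suc_atMost) (auto simp: numeral_2_eq_2)
  moreover have "(\<Prod>k=2..n+1. if k \<le> 0 then 1 else cis (- (pi * alpha k))) = (\<Prod>k=2..n+1. if k \<le> 1 then 1 else cis (- (pi * alpha k)))"
    by (rule prod.cong) auto
  ultimately show ?thesis by simp
qed

definition vert :: "nat \<Rightarrow> complex" where "vert = vertex t W"

lemma vert_diff: "k \<in> {1..n} \<Longrightarrow> Re (vert k) < Re (vert (k + 1))"
  using t_mono[of "k - 1" k] by (auto simp: vert_def vertex_def)

text \<open>\<open>phi_straight\<close> on the whole interval, whose end points go to the two
  vertices, shows that \<open>scale * phase k\<close> is a positive multiple of the edge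
  vector.\<close>

lemma phi_edge:
  assumes k: "k \<in> {1..n}" and xy: "z k \<le> x" "x < y" "y \<le> z (k + 1)"
  shows "\<exists>s>0. \<phi> (of_real y) = \<phi> (of_real x) + (vert (k + 1) - vert k) * of_real s"
proof -
  have S': "\<exists>s>0. \<phi> (of_real y) = \<phi> (of_real x) + scale * phase k * of_real s"
    if "z k \<le> x" "x < y" "y \<le> z (k + 1)" for x y
    by (rule phi_straight[of k "z k" "z (k + 1)", OF _ _ _ that]) (use k z_mono' in auto)
  obtain s where s: "0 < s" "\<phi> (of_real y) = \<phi> (of_real x) + scale * phase k * of_real s" using S'[OF xy] by blast
  obtain r where r: "0 < r" "\<phi> (of_real (z (k + 1))) = \<phi> (of_real (z k)) + scale * phase k * of_real r"
    using S'[of "z k" "z (k + 1)"] z_mono[of k "k + 1"] k by auto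
  have "scale * phase k = (vert (k + 1) - vert k) / of_real r"
    using r k by (simp add: phi_vertex vert_def vertex_def field_simps)
  then have "\<phi> (of_real y) = \<phi> (of_real x) + (vert (k + 1) - vert k) * of_real (s / r)"
    using s by simp
  then show ?thesis using s r by (intro exI[of _ "s / r"]) simp
qed

text \<open>The side has no second finite vertex, so its direction is found by turning:
  \<open>phase 0\<close> and \<open>phase 1\<close> differ by \<open>cis (- (pi * alpha 1))\<close>,
  and this rotation by the interior angle takes the direction \<open>D\<close> of the first edge to
  the vertical.\<close>

lemma phi_left:
  assumes "x < y" "y \<le> 0" shows "\<exists>s>0. \<phi> (of_real y) = \<phi> (of_real x) + \<i> * of_real s"
proof -
  define D where "D = vert 2 - vert 1"
  have D: "D \<noteq> 0" using vert_diff[of 1] n by (auto simp: D_def numeral_2_eq_2)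
  obtain s where s: "0 < s" "\<phi> (of_real y) = \<phi> (of_real x) + scale * phase 0 * of_real s"
    using phi_straight[of 0 x 0 x y] z_mono'[of 1] z(1) assms by auto
  obtain r where r: "0 < r" "\<phi> (of_real (z 2)) = \<phi> (of_real (z 1)) + scale * phase 1 * of_real r"
    using phi_straight[of 1 "z 1" "z 2" "z 1" "z 2"] z_mono[of 1 2] z_mono'[of 2] n by auto
  have C1: "scale * phase 1 = D / of_real r"
    using r n phi_vertex[of 1] phi_vertex[of 2] by (simp add: D_def vert_def vertex_def field_simps)
  \<comment> \<open>The quotient of the following and the preceding edge in
    \<open>interior_angle\<close>, the preceding one being the side that goes down;
    \<open>Arg2pi X\<close> is the interior angle.\<close>
  define X where "X = D / (- \<i>)"
  have X: "X \<noteq> 0" "norm X = norm D" using D by (auto simp: X_def norm_divide norm_mult)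
  have "pi * alpha 1 = Arg2pi X - pi"
    using n by (simp add: alpha_def interior_angle_def X_def D_def vert_def numeral_2_eq_2 algebra_simps)
  then have "- (pi * alpha 1) = pi + (- Arg2pi X)" by simp
  then have "cis (- (pi * alpha 1)) = cis pi * cnj (cis (Arg2pi X))"
    by (simp only: cis_cnj cis_mult)
  also have "\<dots> = - cnj X / of_real (norm D)" using X by (simp add: cis_Arg2pi)
  finally have c: "cis (- (pi * alpha 1)) = - cnj X / of_real (norm D)" .
  have "scale * phase 0 = cis (- (pi * alpha 1)) * (scale * phase 1)" by (simp add: phase_first mult_ac)
  also have "\<dots> = - cnj X / of_real (norm D) * (D / of_real r)" unfolding c C1 ..
  also have "cnj X = - \<i> * cnj D" by (simp add: X_def)
  also have "- (- \<i> * cnj D) / of_real (norm D) * (D / of_real r) = \<i> * (D * cnj D) / (of_real (norm D) * of_real r)"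
    by (simp add: mult_ac)
  also have "D * cnj D = of_real (norm D) * of_real (norm D)"
    by (simp add: complex_norm_square[symmetric] power2_eq_square)
  finally have "scale * phase 0 = \<i> * of_real (norm D / r)" using D by simp
  then have "\<phi> (of_real y) = \<phi> (of_real x) + \<i> * of_real (norm D / r * s)" using s by simp
  then show ?thesis using s r D by (intro exI[of _ "norm D / r * s"]) simp
qed

lemma phi_right:
  assumes "1 \<le> x" "x < y" shows "\<exists>s>0. \<phi> (of_real y) = \<phi> (of_real x) - \<i> * of_real s"
proof -
  define D where "D = vert (n + 1) - vert n"
  have D: "D \<noteq> 0" using vert_diff[of n] n by (auto simp: D_def)
  obtain s where s: "0 < s" "\<phi> (of_real y) = \<phi> (of_real x) + scale * phase (n + 1) * of_real s"
    using phi_straight[of "n + 1" 1 y x y] z_mono'[of _ "n + 1"] z(2) assms by auto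
  obtain r where r: "0 < r" "\<phi> (of_real (z (n + 1))) = \<phi> (of_real (z n)) + scale * phase n * of_real r"
    using phi_straight[of n "z n" "z (n + 1)" "z n" "z (n + 1)"] z_mono[of n "n + 1"] z_mono'[of _ n] n by auto
  have C1: "scale * phase n = D / of_real r"
    using r n phi_vertex[of n] phi_vertex[of "n + 1"] by (simp add: D_def vert_def vertex_def field_simps)
  \<comment> \<open>At the last vertex the downward side is the following edge, and the preceding
    one points backwards along \<open>D\<close>.\<close>
  define X where "X = (- \<i>) / (vert n - vert (n + 1))"
  have XD: "X = \<i> / D" using D by (simp add: X_def D_def divide_simps algebra_simps)
  have X: "X \<noteq> 0" "norm X = 1 / norm D" using D by (auto simp: XD norm_divide norm_mult)
  have "pi * alpha (n + 1) = Arg2pi X - pi"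
    using n by (simp add: alpha_def interior_angle_def X_def vert_def algebra_simps)
  then have "cis (pi * alpha (n + 1)) = - cis (Arg2pi X)"
    by (simp flip: cis_divide)
  also have "\<dots> = - \<i> * of_real (norm D) / D" using X by (simp add: cis_Arg2pi XD)
  finally have c: "cis (pi * alpha (n + 1)) = - \<i> * of_real (norm D) / D" .
  have "scale * phase (n + 1) = (scale * phase n) * cis (pi * alpha (n + 1))"
    unfolding phase_last by (simp add: cis_mult mult.assoc)
  also have "\<dots> = - \<i> * of_real (norm D / r)" unfolding C1 c using D by simp
  finally have "\<phi> (of_real y) = \<phi> (of_real x) - \<i> * of_real (norm D / r * s)" using s by simp
  then show ?thesis using s r D by (intro exI[of _ "norm D / r * s"]) simp
qed

end

section \<open>The boundary correspondence\<close>

context schwarz_christoffel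
begin

lemma gamma_at:
  "k \<in> {1..n} \<Longrightarrow> t (k - 1) \<le> s \<Longrightarrow> s \<le> t k \<Longrightarrow> \<gamma> s =
    (t k - s) / (t k - t (k - 1)) * W (k - 1) + (s - t (k - 1)) / (t k - t (k - 1)) * W k"
  unfolding \<gamma> using t(3) W(1) by (rule interpolant_at)

lemma gamma_ends: "\<gamma> 0 = 0" "\<gamma> 1 = 0"
  using gamma_at[of 1 0] gamma_at[of n 1] t_mono[of 0 1] t_mono[of "n - 1" n] n t W by auto

lemma phi_ends: "\<phi> 0 = 0" "\<phi> 1 = 1"
  using phi_vertex[of 1] phi_vertex[of "n + 1"] n z t W by (auto simp: complex_eq_iff)

lemma phi_vert: "k \<in> {1..n+1} \<Longrightarrow> \<phi> (of_real (z k)) = vert k"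
  by (simp add: phi_vertex vert_def vertex_def)

text \<open>Going straight from the left vertex to the point gives a parameter
  \<open>\<sigma>\<close> \<ge> 0, and going on from there to the right vertex gives a second one.
  They add up to 1, so \<open>\<sigma>\<close> is at most 1.\<close>

lemma phi_edge_graph:
  assumes k: "k \<in> {1..n}" and x: "z k \<le> x" "x \<le> z (k + 1)"
  shows "t (k - 1) \<le> Re (\<phi> (of_real x))" "Re (\<phi> (of_real x)) \<le> t k"
    "Im (\<phi> (of_real x)) = \<gamma> (Re (\<phi> (of_real x)))"
proof -
  have "\<exists>\<sigma>\<ge>0. \<phi> (of_real x) = vert k + (vert (k + 1) - vert k) * of_real \<sigma>"
  proof (cases "z k = x")
    case True then show ?thesis using k phi_vert[of k] by (intro exI[of _ 0]) auto
  next
    case False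
    then obtain s where "0 < s" "\<phi> (of_real x) = \<phi> (of_real (z k)) + (vert (k + 1) - vert k) * of_real s"
      using phi_edge[OF k, of "z k" x] x by auto
    then show ?thesis using k phi_vert[of k] by (intro exI[of _ s]) auto
  qed
  then obtain \<sigma> where \<sigma>: "0 \<le> \<sigma>" "\<phi> (of_real x) = vert k + (vert (k + 1) - vert k) * of_real \<sigma>" by blast
  have "\<exists>\<sigma>\<ge>0. vert (k + 1) = \<phi> (of_real x) + (vert (k + 1) - vert k) * of_real \<sigma>"
  proof (cases "x = z (k + 1)")
    case True then show ?thesis using k phi_vert[of "k + 1"] by (intro exI[of _ 0]) auto
  next
    case False
    then obtain s where "0 < s" "\<phi> (of_real (z (k + 1))) = \<phi> (of_real x) + (vert (k + 1) - vert k) * of_real s"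
      using phi_edge[OF k, of x "z (k + 1)"] x by auto
    then show ?thesis using k phi_vert[of "k + 1"] by (intro exI[of _ s]) auto
  qed
  then obtain \<sigma>' where \<sigma>': "0 \<le> \<sigma>'" "vert (k + 1) = \<phi> (of_real x) + (vert (k + 1) - vert k) * of_real \<sigma>'" by blast
  have e: "vert (k + 1) = vert k + (vert (k + 1) - vert k) * of_real \<sigma> + (vert (k + 1) - vert k) * of_real \<sigma>'"
    using \<sigma>'(2) \<sigma>(2) by (simp only:)
  have "(vert (k + 1) - vert k) * (1 - of_real \<sigma> - of_real \<sigma>') =
      vert (k + 1) - (vert k + (vert (k + 1) - vert k) * of_real \<sigma> + (vert (k + 1) - vert k) * of_real \<sigma>')"
    by (simp add: algebra_simps)
  then have "(vert (k + 1) - vert k) * (1 - of_real \<sigma> - of_real \<sigma>') = 0"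
    using e by simp
  then have "1 - of_real \<sigma> - of_real \<sigma>' = (0 :: complex)" using vert_diff[OF k] by auto
  then have "1 - \<sigma> - \<sigma>' = 0" by (simp add: complex_eq_iff)
  then have \<sigma>1: "\<sigma> \<le> 1" using \<sigma>'(1) by linarith
  have tk: "t (k - 1) < t k" using t_mono[of "k - 1" k] k by auto
  have R: "Re (\<phi> (of_real x)) = t (k - 1) + \<sigma> * (t k - t (k - 1))"
    and I: "Im (\<phi> (of_real x)) = W (k - 1) + \<sigma> * (W k - W (k - 1))"
    unfolding \<sigma>(2) by (simp_all add: vert_def vertex_def)
  show 1: "t (k - 1) \<le> Re (\<phi> (of_real x))" unfolding R using \<sigma>(1) tk by simp
  have "\<sigma> * (t k - t (k - 1)) \<le> 1 * (t k - t (k - 1))" using \<sigma>1 tk by (intro mult_right_mono) auto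
  then show 2: "Re (\<phi> (of_real x)) \<le> t k" unfolding R by simp
  have f: "(t k - Re (\<phi> (of_real x))) / (t k - t (k - 1)) = 1 - \<sigma>"
    "(Re (\<phi> (of_real x)) - t (k - 1)) / (t k - t (k - 1)) = \<sigma>"
    unfolding R using tk by (simp_all add: field_simps)
  show "Im (\<phi> (of_real x)) = \<gamma> (Re (\<phi> (of_real x)))"
    unfolding gamma_at[OF k 1 2] f I by (simp add: algebra_simps)
qed

lemma Re_phi_edge_mono:
  assumes k: "k \<in> {1..n}" and xy: "z k \<le> x" "x < y" "y \<le> z (k + 1)"
  shows "Re (\<phi> (of_real x)) < Re (\<phi> (of_real y))"
  using phi_edge[OF assms] vert_diff[OF k] by auto

lemma z_cover: "0 \<le> x \<Longrightarrow> x \<le> 1 \<Longrightarrow> \<exists>k\<in>{1..n}. z k \<le> x \<and> x \<le> z (k + 1)"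
  using partition_cover[OF n, of "\<lambda>k. z (k + 1)" x] z by auto

lemma Re_phi_vertex: "k \<in> {1..n+1} \<Longrightarrow> Re (\<phi> (of_real (z k))) = t (k - 1)"
  by (simp add: phi_vertex)

lemma Re_phi_mono:
  assumes "0 \<le> x" "x < y" "y \<le> 1" shows "Re (\<phi> (of_real x)) < Re (\<phi> (of_real y))"
proof -
  obtain k where k: "k \<in> {1..n}" "z k \<le> x" "x \<le> z (k + 1)" using z_cover[of x] assms by auto
  obtain l where l: "l \<in> {1..n}" "z l \<le> y" "y \<le> z (l + 1)" using z_cover[of y] assms by auto
  consider "l < k" | "k = l" | "k < l" by linarith
  then show ?thesis
  proof cases
    case 1
    then have "z (l + 1) \<le> z k" using k(1) l(1) by (intro z_mono') auto
    then show ?thesis using k l assms by linarith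
  next
    case 2 then show ?thesis using Re_phi_edge_mono[of k x y] k l assms by auto
  next
    case 3
    have a: "Re (\<phi> (of_real x)) \<le> t k" "t (l - 1) \<le> Re (\<phi> (of_real y))"
      using phi_edge_graph k l by auto
    have "k = l - 1 \<or> k < l - 1" "l - 1 \<le> n" using 3 l(1) by auto
    then have b: "t k \<le> t (l - 1)" using t_mono[of k "l - 1"] by (metis less_imp_le order_refl)
    \<comment> \<open>The bounds \<open>a\<close> and \<open>b\<close> give only a weak inequality.
      It is strict because \<open>x\<close> is short of the right end of its edge, \<open>y\<close>
      is past the left end of its own, or an edge lies in between; otherwise \<open>x\<close> and
      \<open>y\<close> would be the same vertex parameter.\<close>
    consider "x < z (k + 1)" | "z l < y" | "k + 1 < l" using 3 k l assms
      by (metis Suc_eq_plus1 Suc_lessI antisym_conv2 not_less)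
    then show ?thesis
    proof cases
      case 1
      then have "Re (\<phi> (of_real x)) < t k"
        using Re_phi_edge_mono[OF k(1,2), of "z (k + 1)"] Re_phi_vertex[of "k + 1"] k(1) by auto
      then show ?thesis using a b by linarith
    next
      case 2
      then have "t (l - 1) < Re (\<phi> (of_real y))"
        using Re_phi_edge_mono[OF l(1) order_refl, of y] Re_phi_vertex[of l] l by auto
      then show ?thesis using a b by linarith
    next
      case 3
      then have "t k < t (l - 1)" using l(1) by (intro t_mono) auto
      then show ?thesis using a by linarith
    qed
  qed
qed

lemma phi_graph:
  assumes "0 \<le> x" "x \<le> 1"
  shows "Im (\<phi> (of_real x)) = \<gamma> (Re (\<phi> (of_real x)))" "0 \<le> Re (\<phi> (of_real x))" "Re (\<phi> (of_real x)) \<le> 1"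
proof -
  obtain k where k: "k \<in> {1..n}" "z k \<le> x" "x \<le> z (k + 1)" using z_cover[OF assms] by auto
  show "Im (\<phi> (of_real x)) = \<gamma> (Re (\<phi> (of_real x)))" using phi_edge_graph[OF k] by blast
  show "0 \<le> Re (\<phi> (of_real x))" using Re_phi_mono[of 0 x] assms phi_ends by (cases "x = 0") auto
  show "Re (\<phi> (of_real x)) \<le> 1" using Re_phi_mono[of x 1] assms phi_ends by (cases "x = 1") auto
qed

lemma phi_neg: "x < 0 \<Longrightarrow> Re (\<phi> (of_real x)) = 0 \<and> Im (\<phi> (of_real x)) < 0"
  using phi_left[of x 0] phi_ends by (auto simp: complex_eq_iff)

lemma phi_gt1: "1 < x \<Longrightarrow> Re (\<phi> (of_real x)) = 1 \<and> Im (\<phi> (of_real x)) < 0"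
  using phi_right[of 1 x] phi_ends by auto

lemma phi_real_inj:
  assumes "x < y" shows "\<phi> (of_real x) \<noteq> \<phi> (of_real y)"
proof -
  consider "y \<le> 0" | "x < 0" "0 < y" "y \<le> 1" | "x < 0" "1 < y" | "0 \<le> x" "y \<le> 1" | "0 \<le> x" "x < 1" "1 < y" | "1 \<le> x"
    using assms by linarith
  then show ?thesis
  proof cases
    case 1 then show ?thesis using phi_left[OF assms] by auto
  next
    case 2 then show ?thesis using phi_neg[of x] Re_phi_mono[of 0 y] phi_ends by force
  next
    case 3 then show ?thesis using phi_neg[of x] phi_gt1[of y] by force
  next
    case 4 then show ?thesis using Re_phi_mono[of x y] assms by force
  next
    case 5 then show ?thesis using Re_phi_mono[of x 1] phi_gt1[of y] phi_ends by force
  next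
    case 6 then show ?thesis using phi_right[of x y] assms by auto
  qed
qed

section \<open>Homeomorphism of the closed half plane onto the closed domain\<close>

definition body :: "complex set" where
  "body = {w. 0 \<le> Re w \<and> Re w \<le> 1 \<and> Im w \<le> \<gamma> (Re w)}"

lemma phi_real_body: "\<phi> (of_real x) \<in> body" "\<phi> (of_real x) \<notin> strip_below \<gamma>"
proof -
  consider "x < 0" | "0 \<le> x" "x \<le> 1" | "1 < x" by linarith
  then have "\<phi> (of_real x) \<in> body \<and> \<phi> (of_real x) \<notin> strip_below \<gamma>"
  proof cases
    case 1 then show ?thesis using phi_neg[of x] gamma_ends by (auto simp: body_def strip_below_def)
  next
    case 2 then show ?thesis using phi_graph[of x] by (auto simp: body_def strip_below_def)
  next
    case 3 then show ?thesis using phi_gt1[of x] gamma_ends by (auto simp: body_def strip_below_def)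
  qed
  then show "\<phi> (of_real x) \<in> body" "\<phi> (of_real x) \<notin> strip_below \<gamma>" by auto
qed

lemma strip_below_body: "strip_below \<gamma> \<subseteq> body" by (auto simp: strip_below_def body_def)

lemma Im0_cases: "Im s \<le> 0 \<Longrightarrow> s \<in> lower_half_plane \<or> (\<exists>x. s = of_real x)"
  by (auto simp: lower_half_plane_def complex_eq_iff not_less intro!: exI[of _ "Re s"])

lemma phi_lhp: "s \<in> lower_half_plane \<Longrightarrow> \<phi> s \<in> strip_below \<gamma>"
  using phi_bij by (auto simp: bij_betw_def)

text \<open>Inside this is the given bijection and on the real line it is
  \<open>phi_real_inj\<close>; an inner and a boundary value cannot coincide because boundary values
  miss the open domain.\<close>

lemma phi_inj: "inj_on \<phi> {s. Im s \<le> 0}"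
proof (rule inj_onI)
  fix s s' assume s: "s \<in> {s. Im s \<le> 0}" "s' \<in> {s. Im s \<le> 0}" and eq: "\<phi> s = \<phi> s'"
  have "s \<in> lower_half_plane \<or> (\<exists>x. s = of_real x)" "s' \<in> lower_half_plane \<or> (\<exists>x. s' = of_real x)"
    using s Im0_cases by auto
  then consider "s \<in> lower_half_plane" "s' \<in> lower_half_plane"
    | x where "s = of_real x" "s' \<in> lower_half_plane" | x where "s \<in> lower_half_plane" "s' = of_real x"
    | x y where "s = of_real x" "s' = of_real y" by blast
  then show "s = s'"
  proof cases
    case 1 then show ?thesis using eq phi_bij by (auto simp: bij_betw_def inj_on_def)
  next
    case 2 then show ?thesis using eq phi_lhp[of s'] phi_real_body(2) by metis
  next
    case 3 then show ?thesis using eq phi_lhp[of s] phi_real_body(2) by metis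
  next
    case 4 then show ?thesis using eq phi_real_inj[of x y] phi_real_inj[of y x] by (cases x y rule: linorder_cases) auto
  qed
qed

lemma phi_real_cont: "continuous_on A (\<lambda>x. \<phi> (of_real x))"
  by (rule continuous_on_compose2[OF phi_cont]) (auto intro: continuous_intros)

text \<open>Properness, in the form used to get far down the vertical sides and to bound
  preimages.\<close>

lemma phi_large:
  obtains b where "\<And>s. Im s \<le> 0 \<Longrightarrow> b \<le> norm s \<Longrightarrow> K < norm (\<phi> s)"
proof -
  have "eventually (\<lambda>s. K < norm (\<phi> s)) (inf at_infinity (principal {s. Im s \<le> 0}))"
    using filterlim_norm_at_top[THEN filterlim_compose, OF phi_infinity]
    by (auto simp: filterlim_at_top_dense)
  then have "eventually (\<lambda>s. Im s \<le> 0 \<longrightarrow> K < norm (\<phi> s)) at_infinity"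
    by (simp add: eventually_inf_principal)
  then show ?thesis using that by (auto simp: eventually_at_infinity)
qed

lemma phi_edge_image:
  assumes k: "k \<in> {1..n}" and a: "t (k - 1) \<le> a" "a \<le> t k"
  shows "\<exists>x. z k \<le> x \<and> x \<le> z (k + 1) \<and> \<phi> (of_real x) = Complex a (\<gamma> a)"
proof -
  have "\<exists>x\<ge>z k. x \<le> z (k + 1) \<and> Re (\<phi> (of_real x)) = a"
    by (rule IVT')
       (use k a z_mono'[of k "k + 1"] in \<open>auto simp: phi_vertex intro!: continuous_intros phi_real_cont\<close>)
  then obtain x where x: "z k \<le> x" "x \<le> z (k + 1)" "Re (\<phi> (of_real x)) = a" by blast
  then show ?thesis using phi_edge_graph(3)[OF k x(1,2)] by (auto simp: complex_eq_iff)
qed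

text \<open>Points of the curve are reached edge by edge; points of the vertical sides by the
  intermediate value theorem, between an end of the curve and a boundary point whose image is far
  below.\<close>

lemma phi_image: "\<phi> ` {s. Im s \<le> 0} = body"
proof (intro set_eqI iffI)
  fix v assume "v \<in> \<phi> ` {s. Im s \<le> 0}"
  then show "v \<in> body" using Im0_cases phi_lhp strip_below_body phi_real_body(1) by blast
next
  fix v assume v: "v \<in> body"
  consider "v \<in> strip_below \<gamma>" | "Im v = \<gamma> (Re v)" | "Re v = 0" | "Re v = 1"
    using v by (auto simp: body_def strip_below_def) linarith+
  then show "v \<in> \<phi> ` {s. Im s \<le> 0}"
  proof cases
    case 1
    then have "v \<in> \<phi> ` lower_half_plane" using phi_bij by (auto simp: bij_betw_def)
    then show ?thesis by (auto simp: lower_half_plane_def)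
  next
    case 2
    obtain k where k: "k \<in> {1..n}" "t (k - 1) \<le> Re v" "Re v \<le> t k"
      using partition_cover[OF n, of t "Re v"] v t by (auto simp: body_def)
    obtain x where "\<phi> (of_real x) = Complex (Re v) (\<gamma> (Re v))" using phi_edge_image[OF k] by blast
    then have "\<phi> (of_real x) = v" using 2 by (simp add: complex_eq_iff)
    then show ?thesis by force
  next
    case 3
    then have I: "Im v \<le> 0" using v gamma_ends by (auto simp: body_def)
    obtain b where b: "\<And>s. Im s \<le> 0 \<Longrightarrow> b \<le> norm s \<Longrightarrow> norm v < norm (\<phi> s)"
      using phi_large[of "norm v"] by blast
    \<comment> \<open>Far enough to the left that the image, which is on the same vertical line as
      \<open>v\<close> and has larger modulus, lies below \<open>v\<close>.\<close>
    define x where "x = - \<bar>b\<bar> - 1"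
    have x: "x < 0" by (simp add: x_def)
    have "b \<le> norm (of_real x :: complex)" unfolding norm_of_real x_def by linarith
    then have "norm v < norm (\<phi> (of_real x))" by (intro b) auto
    then have "\<bar>Im v\<bar> < \<bar>Im (\<phi> (of_real x))\<bar>" using phi_neg[OF x] 3 by (simp add: cmod_def)
    then have "Im (\<phi> (of_real x)) \<le> Im v" using phi_neg[OF x] I by linarith
    then have "\<exists>y\<ge>x. y \<le> 0 \<and> Im (\<phi> (of_real y)) = Im v"
      by (intro IVT') (use x I phi_ends in \<open>auto intro!: continuous_intros phi_real_cont\<close>)
    then obtain y where y: "y \<le> 0" "Im (\<phi> (of_real y)) = Im v" by blast
    then have "\<phi> (of_real y) = v" using phi_neg[of y] phi_ends 3 by (cases "y = 0") (auto simp: complex_eq_iff)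
    then show ?thesis by force
  next
    case 4
    then have I: "Im v \<le> 0" using v gamma_ends by (auto simp: body_def)
    obtain b where b: "\<And>s. Im s \<le> 0 \<Longrightarrow> b \<le> norm s \<Longrightarrow> norm v < norm (\<phi> s)"
      using phi_large[of "norm v"] by blast
    define x where "x = \<bar>b\<bar> + 2"
    have x: "1 < x" by (simp add: x_def)
    have "b \<le> norm (of_real x :: complex)" unfolding norm_of_real x_def by linarith
    then have "norm v < norm (\<phi> (of_real x))" by (intro b) auto
    then have "(norm v)\<^sup>2 < (norm (\<phi> (of_real x)))\<^sup>2" by (intro power_strict_mono) auto
    then have "(Im v)\<^sup>2 < (Im (\<phi> (of_real x)))\<^sup>2" using phi_gt1[OF x] 4 by (simp add: cmod_power2)
    then have "\<bar>Im v\<bar> < \<bar>Im (\<phi> (of_real x))\<bar>" 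
      using abs_le_square_iff[of "Im (\<phi> (of_real x))" "Im v"] by linarith
    then have "Im (\<phi> (of_real x)) \<le> Im v" using phi_gt1[OF x] I by linarith
    then have "\<exists>y\<ge>1. y \<le> x \<and> Im (\<phi> (of_real y)) = Im v"
      by (intro IVT2') (use x I phi_ends in \<open>auto intro!: continuous_intros phi_real_cont\<close>)
    then obtain y where y: "1 \<le> y" "Im (\<phi> (of_real y)) = Im v" by blast
    then have "\<phi> (of_real y) = v" using phi_gt1[of y] phi_ends 4 by (cases "y = 1") (auto simp: complex_eq_iff)
    then show ?thesis by force
  qed
qed

definition phi_inv :: "complex \<Rightarrow> complex" where "phi_inv = inv_into {s. Im s \<le> 0} \<phi>"

lemma phi_inv_phi: "Im s \<le> 0 \<Longrightarrow> phi_inv (\<phi> s) = s"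
  unfolding phi_inv_def by (rule inv_into_f_f[OF phi_inj]) simp

lemma phi_phi_inv: "v \<in> body \<Longrightarrow> \<phi> (phi_inv v) = v" "v \<in> body \<Longrightarrow> Im (phi_inv v) \<le> 0"
  using f_inv_into_f[of v \<phi> "{s. Im s \<le> 0}"] inv_into_into[of v \<phi> "{s. Im s \<le> 0}"] phi_image
  by (auto simp: phi_inv_def)

text \<open>By properness the preimages of a neighbourhood of \<open>v\<close> stay in a compact
  half disc, and on a compact set the inverse of a continuous injection is continuous.\<close>

lemma continuous_phi_inv: "continuous_on body phi_inv"
  unfolding continuous_on_eq_continuous_within
proof
  fix v assume v: "v \<in> body"
  obtain b where b: "\<And>s. Im s \<le> 0 \<Longrightarrow> b \<le> norm s \<Longrightarrow> norm v + 1 < norm (\<phi> s)"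
    using phi_large[of "norm v + 1"] by blast
  define S where "S = {s. Im s \<le> 0} \<inter> cball 0 b"
  have "compact S" unfolding S_def by (intro closed_Int_compact closed_halfspace_Im_le compact_cball)
  moreover have "continuous_on S \<phi>" by (rule continuous_on_subset[OF phi_cont]) (auto simp: S_def)
  ultimately have c: "continuous_on (\<phi> ` S) phi_inv"
    by (intro continuous_on_inv) (auto simp: S_def phi_inv_phi)
  have sub: "body \<inter> ball v 1 \<subseteq> \<phi> ` S"
  proof
    fix u assume u: "u \<in> body \<inter> ball v 1"
    then have "norm u < norm v + 1" using norm_triangle_ineq2[of u v] by (auto simp: dist_norm norm_minus_commute[of v u])
    moreover have "\<phi> (phi_inv u) = u" "Im (phi_inv u) \<le> 0" using phi_phi_inv u by auto
    ultimately have "\<not> b \<le> norm (phi_inv u)" using b[of "phi_inv u"] by (metis not_less_iff_gr_or_eq)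
    then have "phi_inv u \<in> S" using phi_phi_inv[of u] u by (auto simp: S_def)
    then show "u \<in> \<phi> ` S" using phi_phi_inv[of u] u by (metis IntD1 image_eqI)
  qed
  have "continuous (at v within body \<inter> ball v 1) phi_inv"
    using continuous_on_subset[OF c sub] v by (simp add: continuous_on_eq_continuous_within)
  moreover have "at v within body = at v within body \<inter> ball v 1"
    by (rule at_within_nhd[of v "ball v 1"]) auto
  ultimately show "continuous (at v within body) phi_inv" by simp
qed

lemma holomorphic_phi_inv: "phi_inv holomorphic_on strip_below \<gamma>"
proof -
  have inj: "inj_on \<phi> lower_half_plane" and img: "\<phi> ` lower_half_plane = strip_below \<gamma>"
    using phi_bij by (simp_all add: bij_betw_def)
  obtain g where g: "g holomorphic_on \<phi> ` lower_half_plane" "\<And>s. s \<in> lower_half_plane \<Longrightarrow> g (\<phi> s) = s"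
    by (rule holomorphic_has_inverse[OF phi_holo open_lower_half_plane inj]) (rule that)
  have gh: "g holomorphic_on strip_below \<gamma>" using g(1) unfolding img .
  have "g v = phi_inv v" if "v \<in> strip_below \<gamma>" for v
  proof -
    have "v \<in> \<phi> ` lower_half_plane" unfolding img by (rule that)
    then obtain s where s: "v = \<phi> s" "s \<in> lower_half_plane" by (rule imageE)
    have "phi_inv (\<phi> s) = s" using s(2) by (intro phi_inv_phi) (simp add: lower_half_plane_def)
    then show ?thesis unfolding s(1) g(2)[OF s(2)] by (rule sym)
  qed
  from holomorphic_transform[OF gh this] show ?thesis .
qed

lemma phi_inv_strip: "v \<in> strip_below \<gamma> \<Longrightarrow> Im (phi_inv v) < 0"
proof -
  assume "v \<in> strip_below \<gamma>"
  then have "v \<in> \<phi> ` lower_half_plane" using phi_bij by (simp add: bij_betw_def)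
  then obtain s where "v = \<phi> s" "s \<in> lower_half_plane" by (rule imageE)
  then show ?thesis using phi_inv_phi[of s] by (simp add: lower_half_plane_def)
qed

text \<open>The map to the lower half of the unit disc: the curve goes to the semicircle, the sides
  to the real diameter and infinity to 0. It is the function
  \<open>exp (- \<i> * \<pi> * \<psi>\<^sup>-\<^sup>1)\<close> of the overview.\<close>

definition disc_map :: "complex \<Rightarrow> complex" where "disc_map v = joukowski_inv (phi_inv v)"

lemma continuous_disc_map: "continuous_on body disc_map"
  unfolding disc_map_def
  by (rule continuous_on_compose2[OF continuous_joukowski_inv continuous_phi_inv])
     (use phi_phi_inv in auto)

lemma holomorphic_disc_map: "disc_map holomorphic_on strip_below \<gamma>"
proof -
  have "phi_inv ` strip_below \<gamma> \<subseteq> {s. Im s < 0}"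
    using phi_inv_strip by auto
  from holomorphic_on_compose_gen[OF holomorphic_phi_inv holomorphic_joukowski_inv this]
  show ?thesis by (simp add: disc_map_def[abs_def] o_def)
qed

lemma norm_disc_map: "v \<in> body \<Longrightarrow> norm (disc_map v) \<le> 1"
  unfolding disc_map_def by (intro norm_joukowski_inv_le_1 phi_phi_inv)

text \<open>The preimage is a real \<open>x\<close>. As the real part of \<open>\<phi>\<close> is
  strictly increasing on the unit interval, \<open>0 < x < 1\<close> would put \<open>v\<close>
  strictly between the sides; for all other \<open>x\<close> the value of
  \<open>joukowski_inv\<close> is real.\<close>

lemma disc_map_sides:
  assumes v: "v \<in> body" and "Re v = 0 \<or> Re v = 1" shows "Im (disc_map v) = 0"
proof -
  have "phi_inv v \<notin> lower_half_plane"
  proof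
    assume "phi_inv v \<in> lower_half_plane"
    then have "v \<in> strip_below \<gamma>" using phi_lhp phi_phi_inv(1)[OF v] by metis
    then show False using assms by (auto simp: strip_below_def)
  qed
  then obtain x where x: "phi_inv v = of_real x" using Im0_cases phi_phi_inv(2)[OF v] by blast
  then have vx: "\<phi> (of_real x) = v" using phi_phi_inv(1)[OF v] by simp
  have "x \<le> 0 \<or> 1 \<le> x"
  proof (rule ccontr)
    assume "\<not> (x \<le> 0 \<or> 1 \<le> x)"
    then have "0 < Re v" "Re v < 1" using Re_phi_mono[of 0 x] Re_phi_mono[of x 1] phi_ends vx by auto
    then show False using assms by auto
  qed
  then show ?thesis unfolding disc_map_def x by (rule joukowski_inv_real)
qed

lemma disc_map_curve:
  "0 \<le> x \<Longrightarrow> x \<le> 1 \<Longrightarrow> disc_map (\<phi> (of_real ((1 - cos (pi * x)) / 2))) = cis (- (pi * x))"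
  unfolding disc_map_def by (subst phi_inv_phi) (auto intro: joukowski_inv_unit_interval simp del: of_real_divide of_real_diff)

text \<open>Since \<open>\<phi>\<close> is bounded on a half disc, far points have preimages of
  modulus larger than \<open>1 / e\<close>, and \<open>norm_joukowski_inv_le\<close> makes the value
  smaller than \<open>e\<close> there.\<close>

lemma disc_map_infinity: "(disc_map \<longlongrightarrow> 0) (inf at_infinity (principal (strip_below \<gamma>)))"
proof (rule tendstoI)
  fix e :: real assume e: "0 < e"
  define S where "S = {s. Im s \<le> 0} \<inter> cball 0 (1 / e)"
  have "compact S" unfolding S_def by (intro closed_Int_compact closed_halfspace_Im_le compact_cball)
  then have "bounded (\<phi> ` S)"
    by (intro compact_imp_bounded compact_continuous_image continuous_on_subset[OF phi_cont]) (auto simp: S_def)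
  then obtain b where b: "\<And>s. s \<in> S \<Longrightarrow> norm (\<phi> s) \<le> b" by (auto simp: bounded_iff)
  have "dist (disc_map v) 0 < e" if v: "v \<in> strip_below \<gamma>" "b + 1 \<le> norm v" for v
  proof -
    have vb: "v \<in> body" using v strip_below_body by auto
    let ?s = "phi_inv v"
    have "?s \<notin> S" using b[of ?s] phi_phi_inv(1)[OF vb] v by auto
    then have s: "1 / e < norm ?s" using phi_phi_inv(2)[OF vb] by (auto simp: S_def)
    have "norm (disc_map v) * norm ?s \<le> norm (disc_map v) * (norm ?s + norm (?s - 1))"
      by (intro mult_left_mono) auto
    also have "\<dots> \<le> 1" unfolding disc_map_def by (rule norm_joukowski_inv_le[OF phi_phi_inv(2)[OF vb]])
    finally have 1: "norm (disc_map v) * norm ?s \<le> 1" .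
    have s0: "0 < norm ?s" using s e by (meson less_trans zero_less_divide_1_iff)
    have "1 < norm ?s * e" using s e by (simp add: pos_divide_less_eq)
    then have "norm (disc_map v) * norm ?s < e * norm ?s" using 1 by (simp add: mult.commute)
    then have "norm (disc_map v) < e" using s0 by (simp add: mult_less_cancel_right)
    then show ?thesis by simp
  qed
  then show "eventually (\<lambda>v. dist (disc_map v) 0 < e) (inf at_infinity (principal (strip_below \<gamma>)))"
    unfolding eventually_inf_principal eventually_at_infinity by blast
qed

end

section \<open>Schwarz reflection\<close>

lemma fold_unit_Ints: "fold_unit (of_int j) = (if even j then 0 else 1)"
proof (cases "even j")
  case True
  then obtain i where "j = 2 * i" by (elim evenE)
  then show ?thesis using fold_unit_right[of i "of_int j"] by simp
next
  case False
  then obtain i where "j = 2 * i + 1" by (elim oddE)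
  then show ?thesis using fold_unit_right[of i "of_int j"] by simp
qed

context schwarz_christoffel
begin

lemma reflect_body: "Im w \<le> lift (Re w) \<Longrightarrow> reflect_strip w \<in> body"
  using fold_unit_bounds[of "Re w"] by (simp add: reflect_strip_eq body_def lift_def)

text \<open>The extension of \<open>disc_map\<close> by Schwarz reflection in the lines \<open>Re w \<in> \<int>\<close>.\<close>

definition disc_ext :: "complex \<Rightarrow> complex" where
  "disc_ext w = (if even \<lfloor>Re w\<rfloor> then disc_map (reflect_strip w) else cnj (disc_map (reflect_strip w)))"

lemma open_below: "open (- above)"
  using closed_above by (rule open_Compl)

text \<open>Over a cell with even index folding is a translation. Over an odd one it is the
  antiholomorphic map \<open>of_real c - cnj w\<close>, for which the outer conjugation in
  \<open>disc_ext\<close> compensates.\<close>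

lemma disc_ext_cell:
  "disc_ext holomorphic_on (- above \<inter> {w. of_int m < Re w \<and> Re w < of_int m + 1})" (is "_ holomorphic_on ?C")
proof -
  have oC: "open ?C"
    using open_below by (intro open_Int open_Collect_conj open_halfspace_Re_lt open_halfspace_Re_gt) auto
  have fl: "\<lfloor>Re w\<rfloor> = m" if "w \<in> ?C" for w using that by (simp add: floor_eq_iff)
  show ?thesis
  proof (cases "even m")
    case True
    then obtain i where m: "m = 2 * i" by (elim evenE)
    have R: "reflect_strip w = w - of_real (2 * of_int i) \<and> w - of_real (2 * of_int i) \<in> strip_below \<gamma>" if "w \<in> ?C" for w
    proof -
      have "fold_unit (Re w) = Re w - 2 * of_int i"
        using that m by (intro fold_unit_right) auto
      then show ?thesis using that m
        by (simp add: reflect_strip_eq complex_eq_iff strip_below_def above_def lift_def)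
    qed
    have "(\<lambda>w. disc_map (w - of_real (2 * of_int i))) holomorphic_on ?C"
      by (rule holomorphic_on_compose_gen[OF _ holomorphic_disc_map, unfolded o_def])
         (use R in \<open>auto intro!: holomorphic_intros\<close>)
    then show ?thesis
      by (rule holomorphic_transform) (use R fl True in \<open>simp add: disc_ext_def\<close>)
  next
    case False
    then obtain i where "m = 2 * i + 1" by (elim oddE)
    then have m: "m = 2 * (i + 1) - 1" by simp
    define c :: real where "c = 2 * of_int (i + 1)"
    have R: "reflect_strip w = of_real c - cnj w \<and> of_real c - cnj w \<in> strip_below \<gamma>" if "w \<in> ?C" for w
    proof -
      have "fold_unit (Re w) = c - Re w"
        unfolding c_def using that m by (intro fold_unit_left) auto
      then show ?thesis using that m
        by (simp add: reflect_strip_eq complex_eq_iff strip_below_def above_def lift_def c_def)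
    qed
    have "(\<lambda>w. disc_map (of_real c - w)) holomorphic_on cnj ` ?C"
      by (rule holomorphic_on_compose_gen[OF _ holomorphic_disc_map, unfolded o_def])
         (use R in \<open>auto intro!: holomorphic_intros\<close>)
    then have "cnj \<circ> (\<lambda>w. disc_map (of_real c - w)) \<circ> cnj holomorphic_on ?C"
      by (rule holomorphic_on_compose_cnj_cnj[OF _ oC])
    then show ?thesis
      by (rule holomorphic_transform) (use R fl False in \<open>simp add: disc_ext_def\<close>)
  qed
qed

lemma continuous_disc_reflect: "continuous_on {w. Im w \<le> lift (Re w)} (\<lambda>w. disc_map (reflect_strip w))"
  by (rule continuous_on_compose2[OF continuous_disc_map continuous_reflect_strip])
     (use reflect_body in auto)

text \<open>On a line \<open>Re w = of_int j\<close> the folded point is on a vertical side, where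
  \<open>disc_map\<close> is real. The formulas of the two adjacent cells therefore agree there, and
  continuity across the line is enough for holomorphy.\<close>

lemma holomorphic_disc_ext: "disc_ext holomorphic_on - above"
proof -
  define V where "V j = - above \<inter> {w. of_int j - 1 < Re w \<and> Re w < of_int j + 1}" for j
  have oV: "open (V j)" for j
    unfolding V_def using open_below
    by (intro open_Int open_Collect_conj open_halfspace_Re_lt open_halfspace_Re_gt) auto
  have sub: "V j \<subseteq> {w. Im w \<le> lift (Re w)}" for j by (auto simp: V_def above_def)
  have real_line: "Im (disc_map (reflect_strip w)) = 0" if w: "w \<in> V j" "Re w = of_int j" for w j
  proof (rule disc_map_sides)
    show "reflect_strip w \<in> body" using w(1) sub[of j] by (intro reflect_body) auto
  qed (simp add: reflect_strip_eq w(2) fold_unit_Ints)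
  have "disc_ext holomorphic_on V j" for j
  proof (rule holomorphic_on_paste_across_line[OF oV, of 1 _ _ "of_int j"])
    show "disc_ext holomorphic_on (V j \<inter> {w. 1 \<bullet> w < real_of_int j})"
      by (rule holomorphic_on_subset[OF disc_ext_cell[of "j - 1"]]) (auto simp: V_def)
    show "disc_ext holomorphic_on (V j \<inter> {w. real_of_int j < 1 \<bullet> w})"
      by (rule holomorphic_on_subset[OF disc_ext_cell[of j]]) (auto simp: V_def)
    \<comment> \<open>Both formulas, conjugated and not, are continuous on all of
      \<open>V j\<close>. The cell to the left has index \<open>j - 1\<close>, so its formula is
      selected by \<open>odd j\<close>.\<close>
    define A where "A e w = (if e then disc_map (reflect_strip w) else cnj (disc_map (reflect_strip w)))" for e :: bool and w
    have cA: "continuous_on S (A e)" if "S \<subseteq> V j" for S e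
      using continuous_on_subset[OF continuous_disc_reflect, of S] that sub[of j]
      by (cases e) (auto simp: A_def[abs_def] intro!: continuous_on_cnj)
    have "continuous_on (V j) (\<lambda>w. if Re w \<le> of_int j then A (odd j) w else A (even j) w)"
    proof (rule continuous_on_cases_le)
      fix w assume w: "w \<in> V j" "Re w = of_int j"
      then show "A (odd j) w = A (even j) w" using real_line by (simp add: A_def complex_eq_iff)
    qed (auto intro!: cA continuous_intros)
    then show "continuous_on (V j) disc_ext"
    proof (rule continuous_on_eq)
      fix w assume w: "w \<in> V j"
      show "(if Re w \<le> of_int j then A (odd j) w else A (even j) w) = disc_ext w"
      proof (cases "Re w < of_int j")
        case True
        then have "\<lfloor>Re w\<rfloor> = j - 1" using w by (simp add: V_def floor_eq_iff)
        then show ?thesis using True by (simp add: A_def disc_ext_def)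
      next
        case False
        then have f: "\<lfloor>Re w\<rfloor> = j" using w by (simp add: V_def floor_eq_iff)
        show ?thesis
        proof (cases "Re w = of_int j")
          case True
          then show ?thesis using f real_line[OF w] by (auto simp: A_def disc_ext_def complex_eq_iff)
        qed (use False f in \<open>simp add: A_def disc_ext_def\<close>)
      qed
    qed
  qed auto
  then have "disc_ext holomorphic_on (\<Union>j. V j)" using oV by (intro holomorphic_on_UN_open) auto
  moreover have "- above \<subseteq> (\<Union>j. V j)"
  proof
    fix w assume "w \<in> - above"
    then have "w \<in> V \<lfloor>Re w\<rfloor>" unfolding V_def by (simp, linarith)
    then show "w \<in> (\<Union>j. V j)" by blast
  qed
  ultimately show ?thesis using holomorphic_on_subset by blast
qed

lemma curve_graph_body: "curve_graph \<gamma> \<subseteq> body"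
  by (auto simp: curve_graph_def body_def)

lemma continuous_disc_map_curve: "continuous_on (curve_graph \<gamma>) disc_map"
  using continuous_disc_map curve_graph_body by (rule continuous_on_subset)

lemma strip_below_lift: "v \<in> strip_below \<gamma> \<Longrightarrow> Im v < lift (Re v) \<and> reflect_strip v = v"
  by (simp add: strip_below_def lift_def fold_unit_id reflect_strip_eq)

text \<open>The real part of a power does not see the conjugation over odd cells, so the holomorphic
  function \<open>disc_ext w ^ m\<close> has the same real part as the folded
  \<open>disc_map\<close>.\<close>

lemma hitting_measure_disc_map:
  assumes BM: "planar_brownian_motion M B z0" and z0: "z0 \<in> strip_below \<gamma>"
  shows "integral\<^sup>L (hitting_measure M B (curve_graph \<gamma>)) (\<lambda>v. Re (disc_map v ^ m)) = Re (disc_map z0 ^ m)"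
proof -
  \<comment> \<open>Points above the lifted graph are moved vertically down to it, which extends the
    test function continuously and boundedly to the whole plane.\<close>
  define p where "p w = Complex (Re w) (min (Im w) (lift (Re w)))" for w
  have p_id: "p w = w" if "Im w \<le> lift (Re w)" for w using that by (simp add: p_def complex_eq_iff)
  define h where "h w = Re (disc_map (reflect_strip (p w)) ^ m)" for w
  have "continuous_on UNIV p" unfolding p_def by (intro continuous_intros continuous_lift_Re)
  then have "continuous_on UNIV (\<lambda>w. disc_map (reflect_strip (p w)))"
    by (rule continuous_on_compose2[OF continuous_disc_reflect]) (auto simp: p_def)
  then have hc: "continuous_on UNIV h" unfolding h_def by (intro continuous_intros)
  have hb: "\<bar>h w\<bar> \<le> 1" for w
  proof -
    have "reflect_strip (p w) \<in> body" by (rule reflect_body) (simp add: p_def)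
    then have "norm (disc_map (reflect_strip (p w)) ^ m) \<le> 1"
      by (simp add: norm_power power_le_one norm_disc_map)
    then show ?thesis unfolding h_def using abs_Re_le_cmod order_trans by blast
  qed
  have "integral\<^sup>L (hitting_measure M B (curve_graph \<gamma>)) (\<lambda>v. Re (disc_map v ^ m)) = h z0"
  proof (rule hitting_measure_integral[OF BM _ hc hb])
    show "Im z0 < lift (Re z0)" using strip_below_lift[OF z0] by simp
    show "(\<lambda>w. disc_ext w ^ m) holomorphic_on - above"
      by (intro holomorphic_intros holomorphic_disc_ext)
    show "h w = Re (disc_ext w ^ m)" if "w \<notin> above" for w
    proof -
      have "p w = w" using that by (intro p_id) (simp add: above_def)
      moreover have "Re (cnj x ^ m) = Re (x ^ m)" for x
        by (metis complex_cnj_power complex_cnj(1) complex.sel(1) complex.collapse)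
      ultimately show ?thesis by (simp add: h_def disc_ext_def)
    qed
    show "continuous_on (curve_graph \<gamma>) (\<lambda>v. Re (disc_map v ^ m))"
      by (intro continuous_intros continuous_disc_map_curve)
    show "h w = Re (disc_map (reflect_strip w) ^ m)" if "Im w = lift (Re w)" for w
      using p_id[of w] that by (simp add: h_def)
  qed
  also have "h z0 = Re (disc_map z0 ^ m)"
    using p_id[of z0] strip_below_lift[OF z0] by (simp add: h_def)
  finally show ?thesis .
qed

end

section \<open>Uniqueness of weak limits\<close>

text \<open>Closed sets are stable under intersection and generate the Borel sets, and the indicator
  of a nonempty closed set is the limit of the bounded continuous functions
  \<open>f j\<close>.\<close>

lemma finite_borel_measure_eqI:
  fixes N1 N2 :: "'a :: metric_space measure"
  assumes fin: "finite_measure N1" "finite_measure N2"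
    and sets: "sets N1 = sets borel" "sets N2 = sets borel"
    and eq: "\<And>f :: 'a \<Rightarrow> real. continuous_on UNIV f \<Longrightarrow> bounded (range f) \<Longrightarrow> integral\<^sup>L N1 f = integral\<^sup>L N2 f"
  shows "N1 = N2"
proof (rule measure_eqI_generator_eq[where E="Collect closed" and \<Omega>=UNIV and A="\<lambda>_. UNIV"])
  interpret N1: finite_measure N1 by fact
  interpret N2: finite_measure N2 by fact
  show "Int_stable (Collect (closed :: 'a set \<Rightarrow> bool))" by (auto simp: Int_stable_def)
  show "sets N1 = sigma_sets UNIV (Collect closed)" "sets N2 = sigma_sets UNIV (Collect closed)"
    using sets by (simp_all add: borel_eq_closed)
  show "emeasure N1 UNIV \<noteq> \<infinity>" by simp
  fix K :: "'a set" assume "K \<in> Collect closed"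
  then have K: "closed K" by simp
  show "emeasure N1 K = emeasure N2 K"
  \<comment> \<open>The empty set is treated apart because \<open>infdist\<close> to it is 0
    everywhere.\<close>
  proof (cases "K = {}")
    case False
    define f where "f j x = max 0 (1 - real j * infdist x K)" for j x
    have fc: "continuous_on UNIV (f j)" for j unfolding f_def by (intro continuous_intros)
    have fb: "\<bar>f j x\<bar> \<le> 1" for j x using infdist_nonneg[of x K] by (simp add: f_def)
    have lim: "(\<lambda>j. integral\<^sup>L N (f j)) \<longlonglongrightarrow> measure N K"
      if N: "finite_measure N" "sets N = sets borel" for N
    proof -
      interpret N: finite_measure N by fact
      have sp: "space N = UNIV" using sets_eq_imp_space_eq[OF N(2)] by simp
      have KN: "K \<in> sets N" using K N(2) by simp
      have "(\<lambda>j. integral\<^sup>L N (f j)) \<longlonglongrightarrow> integral\<^sup>L N (indicator K)"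
      proof (rule integral_dominated_convergence[where w="\<lambda>_. 1"])
        show "indicator K \<in> borel_measurable N" using KN by simp
        show "f j \<in> borel_measurable N" for j
          using borel_measurable_continuous_onI[OF fc] by (simp add: measurable_cong_sets[OF N(2) refl])
        show "AE x in N. (\<lambda>j. f j x) \<longlonglongrightarrow> indicator K x"
        proof (rule AE_I2)
          fix x
          show "(\<lambda>j. f j x) \<longlonglongrightarrow> indicator K x"
          proof (cases "x \<in> K")
            case True then show ?thesis by (simp add: f_def)
          next
            case nK: False
            then have d: "0 < infdist x K" using K \<open>K \<noteq> {}\<close> infdist_pos_not_in_closed by blast
            obtain j0 where j0: "1 / infdist x K \<le> real j0" using real_arch_simple by blast
            have "eventually (\<lambda>j. f j x = 0) sequentially"
              using eventually_ge_at_top[of j0]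
            proof eventually_elim
              case (elim j)
              then have "1 / infdist x K \<le> real j" using j0 by linarith
              then have "1 \<le> real j * infdist x K" using d by (simp add: field_simps)
              then show ?case by (simp add: f_def)
            qed
            then show ?thesis using nK by (simp add: tendsto_eventually)
          qed
        qed
      qed (use fb in auto)
      then show ?thesis using KN sp by simp
    qed
    have "integral\<^sup>L N1 (f j) = integral\<^sup>L N2 (f j)" for j
      by (rule eq[OF fc]) (use fb in \<open>auto simp: bounded_iff intro!: exI[of _ 1]\<close>)
    then have "measure N1 K = measure N2 K"
      using LIMSEQ_unique[OF lim[OF fin(1) sets(1)]] lim[OF fin(2) sets(2)] by simp
    then show ?thesis by (simp add: N1.emeasure_eq_measure N2.emeasure_eq_measure)
  qed simp
qed auto

text \<open>Reduces to measures on the whole space by pushing both forward under the inclusion of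
  \<open>\<Gamma>\<close>.\<close>

lemma finite_measure_on_eqI:
  fixes \<Gamma> :: "'a :: metric_space set"
  assumes \<Gamma>: "\<Gamma> \<in> sets borel" and fin: "finite_measure N1" "finite_measure N2"
    and sets: "sets N1 = sets (restrict_space borel \<Gamma>)" "sets N2 = sets (restrict_space borel \<Gamma>)"
    and eq: "\<And>f :: 'a \<Rightarrow> real. continuous_on \<Gamma> f \<Longrightarrow> bounded (f ` \<Gamma>) \<Longrightarrow> integral\<^sup>L N1 f = integral\<^sup>L N2 f"
  shows "N1 = N2"
proof -
  interpret N1: finite_measure N1 by fact
  interpret N2: finite_measure N2 by fact
  have id: "(\<lambda>x. x) \<in> N \<rightarrow>\<^sub>M borel" if "sets N = sets (restrict_space borel \<Gamma>)" for N :: "'a measure"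
    using that by (subst measurable_cong_sets[OF that refl]) (intro measurable_restrict_space1, simp)
  note id1 = id[OF sets(1)] and id2 = id[OF sets(2)]
  have "distr N1 borel (\<lambda>x. x) = distr N2 borel (\<lambda>x. x)"
  proof (rule finite_borel_measure_eqI)
    show "finite_measure (distr N1 borel (\<lambda>x. x))" "finite_measure (distr N2 borel (\<lambda>x. x))"
      using id1 id2 N1.finite_measure_distr N2.finite_measure_distr by blast+
    fix f :: "'a \<Rightarrow> real" assume f: "continuous_on UNIV f" "bounded (range f)"
    have fm: "f \<in> borel_measurable borel" by (rule borel_measurable_continuous_onI[OF f(1)])
    have "bounded (f ` \<Gamma>)" using f(2) by (rule bounded_subset) auto
    then show "integral\<^sup>L (distr N1 borel (\<lambda>x. x)) f = integral\<^sup>L (distr N2 borel (\<lambda>x. x)) f"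
      using eq[of f] continuous_on_subset[OF f(1)] by (simp add: integral_distr[OF id1 fm] integral_distr[OF id2 fm])
  qed auto
  then have e: "emeasure (distr N1 borel (\<lambda>x. x)) A = emeasure (distr N2 borel (\<lambda>x. x)) A" for A by simp
  show ?thesis
  proof (rule measure_eqI)
    show "sets N1 = sets N2" using sets by simp
    fix A assume "A \<in> sets N1"
    then have A: "A \<in> sets borel" "A \<subseteq> \<Gamma>" using sets(1) \<Gamma> by (auto simp: sets_restrict_space_iff)
    have "space N1 = \<Gamma>" "space N2 = \<Gamma>"
      using sets_eq_imp_space_eq[OF sets(1)] sets_eq_imp_space_eq[OF sets(2)] by (simp_all add: space_restrict_space)
    then show "emeasure N1 A = emeasure N2 A"
      using e[of A] A by (simp add: emeasure_distr[OF id1] emeasure_distr[OF id2] Int_absorb2)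
  qed
qed

lemma weak_limit_unique:
  assumes \<Gamma>: "\<Gamma> \<in> sets borel" and F: "F \<noteq> bot" and w: "weak_limit \<Gamma> \<nu> F \<mu>1" "weak_limit \<Gamma> \<nu> F \<mu>2"
  shows "\<mu>1 = \<mu>2"
proof (rule finite_measure_on_eqI[OF \<Gamma>])
  fix f :: "complex \<Rightarrow> real" assume "continuous_on \<Gamma> f" "bounded (f ` \<Gamma>)"
  then have "((\<lambda>z. integral\<^sup>L (\<nu> z) f) \<longlongrightarrow> integral\<^sup>L \<mu>1 f) F" "((\<lambda>z. integral\<^sup>L (\<nu> z) f) \<longlongrightarrow> integral\<^sup>L \<mu>2 f) F"
    using w by (simp_all add: weak_limit_def)
  then show "integral\<^sup>L \<mu>1 f = integral\<^sup>L \<mu>2 f" by (rule tendsto_unique[OF F])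
qed (use w in \<open>auto simp: weak_limit_def\<close>)

section \<open>The limiting hitting distribution\<close>

context schwarz_christoffel
begin

text \<open>The map \<psi> of the overview on the segment from 0 to 1.\<close>

definition curve_map :: "real \<Rightarrow> complex" where
  "curve_map x = \<phi> (of_real ((1 - cos (pi * x)) / 2))"

text \<open>For uniform \<open>x\<close> the pre-image \<open>(1 - cos (pi * x)) / 2\<close> on the
  real axis has the arcsine law, the origin of the arcsine in the theorem.\<close>

definition limit_measure :: "complex measure" where
  "limit_measure = distr (restrict_space lborel {0..1}) (restrict_space borel \<Gamma>) curve_map"

lemma cos_unit: "0 \<le> (1 - cos (pi * x)) / 2" "(1 - cos (pi * x)) / 2 \<le> 1"
  using cos_le_one[of "pi * x"] cos_ge_minus_one[of "pi * x"] by simp_all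

lemma curve_map_curve: "curve_map x \<in> \<Gamma>"
  unfolding curve_map_def curve_graph_def
  using phi_graph[OF cos_unit, of x] by (auto intro!: image_eqI complex_eqI)

lemma continuous_curve_map: "continuous_on A curve_map"
  unfolding curve_map_def by (rule continuous_on_compose2[OF phi_cont]) (auto intro!: continuous_intros)

lemma phi_onto_curve:
  assumes "v \<in> \<Gamma>" obtains x where "0 \<le> x" "x \<le> 1" "v = \<phi> (of_real x)"
proof -
  obtain a where a: "0 \<le> a" "a \<le> 1" "v = Complex a (\<gamma> a)" using assms by (auto simp: curve_graph_def)
  obtain k where k: "k \<in> {1..n}" "t (k - 1) \<le> a" "a \<le> t k"
    using partition_cover[OF n, of t a] a t by auto
  obtain x where x: "z k \<le> x" "x \<le> z (k + 1)" "\<phi> (of_real x) = v" using phi_edge_image[OF k] a by blast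
  have "0 \<le> z k" "z (k + 1) \<le> 1" using z_mono'[of 1 k] z_mono'[of "k + 1" "n + 1"] z k by auto
  then show ?thesis using that[of x] x by auto
qed

lemma curve_map_onto:
  assumes "v \<in> \<Gamma>" obtains y where "0 \<le> y" "y \<le> 1" "v = curve_map y"
proof -
  obtain x where x: "0 \<le> x" "x \<le> 1" "v = \<phi> (of_real x)" using assms by (rule phi_onto_curve)
  define y where "y = arccos (1 - 2 * x) / pi"
  have "0 \<le> y" "y \<le> 1" using x by (auto simp: y_def arccos_lbound arccos_ubound)
  moreover have "(1 - cos (pi * y)) / 2 = x" using x by (simp add: y_def cos_arccos)
  then have "v = curve_map y" using x(3) by (simp only: curve_map_def)
  ultimately show ?thesis using that by blast
qed

lemma disc_map_curve_map: "0 \<le> x \<Longrightarrow> x \<le> 1 \<Longrightarrow> disc_map (curve_map x) = cis (- (pi * x))"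
  unfolding curve_map_def by (rule disc_map_curve)

lemma Gamma_borel: "\<Gamma> \<in> sets borel"
  using compact_curve_graph[OF cont] by (simp add: compact_imp_closed)

lemma sets_limit_measure: "sets limit_measure = sets (restrict_space borel \<Gamma>)"
  by (simp add: limit_measure_def)

lemma prob_space_unit: "prob_space (restrict_space lborel {0..1 :: real})"
  by (rule prob_spaceI) (simp add: emeasure_restrict_space space_restrict_space)

lemma curve_map_measurable:
  "curve_map \<in> restrict_space lborel {0..1} \<rightarrow>\<^sub>M restrict_space borel \<Gamma>"
  by (rule measurable_restrict_space2)
     (auto intro!: curve_map_curve measurable_restrict_space1 borel_measurable_continuous_onI continuous_curve_map)

lemma prob_limit_measure: "prob_space limit_measure"
  unfolding limit_measure_def by (rule prob_space.prob_space_distr[OF prob_space_unit curve_map_measurable])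

lemma integral_limit_measure:
  fixes f :: "complex \<Rightarrow> real"
  assumes "continuous_on \<Gamma> f"
  shows "integral\<^sup>L limit_measure f = (\<integral>x. f (curve_map x) \<partial>restrict_space lborel {0..1})"
  unfolding limit_measure_def
  by (rule integral_distr[OF curve_map_measurable borel_measurable_continuous_on_restrict[OF assms]])

section \<open>Cosine moments on the curve\<close>

abbreviation on_curve :: "complex measure \<Rightarrow> bool" where
  "on_curve N \<equiv> sets N = sets (restrict_space borel \<Gamma>)"

lemma space_curve: "on_curve N \<Longrightarrow> space N = \<Gamma>"
  by (drule sets_eq_imp_space_eq) (simp add: space_restrict_space)

lemma integrable_curve:
  fixes f :: "complex \<Rightarrow> real"
  assumes N: "prob_space N" "on_curve N" and f: "continuous_on \<Gamma> f"
  shows "integrable N f"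
proof -
  interpret prob_space N by fact
  have "bounded (f ` \<Gamma>)"
    by (intro compact_imp_bounded compact_continuous_image f compact_curve_graph cont)
  then obtain b where b: "\<And>v. v \<in> \<Gamma> \<Longrightarrow> \<bar>f v\<bar> \<le> b" by (auto simp: bounded_iff)
  show ?thesis
  proof (rule integrable_const_bound[where B=b])
    show "AE x in N. norm (f x) \<le> b" using b space_curve[OF N(2)] by (intro AE_I2) simp
    show "f \<in> borel_measurable N"
      using borel_measurable_continuous_on_restrict[OF f] by (simp add: measurable_cong_sets[OF N(2) refl])
  qed
qed

text \<open>On the curve this is the \<open>k\<close>-th power of a cosine times the cosine of the
  \<open>m\<close>-fold angle. The family links the cosines of multiples (\<open>k = 0\<close>),
  whose integrals are known, to the powers of the cosine (\<open>m = 0\<close>), of which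
  polynomials consist.\<close>

definition moment :: "nat \<Rightarrow> nat \<Rightarrow> complex \<Rightarrow> real" where
  "moment k m v = Re (disc_map v) ^ k * Re (disc_map v ^ m)"

lemma continuous_moment: "continuous_on \<Gamma> (moment k m)"
  unfolding moment_def by (intro continuous_intros continuous_disc_map_curve)

text \<open>The product-to-sum formula trades one factor \<open>Re (disc_map v)\<close> for a shift
  of \<open>m\<close> by one in both directions; at \<open>m = 0\<close> the factor is itself the
  cosine with multiple 1.\<close>

lemma moment_Suc:
  assumes "v \<in> \<Gamma>"
  shows "moment (Suc k) 0 v = moment k 1 v"
    and "moment (Suc k) (Suc m) v = (moment k (Suc (Suc m)) v + moment k m v) / 2"
proof -
  show "moment (Suc k) 0 v = moment k 1 v" by (simp add: moment_def)
  obtain y where y: "0 \<le> y" "y \<le> 1" "v = curve_map y" using assms by (rule curve_map_onto)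
  let ?a = "- (pi * y)"
  have c: "Re (disc_map v ^ j) = cos (real j * ?a)" for j
    unfolding y(3) disc_map_curve_map[OF y(1,2)] Complex.DeMoivre by simp
  have "real (Suc (Suc m)) * ?a = real (Suc m) * ?a + ?a" "real m * ?a = real (Suc m) * ?a - ?a"
    by (simp_all add: algebra_simps)
  moreover have "cos (a + b) + cos (a - b) = 2 * cos b * cos a" for a b :: real
    by (simp add: cos_add cos_diff)
  ultimately have cs: "cos (real (Suc (Suc m)) * ?a) + cos (real m * ?a) = 2 * cos ?a * cos (real (Suc m) * ?a)"
    by (simp only:)
  have c1: "Re (disc_map v) = cos ?a" using c[of 1] by simp
  show "moment (Suc k) (Suc m) v = (moment k (Suc (Suc m)) v + moment k m v) / 2"
    unfolding moment_def c c1 distrib_left[symmetric] cs by simp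
qed

lemma integral_cos_unit:
  "(\<integral>x. cos (real m * (pi * x)) \<partial>restrict_space lborel {0..1}) = (if m = 0 then 1 else 0)"
proof -
  have "(\<integral>x. cos (real m * (pi * x)) \<partial>restrict_space lborel {0..1}) = integral {0..1} (\<lambda>x. cos (real m * (pi * x)))"
  proof -
    have "set_integrable lborel {0..1} (\<lambda>x. cos (real m * (pi * x)))"
      by (rule borel_integrable_atLeastAtMost') (intro continuous_intros)
    from set_borel_integral_eq_integral(2)[OF this] show ?thesis
      by (simp add: integral_restrict_space set_lebesgue_integral_def)
  qed
  also have "\<dots> = (if m = 0 then 1 else 0)"
  proof (cases "m = 0")
    case False
    have "((\<lambda>x. cos (real m * (pi * x))) has_integral
        (sin (real m * (pi * 1)) / (real m * pi) - sin (real m * (pi * 0)) / (real m * pi))) {0..1}"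
      using False
      by (intro fundamental_theorem_of_calculus)
         (auto intro!: derivative_eq_intros simp flip: has_real_derivative_iff_has_vector_derivative)
    then have "((\<lambda>x. cos (real m * (pi * x))) has_integral 0) {0..1}" by (simp add: sin_npi)
    then show ?thesis using False by (simp add: integral_unique)
  qed simp
  finally show ?thesis .
qed

lemma integral_limit_moment: "integral\<^sup>L limit_measure (moment 0 m) = (if m = 0 then 1 else 0)"
proof -
  have "integral\<^sup>L limit_measure (moment 0 m) = (\<integral>x. moment 0 m (curve_map x) \<partial>restrict_space lborel {0..1})"
    by (rule integral_limit_measure[OF continuous_moment])
  also have "\<dots> = (\<integral>x. cos (real m * (pi * x)) \<partial>restrict_space lborel {0..1})"
  proof (rule Bochner_Integration.integral_cong[OF refl])
    fix x :: real assume "x \<in> space (restrict_space lborel {0..1})"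
    then have x: "0 \<le> x" "x \<le> 1" by (simp_all add: space_restrict_space)
    show "moment 0 m (curve_map x) = cos (real m * (pi * x))"
      unfolding moment_def disc_map_curve_map[OF x] Complex.DeMoivre by simp
  qed
  finally show ?thesis by (simp add: integral_cos_unit)
qed

end

section \<open>Convergence of the hitting measures\<close>

locale reflected_brownian = schwarz_christoffel n t W z \<gamma> \<phi>
  for n :: nat and t W z :: "nat \<Rightarrow> real" and \<gamma> :: "real \<Rightarrow> real" and \<phi> :: "complex \<Rightarrow> complex" +
  fixes P :: "complex \<Rightarrow> 'a measure" and B :: "real \<Rightarrow> 'a \<Rightarrow> complex"
  assumes B: "\<And>x. planar_brownian_motion (P x) B x"
begin

abbreviation "\<nu> v \<equiv> hitting_measure (P v) B \<Gamma>"

abbreviation "to_infinity \<equiv> inf at_infinity (principal (strip_below \<gamma>))"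

lemma nu_prob:
  "v \<in> strip_below \<gamma> \<Longrightarrow> prob_space (\<nu> v) \<and> on_curve (\<nu> v)"
  using hitting_measure_prob[OF B] strip_below_lift by blast

lemma eventually_strip: "eventually (\<lambda>v. v \<in> strip_below \<gamma>) to_infinity"
  by (simp add: eventually_inf_principal)

text \<open>For \<open>k = 0\<close> the integral is \<open>Re (disc_map v ^ m)\<close>, which tends
  to \<open>0 ^ m\<close>, that is, to 1 for \<open>m = 0\<close> and to 0 otherwise. The recursion
  \<open>moment_Suc\<close> can be integrated against any probability measure on the curve and
  carries the convergence to larger \<open>k\<close>.\<close>

lemma moment_limit:
  "((\<lambda>v. integral\<^sup>L (\<nu> v) (moment k m)) \<longlongrightarrow> integral\<^sup>L limit_measure (moment k m)) to_infinity"
proof (induction k arbitrary: m)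
  case 0
  have "eventually (\<lambda>v. Re (disc_map v ^ m) = integral\<^sup>L (\<nu> v) (moment 0 m)) to_infinity"
    using eventually_strip
    by eventually_elim (simp add: moment_def[abs_def] hitting_measure_disc_map[OF B])
  moreover have "((\<lambda>v. Re (disc_map v ^ m)) \<longlongrightarrow> Re (0 ^ m)) to_infinity"
    by (intro tendsto_intros disc_map_infinity)
  ultimately have "((\<lambda>v. integral\<^sup>L (\<nu> v) (moment 0 m)) \<longlongrightarrow> Re (0 ^ m)) to_infinity"
    by (rule Lim_transform_eventually[rotated])
  then show ?case by (cases m) (simp_all add: integral_limit_moment)
next
  case (Suc k)
  have I: "integrable N (moment k m)" if "prob_space N" "on_curve N" for N m
    using that continuous_moment by (rule integrable_curve)
  have rec0: "integral\<^sup>L N (moment (Suc k) 0) = integral\<^sup>L N (moment k 1)"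
    if "on_curve N" for N
    by (rule Bochner_Integration.integral_cong) (use space_curve[OF that] moment_Suc in auto)
  have rec: "integral\<^sup>L N (moment (Suc k) (Suc j)) = (integral\<^sup>L N (moment k (Suc (Suc j))) + integral\<^sup>L N (moment k j)) / 2"
    if N: "prob_space N" "on_curve N" for N j
  proof -
    have "integral\<^sup>L N (moment (Suc k) (Suc j)) = (\<integral>v. (moment k (Suc (Suc j)) v + moment k j v) / 2 \<partial>N)"
      by (rule Bochner_Integration.integral_cong) (use space_curve[OF N(2)] moment_Suc in auto)
    then show ?thesis using I[OF N] by simp
  qed
  show ?case
  proof (cases m)
    case 0
    have "eventually (\<lambda>v. integral\<^sup>L (\<nu> v) (moment k 1) = integral\<^sup>L (\<nu> v) (moment (Suc k) 0)) to_infinity"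
      using eventually_strip by eventually_elim (simp add: rec0 nu_prob)
    from Lim_transform_eventually[OF Suc.IH this] show ?thesis
      by (simp add: 0 rec0 sets_limit_measure)
  next
    case (Suc j)
    have "eventually (\<lambda>v. (integral\<^sup>L (\<nu> v) (moment k (Suc (Suc j))) + integral\<^sup>L (\<nu> v) (moment k j)) / 2
        = integral\<^sup>L (\<nu> v) (moment (Suc k) (Suc j))) to_infinity"
      using eventually_strip by eventually_elim (simp add: rec nu_prob)
    moreover have "((\<lambda>v. (integral\<^sup>L (\<nu> v) (moment k (Suc (Suc j))) + integral\<^sup>L (\<nu> v) (moment k j)) / 2)
        \<longlongrightarrow> (integral\<^sup>L limit_measure (moment k (Suc (Suc j))) + integral\<^sup>L limit_measure (moment k j)) / 2) to_infinity"
      by (intro tendsto_divide tendsto_add Suc.IH tendsto_const) simp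
    ultimately show ?thesis
      unfolding Suc rec[OF prob_limit_measure sets_limit_measure] by (rule Lim_transform_eventually[rotated])
  qed
qed

text \<open>A point of the curve is determined by the cosine \<open>c\<close> of its angle, so a
  continuous function on the curve is one of \<open>c\<close> between -1 and 1, to which the
  Weierstrass theorem applies; the power \<open>c ^ i\<close> is \<open>moment i 0\<close>.\<close>

lemma curve_function_approx:
  fixes f :: "complex \<Rightarrow> real"
  assumes f: "continuous_on \<Gamma> f" and e: "0 < e"
  obtains a :: "nat \<Rightarrow> real" and N :: nat
    where "\<And>v. v \<in> \<Gamma> \<Longrightarrow> \<bar>f v - (\<Sum>i\<le>N. a i * moment i 0 v)\<bar> < e"
proof -
  define g where "g c = f (\<phi> (of_real ((1 - c) / 2)))" for c :: real
  have cm: "\<phi> (of_real ((1 - c) / 2)) \<in> \<Gamma>" if "c \<in> {-1..1}" for c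
    using curve_map_curve[of "arccos c / pi"] that by (simp add: curve_map_def cos_arccos)
  have "continuous_on {-1..1} (\<lambda>c. \<phi> (of_real ((1 - c) / 2)))"
    by (rule continuous_on_compose2[OF phi_cont]) (auto intro!: continuous_intros)
  then have "continuous_on {-1..1} g"
    unfolding g_def by (rule continuous_on_compose2[OF f]) (use cm in auto)
  then obtain p where p: "real_polynomial_function p" "\<And>c. c \<in> {-1..1} \<Longrightarrow> \<bar>g c - p c\<bar> < e"
    using Stone_Weierstrass_real_polynomial_function[OF compact_Icc _ e] by blast
  obtain a N where a: "p = (\<lambda>c. \<Sum>i\<le>N. a i * c ^ i)"
    using p(1) unfolding real_polynomial_function_iff_sum by blast
  show ?thesis
  proof (rule that)
    fix v assume "v \<in> \<Gamma>"
    then obtain y where y: "0 \<le> y" "y \<le> 1" "v = curve_map y" by (rule curve_map_onto)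
    have c: "Re (disc_map v) = cos (pi * y)"
      unfolding y(3) disc_map_curve_map[OF y(1,2)] by simp
    have "f v = g (cos (pi * y))" by (simp only: y(3) g_def curve_map_def)
    then show "\<bar>f v - (\<Sum>i\<le>N. a i * moment i 0 v)\<bar> < e"
      using p(2)[of "cos (pi * y)"] by (simp add: a moment_def c)
  qed
qed

lemma weak_limit_nu: "weak_limit \<Gamma> \<nu> to_infinity limit_measure"
  unfolding weak_limit_def
proof (intro conjI allI impI)
  show "finite_measure limit_measure" using prob_limit_measure by (simp add: prob_space_def)
  show "sets limit_measure = sets (restrict_space borel \<Gamma>)" by (rule sets_limit_measure)
  fix f :: "complex \<Rightarrow> real" assume "continuous_on \<Gamma> f \<and> bounded (f ` \<Gamma>)"
  then have f: "continuous_on \<Gamma> f" by simp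
  show "((\<lambda>v. integral\<^sup>L (\<nu> v) f) \<longlongrightarrow> integral\<^sup>L limit_measure f) to_infinity"
  proof (rule tendstoI)
    fix e :: real assume e: "0 < e"
    then have e3: "0 < e / 3" by simp
    obtain a K where a: "\<And>v. v \<in> \<Gamma> \<Longrightarrow> \<bar>f v - (\<Sum>i\<le>K. a i * moment i 0 v)\<bar> < e / 3"
      using curve_function_approx[OF f e3] by blast
    define p where "p v = (\<Sum>i\<le>K. a i * moment i 0 v)" for v
    have fp: "\<bar>f v - p v\<bar> \<le> e / 3" if "v \<in> \<Gamma>" for v using a[OF that] by (simp add: p_def)
    have pc: "continuous_on \<Gamma> p" unfolding p_def by (intro continuous_intros continuous_moment)
    \<comment> \<open>All measures involved have mass 1, so the uniform error of the approximation
      bounds the error of the integral independently of the starting point.\<close>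
    have near: "\<bar>integral\<^sup>L N f - integral\<^sup>L N p\<bar> \<le> e / 3"
      if N: "prob_space N" "on_curve N" for N
    proof -
      interpret N: prob_space N by fact
      have i: "integrable N f" "integrable N p" using integrable_curve[OF N] f pc by auto
      have "\<bar>integral\<^sup>L N f - integral\<^sup>L N p\<bar> = \<bar>\<integral>v. f v - p v \<partial>N\<bar>" using i by simp
      also have "\<dots> \<le> (\<integral>v. \<bar>f v - p v\<bar> \<partial>N)" by (rule integral_abs_bound)
      also have "\<dots> \<le> (\<integral>v. e / 3 \<partial>N)"
        by (rule integral_mono) (use i fp in \<open>auto simp: space_curve[OF N(2)]\<close>)
      also have "\<dots> = e / 3" by (simp add: N.prob_space)
      finally show ?thesis .
    qed
    have sum: "integral\<^sup>L N p = (\<Sum>i\<le>K. a i * integral\<^sup>L N (moment i 0))"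
      if N: "prob_space N" "on_curve N" for N
      unfolding p_def using integrable_curve[OF N continuous_moment]
      by (subst Bochner_Integration.integral_sum) auto
    have "((\<lambda>v. \<Sum>i\<le>K. a i * integral\<^sup>L (\<nu> v) (moment i 0)) \<longlongrightarrow> integral\<^sup>L limit_measure p) to_infinity"
      unfolding sum[OF prob_limit_measure sets_limit_measure]
      by (intro tendsto_intros moment_limit)
    from tendstoD[OF this e3]
    show "eventually (\<lambda>v. dist (integral\<^sup>L (\<nu> v) f) (integral\<^sup>L limit_measure f) < e) to_infinity"
      using eventually_strip
    proof eventually_elim
      case (elim v)
      have N: "prob_space (\<nu> v)" "on_curve (\<nu> v)" using nu_prob elim by auto
      show ?case
        using near[OF N] near[OF prob_limit_measure sets_limit_measure] elim(1) sum[OF N]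
        unfolding dist_real_def by linarith
    qed
  qed
qed

text \<open>Limits along a trivial filter would not be unique. The witness lies far down on the
  middle line of the strip.\<close>

lemma to_infinity_nontrivial: "to_infinity \<noteq> bot"
proof
  assume "to_infinity = bot"
  then have "eventually (\<lambda>_. False) to_infinity" by simp
  then obtain b where b: "\<And>v. b \<le> norm v \<Longrightarrow> v \<notin> strip_below \<gamma>"
    by (auto simp: eventually_inf_principal eventually_at_infinity)
  define v where "v = Complex (1 / 2) (- \<bar>\<gamma> (1 / 2)\<bar> - \<bar>b\<bar> - 1)"
  have "\<bar>Im v\<bar> \<le> norm v" by (rule abs_Im_le_cmod)
  then have "b \<le> norm v" by (simp add: v_def)
  moreover have "v \<in> strip_below \<gamma>" by (simp add: v_def strip_below_def)
  ultimately show False using b by blast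
qed

lemma hitting_measure_infinity_eq:
  "hitting_measure_infinity P B (strip_below \<gamma>) \<Gamma> = limit_measure"
  unfolding hitting_measure_infinity_def
  by (rule the_equality[where a=limit_measure])
     (use weak_limit_nu weak_limit_unique[OF Gamma_borel to_infinity_nontrivial] in auto)

section \<open>Masses of the edges\<close>

abbreviation edge :: "nat \<Rightarrow> complex set" where
  "edge k \<equiv> closed_segment (Complex (t (k - 1)) (W (k - 1))) (Complex (t k) (W k))"

lemma edge_eq:
  assumes k: "k \<in> {1..n}"
  shows "edge k =
    {v. t (k - 1) \<le> Re v \<and> Re v \<le> t k \<and> Im v = \<gamma> (Re v)}"
proof -
  have tk: "t (k - 1) < t k" using t_mono[of "k - 1" k] k by auto
  have g: "\<gamma> s = (1 - (s - t (k - 1)) / (t k - t (k - 1))) * W (k - 1) + (s - t (k - 1)) / (t k - t (k - 1)) * W k"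
    if "t (k - 1) \<le> s" "s \<le> t k" for s
  proof -
    have "(t k - s) / (t k - t (k - 1)) = 1 - (s - t (k - 1)) / (t k - t (k - 1))"
      using tk by (simp add: field_simps)
    then show ?thesis using gamma_at[OF k that] by simp
  qed
  show ?thesis
  proof (intro set_eqI iffI)
    fix v assume "v \<in> edge k"
    then obtain u where u: "0 \<le> u" "u \<le> 1"
      and v: "v = (1 - u) *\<^sub>R Complex (t (k - 1)) (W (k - 1)) + u *\<^sub>R Complex (t k) (W k)"
      by (auto simp: in_segment)
    have R: "Re v = t (k - 1) + u * (t k - t (k - 1))" by (simp add: v algebra_simps)
    have I: "Im v = (1 - u) * W (k - 1) + u * W k" by (simp add: v)
    have "u * (t k - t (k - 1)) \<le> 1 * (t k - t (k - 1))"
      using u tk by (intro mult_right_mono) auto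
    moreover have "t (k - 1) + 1 * (t k - t (k - 1)) = t k" by simp
    ultimately have b2: "Re v \<le> t k" unfolding R by (metis add_left_mono)
    have b1: "t (k - 1) \<le> Re v" unfolding R using u tk by simp
    note b = b1 b2
    have "(Re v - t (k - 1)) / (t k - t (k - 1)) = u" unfolding R using tk by simp
    then show "v \<in> {v. t (k - 1) \<le> Re v \<and> Re v \<le> t k \<and> Im v = \<gamma> (Re v)}"
      using b g[OF b] I by simp
  next
    fix v assume "v \<in> {v. t (k - 1) \<le> Re v \<and> Re v \<le> t k \<and> Im v = \<gamma> (Re v)}"
    then have b: "t (k - 1) \<le> Re v" "Re v \<le> t k" and I: "Im v = \<gamma> (Re v)" by auto
    define u where "u = (Re v - t (k - 1)) / (t k - t (k - 1))"
    have u: "0 \<le> u" "u \<le> 1" unfolding u_def using b tk by (auto simp: field_simps)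
    have "Re v = t (k - 1) + u * (t k - t (k - 1))" unfolding u_def using tk by simp
    moreover have "Im v = (1 - u) * W (k - 1) + u * W k" using I g[OF b] by (simp only: u_def)
    ultimately have "v = (1 - u) *\<^sub>R Complex (t (k - 1)) (W (k - 1)) + u *\<^sub>R Complex (t k) (W k)"
      by (simp add: complex_eq_iff algebra_simps)
    then show "v \<in> edge k"
      using u by (auto simp: in_segment)
  qed
qed

text \<open>Outside the interval between the two pre-vertices, strict monotonicity of the real part
  places the image to the left or to the right of the edge.\<close>

lemma phi_edge_iff:
  assumes k: "k \<in> {1..n}" and x: "0 \<le> x" "x \<le> 1"
  shows "\<phi> (of_real x) \<in> edge k \<longleftrightarrow>
    z k \<le> x \<and> x \<le> z (k + 1)"
proof
  assume "\<phi> (of_real x) \<in> edge k"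
  then have b: "t (k - 1) \<le> Re (\<phi> (of_real x))" "Re (\<phi> (of_real x)) \<le> t k"
    unfolding edge_eq[OF k] by auto
  have z01: "0 \<le> z k" "z (k + 1) \<le> 1" using z_mono'[of 1 k] z_mono'[of "k + 1" "n + 1"] z k by auto
  have "Re (\<phi> (of_real (z k))) = t (k - 1)" "Re (\<phi> (of_real (z (k + 1)))) = t k"
    using Re_phi_vertex[of k] Re_phi_vertex[of "k + 1"] k by auto
  moreover have "z k \<le> 1" "0 \<le> z (k + 1)" using z_mono'[of k "k + 1"] z01 k by auto
  ultimately show "z k \<le> x \<and> x \<le> z (k + 1)"
    using b Re_phi_mono[of x "z k"] Re_phi_mono[of "z (k + 1)" x] z01 x by force
next
  assume "z k \<le> x \<and> x \<le> z (k + 1)"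
  then show "\<phi> (of_real x) \<in> edge k"
    unfolding edge_eq[OF k] using phi_edge_graph[OF k, of x] by auto
qed

text \<open>The half-angle formula gives \<open>(sin (pi * x / 2))\<^sup>2\<close>, and the sine is
  increasing from 0 to \<open>pi / 2\<close>.\<close>

lemma half_cos_le_iff:
  assumes x: "0 \<le> x" "x \<le> 1" and c: "0 \<le> c" "c \<le> 1"
  shows "c \<le> (1 - cos (pi * x)) / 2 \<longleftrightarrow> 2 / pi * arcsin (sqrt c) \<le> x"
    and "(1 - cos (pi * x)) / 2 \<le> c \<longleftrightarrow> x \<le> 2 / pi * arcsin (sqrt c)"
proof -
  define a where "a = arcsin (sqrt c)"
  have sc: "0 \<le> sqrt c" "sqrt c \<le> 1" "- 1 \<le> sqrt c" using c by (auto intro: order_trans[of _ 0])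
  have a: "0 \<le> a" "a \<le> pi / 2" "sin a = sqrt c"
    unfolding a_def using sc arcsin_le_arcsin[of 0 "sqrt c"] arcsin_ubound[of "sqrt c"] sin_arcsin[of "sqrt c"] by auto
  have e: "(1 - cos (pi * x)) / 2 = (sin (pi * x / 2))\<^sup>2"
    using cos_double_sin[of "pi * x / 2"] by simp
  have b: "0 \<le> pi * x / 2" "pi * x / 2 \<le> pi / 2" using x by (auto simp: mult_left_le)
  have s: "0 \<le> sin (pi * x / 2)" using b by (intro sin_ge_zero) auto
  have ca: "c = (sin a)\<^sup>2" using a(3) c by simp
  have sa: "0 \<le> sin a" using a(3) sc by simp
  have "c \<le> (1 - cos (pi * x)) / 2 \<longleftrightarrow> sin a \<le> sin (pi * x / 2)"
    unfolding e ca using s sa by (simp add: power2_le_iff_abs_le abs_le_square_iff[symmetric])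
  also have "\<dots> \<longleftrightarrow> a \<le> pi * x / 2" using a b by (intro sin_mono_le_eq) auto
  also have "\<dots> \<longleftrightarrow> 2 / pi * a \<le> x" by (simp add: field_simps)
  finally show "c \<le> (1 - cos (pi * x)) / 2 \<longleftrightarrow> 2 / pi * arcsin (sqrt c) \<le> x" by (simp add: a_def)
  have "(1 - cos (pi * x)) / 2 \<le> c \<longleftrightarrow> sin (pi * x / 2) \<le> sin a"
    unfolding e ca using s sa by (simp add: power2_le_iff_abs_le abs_le_square_iff[symmetric])
  also have "\<dots> \<longleftrightarrow> pi * x / 2 \<le> a" using a b by (intro sin_mono_le_eq) auto
  also have "\<dots> \<longleftrightarrow> x \<le> 2 / pi * a" by (simp add: field_simps)
  finally show "(1 - cos (pi * x)) / 2 \<le> c \<longleftrightarrow> x \<le> 2 / pi * arcsin (sqrt c)" by (simp add: a_def)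
qed

text \<open>The edge pulls back under \<open>curve_map\<close> to an interval of parameters, and
  under the uniform distribution its mass is the length of that interval.\<close>

lemma measure_edge:
  assumes k: "k \<in> {1..n}"
  shows "measure limit_measure (edge k) =
    2 / pi * (arcsin (sqrt (z (k + 1))) - arcsin (sqrt (z k)))"
proof -
  let ?E = "edge k"
  \<comment> \<open>\<open>a j\<close> is the parameter that \<open>curve_map\<close> sends to the
    \<open>j\<close>-th vertex.\<close>
  define a where "a j = 2 / pi * arcsin (sqrt (z j))" for j
  have z01: "0 \<le> z j" "z j \<le> 1" if "j \<in> {1..n+1}" for j
    using z_mono'[of 1 j] z_mono'[of j "n + 1"] z that by auto
  have a01: "0 \<le> a j" "a j \<le> 1" if "j \<in> {1..n+1}" for j
  proof -
    have "- 1 \<le> sqrt (z j)" using z01[OF that] by (auto intro: order_trans[of _ 0])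
    then show "0 \<le> a j" "a j \<le> 1"
      using arcsin_le_arcsin[of 0 "sqrt (z j)"] arcsin_ubound[of "sqrt (z j)"] z01[OF that]
      by (auto simp: a_def field_simps)
  qed
  have k': "k \<in> {1..n+1}" "k + 1 \<in> {1..n+1}" using k by auto
  have "- 1 \<le> sqrt (z k)" using real_sqrt_ge_zero[OF z01(1)[OF k'(1)]] by linarith
  then have "arcsin (sqrt (z k)) \<le> arcsin (sqrt (z (k + 1)))"
    using z01[OF k'(1)] z01[OF k'(2)] z_mono'[of k "k + 1"] k by (intro arcsin_le_arcsin) (auto intro: order_trans)
  then have ak: "a k \<le> a (k + 1)" by (simp add: a_def divide_right_mono)
  have EG: "?E \<subseteq> \<Gamma>"
  proof
    fix v assume "v \<in> ?E"
    then have "t (k - 1) \<le> Re v" "Re v \<le> t k" "Im v = \<gamma> (Re v)" unfolding edge_eq[OF k] by auto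
    moreover have "k - 1 \<le> n" using k by auto
    then have "0 \<le> t (k - 1)" using t_mono[of 0 "k - 1"] t(1) by (cases "k - 1 = 0") auto
    moreover have "t k \<le> 1" using t_mono[of k n] t k by (cases "k = n") auto
    ultimately show "v \<in> \<Gamma>" unfolding curve_graph_def
      by (intro image_eqI[of _ _ "Re v"]) (auto simp: complex_eq_iff)
  qed
  have E: "?E \<in> sets (restrict_space borel \<Gamma>)"
    using EG Gamma_borel by (simp add: sets_restrict_space_iff)
  have "curve_map -` ?E \<inter> {0..1} = {a k..a (k + 1)}"
  proof (intro set_eqI)
    fix x
    show "x \<in> curve_map -` ?E \<inter> {0..1} \<longleftrightarrow> x \<in> {a k..a (k + 1)}"
    proof (cases "x \<in> {0..1}")
      case True
      then have x: "0 \<le> x" "x \<le> 1" by auto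
      have "curve_map x \<in> ?E \<longleftrightarrow> z k \<le> (1 - cos (pi * x)) / 2 \<and> (1 - cos (pi * x)) / 2 \<le> z (k + 1)"
        unfolding curve_map_def by (rule phi_edge_iff[OF k cos_unit])
      also have "\<dots> \<longleftrightarrow> a k \<le> x \<and> x \<le> a (k + 1)"
        using half_cos_le_iff(1)[OF x z01[OF k'(1)]] half_cos_le_iff(2)[OF x z01[OF k'(2)]]
        by (simp only: a_def)
      finally show ?thesis using True by auto
    next
      case False then show ?thesis using a01[OF k'(1)] a01[OF k'(2)] by auto
    qed
  qed
  then have "measure limit_measure ?E = measure (restrict_space lborel {0..1}) {a k..a (k + 1)}"
    unfolding limit_measure_def by (subst measure_distr[OF curve_map_measurable E]) (simp add: space_restrict_space)
  also have "\<dots> = measure lborel {a k..a (k + 1)}"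
    using a01[OF k'(1)] a01[OF k'(2)] by (subst measure_restrict_space) auto
  also have "\<dots> = a (k + 1) - a k" using ak by simp
  finally show ?thesis by (simp add: a_def right_diff_distrib)
qed

end

theorem corollary4p2:
  fixes n :: nat and t W z :: "nat \<Rightarrow> real" and \<gamma> :: "real \<Rightarrow> real"
    and U \<Gamma> :: "complex set" and \<phi> :: "complex \<Rightarrow> complex"
    and P :: "complex \<Rightarrow> 'a measure" and B :: "real \<Rightarrow> 'a \<Rightarrow> complex"
  assumes n: "1 \<le> n"
    and t: "t 0 = 0" "t n = 1" "strict_mono_on {0..n} t"
    and W: "W 0 = 0" "W n = 0"
    and \<gamma>: "\<gamma> = interpolant n t W"
    and U: "U = strip_below \<gamma>"
    and \<Gamma>: "\<Gamma> = curve_graph \<gamma>"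
    and B: "\<And>x. planar_brownian_motion (P x) B x"
    and z: "z 1 = 0" "z (n + 1) = 1" "strict_mono_on {1..n + 1} z"
    and \<phi>: "schwarz_christoffel_map n (vertex t W) U z \<phi>"
  shows "\<forall>k\<in>{1..n}.
    measure (hitting_measure_infinity P B U \<Gamma>)
      (closed_segment (Complex (t (k - 1)) (W (k - 1))) (Complex (t k) (W k)))
    = 2 / pi * (arcsin (sqrt (z (k + 1))) - arcsin (sqrt (z k)))"
proof -
  interpret reflected_brownian n t W z \<gamma> \<phi> P B
    using n t W \<gamma> z \<phi> B unfolding U by unfold_locales
  show ?thesis
    unfolding U \<Gamma> hitting_measure_infinity_eq using measure_edge by blast
qed

end
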